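(* Let $X=X(\Sigma)$ be a $\mathbb Q$-factorial complete $n$-dimensional toric variety of rank $r$. (i) Given a (reduced) fan matrix $V$ of $X$, the matrix $Q=\mathcal G(V)$ is a reduced weight matrix of $X$, which can be obtained as the last $r$ rows of a matrix $U_V\in\mathrm{GL}_{n+r}(\mathbb Z)$ such that $U_V\cdot V^T$ is a matrix in Hermite normal form. (ii) Conversely, if $Q$ is a reduced weight matrix of $X$ and the divisor class group $\mathrm{Cl}(X)$ is a free abelian group, then $V=\mathcal G(Q)$ is a $CF$-matrix which is a fan matrix of $X$, given by the last $n$ rows of a matrix $U_Q\in\mathrm{GL}_{n+r}(\mathbb Z)$ such that $U_Q\cdot Q^T$ is a matrix in Hermite normal form.
   Context: $N$ is a lattice of rank $n$ with dual $M$, and $\Sigma$ is a fan in $N\otimes\mathbb R$ with all cones simplicial and with union $N\otimes\mathbb R$ ($\mathbb Q$-factoriality and completeness of $X$). The rank is $r=\mathrm{rk}\,\mathrm{Pic}(X)\ge1$ and $\Sigma$ has $n+r$ rays $\rho_1,\dots,\rho_{n+r}$; $\mathbf v_j$ is the generator of the monoid $\rho_j\cap N$ and $D_j$ the corresponding torus-invariant prime divisor. A (reduced) fan matrix of $X$ is the $n\times(n+r)$ matrix $V=(\mathbf v_1,\dots,\mathbf v_{n+r})$ with coordinates in some $\mathbb Z$-basis of $N$. With $\mathcal W_T(X)=\bigoplus_j\mathbb ZD_j$ there is an exact sequence $0\to M\xrightarrow{div}\mathcal W_T(X)\xrightarrow{d}\mathrm{Cl}(X)\to0$, $div(\mathbf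 u)=\sum_j\langle\mathbf u,\mathbf v_j\rangle D_j$. A weight matrix of $X$ is an $r\times(n+r)$ integer matrix $Q$ such that $Q^T$ represents the dual map $d^\vee:\mathrm{Hom}(\mathrm{Cl}(X),\mathbb Z)\to\mathrm{Hom}(\mathcal W_T(X),\mathbb Z)=\mathbb Z^{n+r}$ with respect to some $\mathbb Z$-basis of $\mathrm{Hom}(\mathrm{Cl}(X),\mathbb Z)$ and the dual basis of $D_1,\dots,D_{n+r}$. It is reduced if for every $i$, $\mathbb Z^{n+r-1}/\mathcal L_r(Q^i)$ is torsion free, where $Q^i$ is $Q$ with its $i$-th column removed and $\mathcal L_r$ denotes the lattice spanned by the rows. Gale dual: for an $a\times(a+b)$ integer matrix $A$ of rank $a$, $\mathcal G(A)$ is a $b\times(a+b)$ integer matrix whose rows form a $\mathbb Z$-basis of $\ker(A)\subseteq\mathbb Z^{a+b}$; it is well defined up to left multiplication by $\mathrm{GL}_b(\mathbb Z)$. A $CF$-matrix is an $n\times(n+r)$ integer matrix $V$ such that: $\mathrm{rk}(V)=n$; the cone generated by its columns is $\mathbb R^n$; all its columns are non-zero; no column is a positive real multiple of another column; and its columns generate $\mathbb Z^n$ as a group. Hermite normal form (HNF): an integer $p\times q$ matrix $(m_{ij})$ is in HNF if there are $s\le p$ and a strictly increasing $f:\{1,\dots,s\}\to\{1,\dots,q\}$ such that for $1\le i\le s$: $m_{i,f(i)}\ge1$, $m_{ij}=0$ if $j<f(i)$, and $0\le m_{i,f(k)}<m_{k,f(k)}$ if $i<k\leq s$; and the last $p-s$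 rows are zero. *)

theory Defs
  imports
    "HOL-Analysis.Analysis"
    "HOL-Algebra.Free_Abelian_Groups"
    "HOL-Algebra.Coset"
    "Jordan_Normal_Form.DL_Rank"
    "Jordan_Normal_Form.Matrix_Kernel"
begin

hide_const (open) Finite_Cartesian_Product.row Finite_Cartesian_Product.column
  Finite_Cartesian_Product.rows Finite_Cartesian_Product.columns

section \<open>Abelian groups\<close>

definition Z_combination ::
  "('g, 'm) monoid_scheme \<Rightarrow> nat \<Rightarrow> (nat \<Rightarrow> 'g) \<Rightarrow> (nat \<Rightarrow> int) \<Rightarrow> 'g" where
  "Z_combination G k b c = finprod G (\<lambda>i. b i [^]\<^bsub>G\<^esub> c i) {..<k}"

definition Z_independent :: "('g, 'm) monoid_scheme \<Rightarrow> nat \<Rightarrow> (nat \<Rightarrow> 'g) \<Rightarrow> bool" where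
  "Z_independent G k b \<longleftrightarrow> b \<in> {..<k} \<rightarrow> carrier G \<and>
     (\<forall>c. Z_combination G k b c = \<one>\<^bsub>G\<^esub> \<longrightarrow> (\<forall>i<k. c i = 0))"

definition Z_basis :: "('g, 'm) monoid_scheme \<Rightarrow> nat \<Rightarrow> (nat \<Rightarrow> 'g) \<Rightarrow> bool" where
  "Z_basis G k b \<longleftrightarrow> Z_independent G k b \<and> (\<forall>x\<in>carrier G. \<exists>c. x = Z_combination G k b c)"

definition abelian_rank :: "('g, 'm) monoid_scheme \<Rightarrow> nat" where
  "abelian_rank G = (GREATEST k. \<exists>b. Z_independent G k b)"

definition torsion_free :: "('g, 'm) monoid_scheme \<Rightarrow> bool" where
  "torsion_free G \<longleftrightarrow> (\<forall>x\<in>carrier G. \<forall>k::nat. k > 0 \<longrightarrow> x [^]\<^bsub>G\<^esub> k = \<one>\<^bsub>G\<^esub> \<longrightarrow> x = \<one>\<^bsub>G\<^esub>)"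

text \<open>The type of the index set \<open>S\<close> is no restriction: a basis of \<open>G\<close> is a subset of \<open>G\<close>.\<close>

definition free_abelian :: "('g, 'm) monoid_scheme \<Rightarrow> bool" where
  "free_abelian G \<longleftrightarrow> (\<exists>S :: 'g set. G \<cong> free_Abelian_group S)"

text \<open>The group \<open>Hom(G, \<int>)\<close>. Homomorphisms are taken to be \<open>undefined\<close> outside of
  \<open>carrier G\<close>, so that equality of functions is equality of homomorphisms.\<close>

definition int_dual :: "('g, 'm) monoid_scheme \<Rightarrow> ('g \<Rightarrow> int) monoid" where
  "int_dual G = \<lparr>carrier = hom G integer_group \<inter> extensional (carrier G),
     mult = (\<lambda>f g. restrict (\<lambda>x. f x + g x) (carrier G)),
     one = restrict (\<lambda>x. 0) (carrier G)\<rparr>"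


section \<open>Integer matrices\<close>

definition rank_int :: "int mat \<Rightarrow> nat" where
  "rank_int A = vec_space.rank (dim_row A) (map_mat rat_of_int A)"

definition GL_Z :: "nat \<Rightarrow> int mat set" where
  "GL_Z m = {U \<in> carrier_mat m m. invertible_mat U}"

definition kernel_group :: "int mat \<Rightarrow> int vec monoid" where
  "kernel_group A = (monoid_vec TYPE(int) (dim_col A))\<lparr>carrier := mat_kernel A\<rparr>"

text \<open>\<open>gale_dual a b A G\<close>: the matrix \<open>G\<close> is one of the possible choices for \<open>\<G>(A)\<close>, where \<open>A\<close> is
  \<open>a \<times> (a + b)\<close> of rank \<open>a\<close>.\<close>

definition gale_dual :: "nat \<Rightarrow> nat \<Rightarrow> int mat \<Rightarrow> int mat \<Rightarrow> bool" where
  "gale_dual a b A G \<longleftrightarrow> A \<in> carrier_mat a (a + b) \<and> rank_int A = a \<and>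
     G \<in> carrier_mat b (a + b) \<and> Z_basis (kernel_group A) b (Matrix.row G)"

definition row_lattice :: "int mat \<Rightarrow> int vec set" where
  "row_lattice A = generate (monoid_vec TYPE(int) (dim_col A)) (set (Matrix.rows A))"

definition delete_col :: "nat \<Rightarrow> int mat \<Rightarrow> int mat" where
  "delete_col i A = mat (dim_row A) (dim_col A - 1)
     (\<lambda>(k, j). A $$ (k, if j < i then j else Suc j))"

definition last_rows :: "nat \<Rightarrow> int mat \<Rightarrow> int mat" where
  "last_rows k A = mat k (dim_col A) (\<lambda>(i, j). A $$ (dim_row A - k + i, j))"

text \<open>Row and column indices start from \<open>0\<close>.\<close>

definition hermite_normal_form :: "int mat \<Rightarrow> bool" where
  "hermite_normal_form A \<longleftrightarrow>
     (\<exists>s \<le> dim_row A. \<exists>f :: nat \<Rightarrow> nat. f \<in> {..<s} \<rightarrow> {..<dim_col A} \<and> strict_mono_on {..<s} f \<and>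
        (\<forall>i<s. A $$ (i, f i) \<ge> 1 \<and> (\<forall>j<f i. A $$ (i, j) = 0)) \<and>
        (\<forall>i k. i < k \<and> k < s \<longrightarrow> 0 \<le> A $$ (i, f k) \<and> A $$ (i, f k) < A $$ (k, f k)) \<and>
        (\<forall>i j. s \<le> i \<and> i < dim_row A \<and> j < dim_col A \<longrightarrow> A $$ (i, j) = 0))"

definition CF_matrix :: "nat \<Rightarrow> nat \<Rightarrow> int mat \<Rightarrow> bool" where
  "CF_matrix n r V \<longleftrightarrow> V \<in> carrier_mat n (n + r) \<and> rank_int V = n \<and>
     {map_mat real_of_int V *\<^sub>v c | c. c \<in> carrier_vec (n + r) \<and> (\<forall>j<n + r. vec_index c j \<ge> 0)}
       = carrier_vec n \<and>
     (\<forall>j<n + r. col V j \<noteq> 0\<^sub>v n) \<and>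
     (\<forall>i<n + r. \<forall>j<n + r. i \<noteq> j \<longrightarrow>
        \<not> (\<exists>t>0. map_vec real_of_int (col V i) = t \<cdot>\<^sub>v map_vec real_of_int (col V j))) \<and>
     generate (monoid_vec TYPE(int) n) (set (cols V)) = carrier_vec n"


section \<open>Lattices, cones and fans\<close>

text \<open>A lattice \<open>N\<close> is realised inside the real vector space \<open>N \<otimes> \<real>\<close>, which is the ambient
  type; its rank is the dimension of that type.\<close>

definition lattice_in :: "'a::euclidean_space set \<Rightarrow> bool" where
  "lattice_in N \<longleftrightarrow> (\<exists>B. independent B \<and> span B = UNIV \<and>
     N = {\<Sum>x\<in>B. real_of_int (c x) *\<^sub>R x | c. True})"

definition lattice_group :: "'a::euclidean_space set \<Rightarrow> 'a monoid" where
  "lattice_group N = \<lparr>carrier = N, mult = (+), one = 0\<rparr>"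

definition rational_cone :: "'a::euclidean_space set \<Rightarrow> 'a set \<Rightarrow> bool" where
  "rational_cone N \<sigma> \<longleftrightarrow> (\<exists>S. finite S \<and> S \<subseteq> N \<and> \<sigma> = convex_cone hull S)"

definition simplicial_cone :: "'a::euclidean_space set \<Rightarrow> 'a set \<Rightarrow> bool" where
  "simplicial_cone N \<sigma> \<longleftrightarrow>
     (\<exists>S. finite S \<and> S \<subseteq> N \<and> independent S \<and> \<sigma> = convex_cone hull S)"

text \<open>For a polyhedral cone the faces in the sense of toric geometry are the non-empty convex
  faces (the library counts \<open>{}\<close> as a face).\<close>

definition fan :: "'a::euclidean_space set \<Rightarrow> 'a set set \<Rightarrow> bool" where
  "fan N \<Sigma> \<longleftrightarrow> finite \<Sigma> \<and> \<Sigma> \<noteq> {} \<and>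
     (\<forall>\<sigma>\<in>\<Sigma>. rational_cone N \<sigma> \<and> \<sigma> \<inter> uminus ` \<sigma> = {0}) \<and>
     (\<forall>\<sigma>\<in>\<Sigma>. \<forall>\<tau>. \<tau> face_of \<sigma> \<and> \<tau> \<noteq> {} \<longrightarrow> \<tau> \<in> \<Sigma>) \<and>
     (\<forall>\<sigma>\<in>\<Sigma>. \<forall>\<tau>\<in>\<Sigma>. (\<sigma> \<inter> \<tau>) face_of \<sigma> \<and> (\<sigma> \<inter> \<tau>) face_of \<tau>)"

definition rays :: "'a::euclidean_space set set \<Rightarrow> 'a set set" where
  "rays \<Sigma> = {\<rho> \<in> \<Sigma>. dim \<rho> = 1}"

definition ray_generator :: "'a::euclidean_space set \<Rightarrow> 'a set \<Rightarrow> 'a" where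
  "ray_generator N \<rho> = (THE v. \<rho> \<inter> N = {real k *\<^sub>R v | k :: nat. True})"


section \<open>Divisors on the toric variety of a fan\<close>

text \<open>The torus-invariant prime divisor of a ray \<open>\<rho>\<close> is the generator \<open>frag_of \<rho>\<close> of the free
  abelian group \<open>torus_divisors \<Sigma>\<close> on the rays.\<close>

abbreviation torus_divisors :: "'a::euclidean_space set set \<Rightarrow> ('a set \<Rightarrow>\<^sub>0 int) monoid" where
  "torus_divisors \<Sigma> \<equiv> free_Abelian_group (rays \<Sigma>)"

definition div_map ::
  "'a::euclidean_space set \<Rightarrow> 'a set set \<Rightarrow> ('a \<Rightarrow> int) \<Rightarrow> ('a set \<Rightarrow>\<^sub>0 int)" where
  "div_map N \<Sigma> u = (\<Sum>\<rho>\<in>rays \<Sigma>. frag_cmul (u (ray_generator N \<rho>)) (frag_of \<rho>))"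

definition principal_divisors ::
  "'a::euclidean_space set \<Rightarrow> 'a set set \<Rightarrow> ('a set \<Rightarrow>\<^sub>0 int) set" where
  "principal_divisors N \<Sigma> = div_map N \<Sigma> ` carrier (int_dual (lattice_group N))"

definition class_group ::
  "'a::euclidean_space set \<Rightarrow> 'a set set \<Rightarrow> ('a set \<Rightarrow>\<^sub>0 int) set monoid" where
  "class_group N \<Sigma> = torus_divisors \<Sigma> Mod principal_divisors N \<Sigma>"

definition divisor_class ::
  "'a::euclidean_space set \<Rightarrow> 'a set set \<Rightarrow> ('a set \<Rightarrow>\<^sub>0 int) \<Rightarrow> ('a set \<Rightarrow>\<^sub>0 int) set" where
  "divisor_class N \<Sigma> D = principal_divisors N \<Sigma> #>\<^bsub>torus_divisors \<Sigma>\<^esub> D"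

text \<open>A torus-invariant divisor is Cartier iff on the affine chart of every cone of the fan it is
  the divisor of a character.\<close>

definition cartier_divisors ::
  "'a::euclidean_space set \<Rightarrow> 'a set set \<Rightarrow> ('a set \<Rightarrow>\<^sub>0 int) set" where
  "cartier_divisors N \<Sigma> = {D \<in> carrier (torus_divisors \<Sigma>).
     \<forall>\<sigma>\<in>\<Sigma>. \<exists>u\<in>carrier (int_dual (lattice_group N)).
       \<forall>\<rho>\<in>rays \<Sigma>. \<rho> \<subseteq> \<sigma> \<longrightarrow> Poly_Mapping.lookup D \<rho> = u (ray_generator N \<rho>)}"

definition picard_group ::
  "'a::euclidean_space set \<Rightarrow> 'a set set \<Rightarrow> ('a set \<Rightarrow>\<^sub>0 int) set monoid" where
  "picard_group N \<Sigma> =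
     (torus_divisors \<Sigma>)\<lparr>carrier := cartier_divisors N \<Sigma>\<rparr> Mod principal_divisors N \<Sigma>"


section \<open>Fan matrices and weight matrices\<close>

text \<open>Both depend on the enumeration \<open>\<rho> 0, \<dots>, \<rho> (m - 1)\<close> of the rays.\<close>

definition fan_matrix ::
  "'a::euclidean_space set \<Rightarrow> nat \<Rightarrow> (nat \<Rightarrow> 'a set) \<Rightarrow> int mat \<Rightarrow> bool" where
  "fan_matrix N m \<rho> V \<longleftrightarrow> V \<in> carrier_mat DIM('a) m \<and>
     (\<exists>b. Z_basis (lattice_group N) DIM('a) b \<and>
        (\<forall>j<m. ray_generator N (\<rho> j) = (\<Sum>i<DIM('a). real_of_int (V $$ (i, j)) *\<^sub>R b i)))"

text \<open>The \<open>j\<close>-th coordinate of \<open>\<phi> \<circ> d\<close>, the image of \<open>\<phi> \<in> Hom(Cl, \<int>)\<close> under the dual of the class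
  map \<open>d\<close>, with respect to the dual basis of the prime divisors is \<open>\<phi> (d (D\<^sub>j))\<close>.\<close>

definition weight_matrix ::
  "'a::euclidean_space set \<Rightarrow> 'a set set \<Rightarrow> nat \<Rightarrow> nat \<Rightarrow> (nat \<Rightarrow> 'a set) \<Rightarrow> int mat \<Rightarrow> bool" where
  "weight_matrix N \<Sigma> r m \<rho> Q \<longleftrightarrow> Q \<in> carrier_mat r m \<and>
     (\<exists>\<phi>. Z_basis (int_dual (class_group N \<Sigma>)) r \<phi> \<and>
        (\<forall>i<r. \<forall>j<m. Q $$ (i, j) = \<phi> i (divisor_class N \<Sigma> (frag_of (\<rho> j)))))"

definition reduced_weight_matrix ::
  "'a::euclidean_space set \<Rightarrow> 'a set set \<Rightarrow> nat \<Rightarrow> nat \<Rightarrow> (nat \<Rightarrow> 'a set) \<Rightarrow> int mat \<Rightarrow> bool" where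
  "reduced_weight_matrix N \<Sigma> r m \<rho> Q \<longleftrightarrow> weight_matrix N \<Sigma> r m \<rho> Q \<and>
     (\<forall>i<m. torsion_free (monoid_vec TYPE(int) (m - 1) Mod row_lattice (delete_col i Q)))"

end

theory Submission
  imports Defs
begin

text \<open>
  Let \<open>V\<close> be a fan matrix. The whole statement rests on reading both kinds of matrices through the
  exact sequence of the class group. In coordinates the map \<open>div\<close> from characters to divisors is
  \<open>V\<^sup>T\<close>, so the principal divisors are the integer combinations of the rows of \<open>V\<close>, and a homomorphism from
  the class group to the integers is the same as a vector of values on the prime divisors that lies in
  the kernel of \<open>V\<close> (\<open>weights_iso\<close>). Hence the weight matrices are exactly the matrices whose rows form
  a basis of that kernel, that is, the Gale duals of \<open>V\<close> (\<open>weight_matrix_iff\<close>).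

  That such a matrix \<open>Q\<close> is reduced comes from the primitivity of the ray generators
  (\<open>torsion_free_delete_col\<close>): if all entries of \<open>z\<close> but one are divisible by \<open>k\<close> and \<open>V z = 0\<close>, then the
  remaining entry, a coefficient of a primitive vector, is divisible by \<open>k\<close> too.

  For the converse, a vector orthogonal to the rows of \<open>Q\<close> has a non-zero multiple in the row lattice of
  \<open>V\<close> (\<open>multiple_in_row_lattice\<close>); it represents a torsion element of the class group. If the class group
  is free, it is therefore in the row lattice itself, so that \<open>V\<close> is a Gale dual of \<open>Q\<close>
  (\<open>gale_dual_of_weight_matrix\<close>). Every other Gale dual of \<open>Q\<close> differs from \<open>V\<close> by a unimodular matrix
  (\<open>kernel_basis_change\<close>), which can be absorbed into the basis of the lattice
  (\<open>fan_matrix_change_basis\<close>), and so is a fan matrix. Of the conditions on a \<open>CF\<close>-matrix all but the last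
  hold for any fan matrix of a complete simplicial fan: each ray of a simplicial cone is one of its faces,
  so the ray generators span the space positively (\<open>fan_rays_positively_span\<close>), and they lie on distinct
  rays. The columns generate the lattice because the matrix consists of rows of a unimodular matrix
  (\<open>last_rows_surj\<close>).

  The statements about Hermite normal forms belong to linear algebra over the integers and are the
  same in both directions. If \<open>A\<close> has full row rank, a unimodular \<open>U\<close> with \<open>U A\<^sup>T\<close> in Hermite normal form
  exists by Euclid's algorithm (\<open>hermite_upto_exists\<close>), and \<open>U A\<^sup>T\<close> has a pivot in every column
  (\<open>full_hermite_exists\<close>). Then the last rows of \<open>U\<close> are a basis of the kernel of \<open>A\<close>, and exchanging them
  for any other basis preserves both properties of \<open>U\<close> (\<open>gale_dual_hermite\<close>).
\<close>

section \<open>Integer row operations and the Hermite normal form\<close>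

lemma GL_Z_iff:
  "U \<in> GL_Z m \<longleftrightarrow> U \<in> carrier_mat m m \<and> (\<exists>W\<in>carrier_mat m m. U * W = 1\<^sub>m m \<and> W * U = 1\<^sub>m m)"
proof
  assume "U \<in> GL_Z m"
  then obtain W where U: "U \<in> carrier_mat m m" and "inverts_mat U W" "inverts_mat W U"
    by (auto simp: GL_Z_def invertible_mat_def)
  then have W: "U * W = 1\<^sub>m m" "W * U = 1\<^sub>m (dim_row W)"
    by (auto simp: inverts_mat_def)
  have "dim_col W = m" "dim_row W = m"
    using arg_cong[OF W(1), of dim_col] arg_cong[OF W(2), of dim_col] U by auto
  with U W show "U \<in> carrier_mat m m \<and> (\<exists>W\<in>carrier_mat m m. U * W = 1\<^sub>m m \<and> W * U = 1\<^sub>m m)"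
    by (auto intro!: bexI[of _ W])
next
  assume "U \<in> carrier_mat m m \<and> (\<exists>W\<in>carrier_mat m m. U * W = 1\<^sub>m m \<and> W * U = 1\<^sub>m m)"
  then show "U \<in> GL_Z m"
    by (auto simp: GL_Z_def invertible_mat_def inverts_mat_def square_mat.simps)
qed

lemma GL_Z_carrier: "U \<in> GL_Z m \<Longrightarrow> U \<in> carrier_mat m m"
  by (simp add: GL_Z_def)

lemma GL_Z_one: "1\<^sub>m m \<in> GL_Z m"
  by (auto simp: GL_Z_iff intro!: bexI[of _ "1\<^sub>m m"])

lemma GL_Z_mult:
  assumes "U \<in> GL_Z m" "W \<in> GL_Z m"
  shows "U * W \<in> GL_Z m"
proof -
  obtain U' W' where *: "U \<in> carrier_mat m m" "W \<in> carrier_mat m m" "U' \<in> carrier_mat m m"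
     "W' \<in> carrier_mat m m" "U * U' = 1\<^sub>m m" "U' * U = 1\<^sub>m m" "W * W' = 1\<^sub>m m" "W' * W = 1\<^sub>m m"
    using assms unfolding GL_Z_iff by metis
  have "(U * W) * (W' * U') = U * (W * (W' * U'))"
    using * by (intro assoc_mult_mat) auto
  also have "W * (W' * U') = (W * W') * U'"
    using * by (intro assoc_mult_mat[symmetric]) auto
  also have "U * \<dots> = 1\<^sub>m m" using * by simp
  finally have 1: "(U * W) * (W' * U') = 1\<^sub>m m" .
  have "(W' * U') * (U * W) = W' * (U' * (U * W))"
    using * by (intro assoc_mult_mat) auto
  also have "U' * (U * W) = (U' * U) * W"
    using * by (intro assoc_mult_mat[symmetric]) auto
  also have "W' * \<dots> = 1\<^sub>m m" using * by simp
  finally have 2: "(W' * U') * (U * W) = 1\<^sub>m m" .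
  show ?thesis
    using * unfolding GL_Z_iff by (intro conjI bexI[of _ "W' * U'"] 1 2) auto
qed

text \<open>Left multiplication by \<open>shear m s c\<close> adds \<open>c i\<close> times row \<open>s\<close> to row \<open>i\<close>, for all \<open>i\<close> at once. For
\<open>c s = 0\<close> this is an ordinary elementary operation; for \<open>c s = - 2\<close> it also changes the sign of
row \<open>s\<close>, so that only swaps are needed in addition.\<close>

definition shear :: "nat \<Rightarrow> nat \<Rightarrow> (nat \<Rightarrow> int) \<Rightarrow> int mat" where
  "shear m s c = mat m m (\<lambda>(i, l). (if i = l then 1 else 0) + (if l = s then c i else 0))"

lemma shear_mult_index:
  assumes "A \<in> carrier_mat m q" "s < m" "i < m" "k < q"
  shows "(shear m s c * A) $$ (i, k) = A $$ (i, k) + c i * A $$ (s, k)"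
proof -
  have "(shear m s c * A) $$ (i, k)
      = (\<Sum>l<m. ((if i = l then 1 else 0) + (if l = s then c i else 0)) * A $$ (l, k))"
    using assms unfolding shear_def by (simp add: scalar_prod_def lessThan_atLeast0)
  also have "\<dots> = (\<Sum>l<m. (if i = l then A $$ (l, k) else 0) + (if l = s then c i * A $$ (l, k) else 0))"
    by (intro sum.cong) (auto simp: distrib_right)
  also have "\<dots> = A $$ (i, k) + c i * A $$ (s, k)"
    using assms by (simp add: sum.distrib)
  finally show ?thesis .
qed

text \<open>The inverse is a shear too: with \<open>- c\<close> if \<open>c s = 0\<close>, and with \<open>c\<close> itself if \<open>c s = - 2\<close>, because
then row \<open>s\<close> has changed its sign when it is added for the second time.\<close>

lemma shear_GL_Z:
  assumes "s < m" "c s = 0 \<or> c s = - 2"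
  shows "shear m s c \<in> GL_Z m"
proof -
  define d where "d = (if c s = 0 then (\<lambda>i. - c i) else c)"
  have carr: "shear m s e \<in> carrier_mat m m" for e by (simp add: shear_def)
  have "shear m s c * shear m s d = 1\<^sub>m m"
    by (rule eq_matI, insert assms)
       (auto simp: shear_mult_index[OF carr], auto simp: shear_def d_def)
  moreover have "shear m s d * shear m s c = 1\<^sub>m m"
    by (rule eq_matI, insert assms)
       (auto simp: shear_mult_index[OF carr], auto simp: shear_def d_def)
  ultimately show ?thesis using carr by (auto simp: GL_Z_iff intro!: bexI[of _ "shear m s d"])
qed

text \<open>\<open>B\<close> arises from \<open>A\<close> by row operations on the rows from \<open>s\<close> on. The last clause is what keeps an
echelon form intact that has been reached in some of the columns: there the rows from \<open>s\<close> on
vanish, and they go on vanishing.\<close>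

definition lower_equiv :: "nat \<Rightarrow> int mat \<Rightarrow> int mat \<Rightarrow> bool" where
  "lower_equiv s A B \<longleftrightarrow> (\<exists>U\<in>GL_Z (dim_row A). B = U * A) \<and>
     (\<forall>k<dim_col A. (\<forall>i<s. B $$ (i, k) = A $$ (i, k)) \<and>
        ((\<forall>i\<in>{s..<dim_row A}. A $$ (i, k) = 0) \<longrightarrow> (\<forall>i\<in>{s..<dim_row A}. B $$ (i, k) = 0)))"

lemma lower_equiv_carrier:
  "lower_equiv s A B \<Longrightarrow> A \<in> carrier_mat m q \<Longrightarrow> B \<in> carrier_mat m q"
  by (auto simp: lower_equiv_def GL_Z_def)

lemma lower_equiv_refl: "lower_equiv s A A"
  by (auto simp: lower_equiv_def intro!: bexI[of _ "1\<^sub>m (dim_row A)"] GL_Z_one)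

lemma lower_equiv_trans:
  assumes "lower_equiv s A B" "lower_equiv s B C"
  shows "lower_equiv s A C"
proof -
  have B: "dim_row B = dim_row A" "dim_col B = dim_col A"
    using lower_equiv_carrier[OF assms(1)] by auto
  obtain U W where "U \<in> GL_Z (dim_row A)" "B = U * A" "W \<in> GL_Z (dim_row A)" "C = W * B"
    using assms B unfolding lower_equiv_def by auto
  then have "\<exists>U\<in>GL_Z (dim_row A). C = U * A"
    by (intro bexI[of _ "W * U"])
       (auto intro!: GL_Z_mult assoc_mult_mat[symmetric] GL_Z_carrier)
  moreover have "(\<forall>i<s. C $$ (i, k) = A $$ (i, k)) \<and>
      ((\<forall>i\<in>{s..<dim_row A}. A $$ (i, k) = 0) \<longrightarrow> (\<forall>i\<in>{s..<dim_row A}. C $$ (i, k) = 0))"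
    if "k < dim_col A" for k
  proof -
    have "(\<forall>i<s. B $$ (i, k) = A $$ (i, k)) \<and>
      ((\<forall>i\<in>{s..<dim_row A}. A $$ (i, k) = 0) \<longrightarrow> (\<forall>i\<in>{s..<dim_row A}. B $$ (i, k) = 0))"
      using assms(1) that unfolding lower_equiv_def by blast
    moreover have "(\<forall>i<s. C $$ (i, k) = B $$ (i, k)) \<and>
      ((\<forall>i\<in>{s..<dim_row A}. B $$ (i, k) = 0) \<longrightarrow> (\<forall>i\<in>{s..<dim_row A}. C $$ (i, k) = 0))"
      using assms(2) that B unfolding lower_equiv_def by auto
    ultimately show ?thesis by auto
  qed
  ultimately show ?thesis unfolding lower_equiv_def by blast
qed

lemma lower_equiv_shear:
  assumes "A \<in> carrier_mat m q" "s \<le> t" "t < m" "c t = 0 \<or> c t = - 2" "\<And>i. i < s \<Longrightarrow> c i = 0"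
  shows "lower_equiv s A (shear m t c * A)"
  using assms shear_GL_Z[of t m c]
  by (auto simp: lower_equiv_def shear_mult_index[OF assms(1)])

lemma lower_equiv_swap:
  assumes "A \<in> carrier_mat m q" "s \<le> i" "i < m" "s \<le> k" "k < m"
  shows "lower_equiv s A (swaprows i k A)"
proof -
  have "swaprows_mat m i k \<in> GL_Z m"
    using assms swaprows_mat_inv[of i m k]
    by (auto simp: GL_Z_iff intro!: bexI[of _ "swaprows_mat m i k"])
  then show ?thesis
    using assms by (auto simp: lower_equiv_def swaprows_mat[OF assms(1), of i k, symmetric]
        intro!: bexI[of _ "swaprows_mat m i k"])
qed

text \<open>Euclid's algorithm on the entries of column \<open>j\<close> from row \<open>s\<close> on. As long as two of them are non-zero,
adding one row to another with the right sign decreases the sum of the absolute values.\<close>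

lemma clear_column:
  assumes "A \<in> carrier_mat m q" "s < m" "j < q"
  shows "\<exists>B. lower_equiv s A B \<and> (\<forall>i\<in>{s<..<m}. B $$ (i, j) = 0) \<and> B $$ (s, j) \<ge> 0"
  using assms
proof (induction "\<Sum>i\<in>{s..<m}. nat \<bar>A $$ (i, j)\<bar>" arbitrary: A rule: less_induct)
  case less
  note A = less.prems(1)
  show ?case
  proof (cases "\<exists>i\<in>{s..<m}. \<exists>k\<in>{s..<m}. i \<noteq> k \<and> A $$ (i, j) \<noteq> 0 \<and> A $$ (k, j) \<noteq> 0")
    case True
    then obtain i k where ik: "i \<in> {s..<m}" "k \<in> {s..<m}" "i \<noteq> k" "A $$ (k, j) \<noteq> 0"
      and le: "\<bar>A $$ (k, j)\<bar> \<le> \<bar>A $$ (i, j)\<bar>"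
      by (metis linear)
    \<comment> \<open>The sign is chosen such that the two entries partly cancel; the larger one
      shrinks by the absolute value of the smaller one.\<close>
    define c where "c = (\<lambda>l. if l = i then - sgn (A $$ (i, j)) * sgn (A $$ (k, j)) else 0)"
    define B where "B = shear m k c * A"
    have AB: "lower_equiv s A B"
      unfolding B_def using A ik by (intro lower_equiv_shear) (auto simp: c_def)
    have ent: "B $$ (l, j) = A $$ (l, j) + c l * A $$ (k, j)" if "l < m" for l
      unfolding B_def using A ik less.prems that by (intro shear_mult_index) auto
    have smaller: "\<bar>B $$ (i, j)\<bar> < \<bar>A $$ (i, j)\<bar>"
      using ik le ent[of i] by (auto simp: c_def sgn_if split: if_splits)
    have "(\<Sum>l\<in>{s..<m}. nat \<bar>B $$ (l, j)\<bar>) < (\<Sum>l\<in>{s..<m}. nat \<bar>A $$ (l, j)\<bar>)"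
    proof (rule sum_strict_mono_ex1)
      show "\<forall>l\<in>{s..<m}. nat \<bar>B $$ (l, j)\<bar> \<le> nat \<bar>A $$ (l, j)\<bar>"
      proof
        fix l assume "l \<in> {s..<m}"
        then show "nat \<bar>B $$ (l, j)\<bar> \<le> nat \<bar>A $$ (l, j)\<bar>"
          using smaller ent[of l] by (cases "l = i") (auto simp: c_def)
      qed
      show "\<exists>l\<in>{s..<m}. nat \<bar>B $$ (l, j)\<bar> < nat \<bar>A $$ (l, j)\<bar>"
        using smaller ik by (intro bexI[of _ i]) auto
    qed simp
    from less.hyps[OF this lower_equiv_carrier[OF AB A] less.prems(2,3)] AB show ?thesis
      by (meson lower_equiv_trans)
  next
    case False
    show ?thesis
    proof (cases "\<exists>i\<in>{s..<m}. A $$ (i, j) \<noteq> 0")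
      case True
      then obtain i where i: "i \<in> {s..<m}" "A $$ (i, j) \<noteq> 0" by auto
      define B where "B = swaprows i s A"
      have AB: "lower_equiv s A B" unfolding B_def
        using A i less.prems by (intro lower_equiv_swap) auto
      have B: "B \<in> carrier_mat m q" using lower_equiv_carrier[OF AB A] .
      have B0: "\<forall>l\<in>{s<..<m}. B $$ (l, j) = 0"
      proof
        fix l assume l: "l \<in> {s<..<m}"
        have "A $$ (k, j) = 0" if "k \<in> {s..<m}" "k \<noteq> i" for k
          using False i that by blast
        then show "B $$ (l, j) = 0"
          using A i l less.prems by (auto simp: B_def)
      qed
      \<comment> \<open>Row s becomes \<open>1 - 2\<close> times itself if its entry is negative.\<close>
      define c where "c = (\<lambda>l. if l = s \<and> B $$ (s, j) < 0 then - 2 else 0 :: int)"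
      have "lower_equiv s B (shear m s c * B)"
        using less.prems B by (intro lower_equiv_shear) (auto simp: c_def)
      with AB have "lower_equiv s A (shear m s c * B)" by (rule lower_equiv_trans)
      moreover have "(shear m s c * B) $$ (l, j) = B $$ (l, j) + c l * B $$ (s, j)" if "l < m" for l
        using B less.prems that by (intro shear_mult_index) auto
      ultimately show ?thesis using B0 less.prems by (auto simp: c_def)
    next
      case none: False
      then show ?thesis using less.prems by (intro exI[of _ A]) (auto simp: lower_equiv_refl)
    qed
  qed
qed

text \<open>The first \<open>q\<close> columns are in Hermite normal form, with \<open>s\<close> pivots in the columns given by \<open>f\<close>.
Making \<open>q\<close>, \<open>s\<close> and \<open>f\<close> explicit allows an induction over the columns.\<close>

definition hermite_upto :: "nat \<Rightarrow> int mat \<Rightarrow> nat \<Rightarrow> (nat \<Rightarrow> nat) \<Rightarrow> bool" where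
  "hermite_upto q A s f \<longleftrightarrow> s \<le> dim_row A \<and> f \<in> {..<s} \<rightarrow> {..<q} \<and> strict_mono_on {..<s} f \<and>
     (\<forall>i<s. A $$ (i, f i) \<ge> 1 \<and> (\<forall>j<f i. A $$ (i, j) = 0)) \<and>
     (\<forall>i k. i < k \<and> k < s \<longrightarrow> 0 \<le> A $$ (i, f k) \<and> A $$ (i, f k) < A $$ (k, f k)) \<and>
     (\<forall>i j. s \<le> i \<and> i < dim_row A \<and> j < q \<longrightarrow> A $$ (i, j) = 0)"

lemma hermite_normal_form_iff_upto:
  "hermite_normal_form A \<longleftrightarrow> (\<exists>s f. hermite_upto (dim_col A) A s f)"
  unfolding hermite_normal_form_def hermite_upto_def by (simp only: ex_simps)

lemma hermite_uptoD:
  assumes "hermite_upto q A s f"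
  shows "s \<le> dim_row A" "strict_mono_on {..<s} f"
    "\<And>i. i < s \<Longrightarrow> f i < q" "\<And>i. i < s \<Longrightarrow> A $$ (i, f i) \<ge> 1"
    "\<And>i j. i < s \<Longrightarrow> j < f i \<Longrightarrow> A $$ (i, j) = 0"
    "\<And>i k. i < k \<Longrightarrow> k < s \<Longrightarrow> 0 \<le> A $$ (i, f k)"
    "\<And>i k. i < k \<Longrightarrow> k < s \<Longrightarrow> A $$ (i, f k) < A $$ (k, f k)"
    "\<And>i j. s \<le> i \<Longrightarrow> i < dim_row A \<Longrightarrow> j < q \<Longrightarrow> A $$ (i, j) = 0"
proof -
  have *: "s \<le> dim_row A" "f \<in> {..<s} \<rightarrow> {..<q}" "strict_mono_on {..<s} f"
    "\<forall>i<s. A $$ (i, f i) \<ge> 1 \<and> (\<forall>j<f i. A $$ (i, j) = 0)"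
    "\<forall>i k. i < k \<and> k < s \<longrightarrow> 0 \<le> A $$ (i, f k) \<and> A $$ (i, f k) < A $$ (k, f k)"
    "\<forall>i j. s \<le> i \<and> i < dim_row A \<and> j < q \<longrightarrow> A $$ (i, j) = 0"
    using assms unfolding hermite_upto_def by - (elim conjE, assumption)+
  show "s \<le> dim_row A" "strict_mono_on {..<s} f" by (rule *)+
  show "f i < q" if "i < s" for i using *(2) that by auto
  show "A $$ (i, f i) \<ge> 1" if "i < s" for i using *(4) that by blast
  show "A $$ (i, j) = 0" if "i < s" "j < f i" for i j using *(4) that by blast
  show "0 \<le> A $$ (i, f k)" if "i < k" "k < s" for i k using *(5) that by blast
  show "A $$ (i, f k) < A $$ (k, f k)" if "i < k" "k < s" for i k using *(5) that by blast
  show "A $$ (i, j) = 0" if "s \<le> i" "i < dim_row A" "j < q" for i j using *(6) that by blast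
qed

lemma hermite_uptoI:
  assumes "s \<le> dim_row A" "strict_mono_on {..<s} f"
    "\<And>i. i < s \<Longrightarrow> f i < q" "\<And>i. i < s \<Longrightarrow> A $$ (i, f i) \<ge> 1"
    "\<And>i j. i < s \<Longrightarrow> j < f i \<Longrightarrow> A $$ (i, j) = 0"
    "\<And>i k. i < k \<Longrightarrow> k < s \<Longrightarrow> 0 \<le> A $$ (i, f k)"
    "\<And>i k. i < k \<Longrightarrow> k < s \<Longrightarrow> A $$ (i, f k) < A $$ (k, f k)"
    "\<And>i j. s \<le> i \<Longrightarrow> i < dim_row A \<Longrightarrow> j < q \<Longrightarrow> A $$ (i, j) = 0"
  shows "hermite_upto q A s f"
  unfolding hermite_upto_def Pi_def
  by (intro conjI allI impI CollectI; (elim conjE)?; simp only: assms lessThan_iff)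

lemma hermite_upto_cong:
  assumes "hermite_upto q A s f" "dim_row B = dim_row A"
    and "\<And>i j. i < dim_row A \<Longrightarrow> j < q \<Longrightarrow> B $$ (i, j) = A $$ (i, j)"
  shows "hermite_upto q B s f"
proof -
  note H = hermite_uptoD[OF assms(1)]
  have pivot: "B $$ (i, f k) = A $$ (i, f k)" if "i < s" "k < s" for i k
    using assms(3) H(1) H(3) that by simp
  show ?thesis
  proof (rule hermite_uptoI)
    show "s \<le> dim_row B" using H(1) assms(2) by simp
    show "B $$ (i, j) = 0" if "i < s" "j < f i" for i j
      using assms(3)[of i j] H(1) H(3)[of i] H(5)[of i j] that by simp
    show "0 \<le> B $$ (i, f k)" if "i < k" "k < s" for i k
      using H(6)[OF that] pivot[of i k] that by simp
    show "B $$ (i, f k) < B $$ (k, f k)" if "i < k" "k < s" for i k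
      using H(7)[OF that] pivot[of i k] pivot[of k k] that by simp
    show "B $$ (i, j) = 0" if "s \<le> i" "i < dim_row B" "j < q" for i j
      using H(8)[of i j] assms(2,3) that by simp
  qed (use H pivot in auto)
qed

lemma hermite_upto_Suc:
  assumes "hermite_upto q A s f" "\<And>i. s \<le> i \<Longrightarrow> i < dim_row A \<Longrightarrow> A $$ (i, q) = 0"
  shows "hermite_upto (Suc q) A s f"
proof -
  note H = hermite_uptoD[OF assms(1)]
  show ?thesis
  proof (rule hermite_uptoI)
    show "f i < Suc q" if "i < s" for i using H(3)[OF that] by simp
    show "A $$ (i, j) = 0" if "s \<le> i" "i < dim_row A" "j < Suc q" for i j
      using H(8)[of i j] assms(2)[of i] that by (cases "j = q") auto
  qed (fact H)+
qed

text \<open>Columns are treated from left to right. When column \<open>q\<close> is reached, the rows from \<open>s\<close> on vanish in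
all earlier columns. Hence clearing column \<open>q\<close> below row \<open>s\<close>, and then subtracting multiples of
row \<open>s\<close> from the rows above it, changes nothing in the earlier columns.\<close>

lemma hermite_upto_exists:
  assumes "A \<in> carrier_mat m p" "q \<le> p"
  shows "\<exists>U\<in>GL_Z m. \<exists>s f. hermite_upto q (U * A) s f"
  using assms(2)
proof (induction q)
  case 0
  show ?case
    using assms by (intro bexI[of _ "1\<^sub>m m"] exI[of _ 0] exI[of _ id])
      (auto simp: hermite_upto_def GL_Z_one)
next
  case (Suc q)
  then obtain U s f where U: "U \<in> GL_Z m" and H: "hermite_upto q (U * A) s f" by auto
  define H1 where "H1 = U * A"
  have H1: "H1 \<in> carrier_mat m p" using U assms by (auto simp: H1_def GL_Z_def)
  have dims: "dim_row H1 = m" "dim_col H1 = p" using H1 by auto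
  note H = H[folded H1_def]
  show ?case
  proof (cases "s < m")
    case False
    then have "hermite_upto (Suc q) H1 s f"
      using dims by (intro hermite_upto_Suc[OF H]) auto
    with U show ?thesis unfolding H1_def by blast
  next
    case sm: True
    obtain B where B: "lower_equiv s H1 B" "\<forall>i\<in>{s<..<m}. B $$ (i, q) = 0" "B $$ (s, q) \<ge> 0"
      using clear_column[OF H1 sm, of q] Suc.prems by auto
    have Bc: "B \<in> carrier_mat m p" using lower_equiv_carrier[OF B(1) H1] .
    obtain W where W: "W \<in> GL_Z m" "B = W * H1" using B(1) dims by (auto simp: lower_equiv_def)
    then have BU: "B = (W * U) * A" "W * U \<in> GL_Z m" using U assms unfolding H1_def
      by (auto intro!: GL_Z_mult assoc_mult_mat[symmetric] GL_Z_carrier)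
    have HB: "hermite_upto q B s f"
    proof (rule hermite_upto_cong[OF H])
      fix i j assume ij: "i < dim_row H1" "j < q"
      show "B $$ (i, j) = H1 $$ (i, j)"
        using hermite_uptoD(8)[OF H, of _ j] B(1) ij dims Suc.prems unfolding lower_equiv_def
        by (cases "i < s") auto
    qed (use Bc dims in auto)
    show ?thesis
    proof (cases "B $$ (s, q) = 0")
      case True
      have "B $$ (i, q) = 0" if "s \<le> i" "i < m" for i
        using True B(2) that by (cases "i = s") auto
      then have "hermite_upto (Suc q) B s f"
        using Bc by (intro hermite_upto_Suc[OF HB]) auto
      with BU show ?thesis by metis
    next
      case False
      define g where "g = B $$ (s, q)"
      have g: "g > 0" using False B(3) by (simp add: g_def)
      \<comment> \<open>The entries above the new pivot \<open>g\<close> are replaced by their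
        remainders modulo \<open>g\<close>.\<close>
      define c where "c = (\<lambda>i. if i < s then - (B $$ (i, q) div g) else 0)"
      define C where "C = shear m s c * B"
      have ent: "C $$ (i, k) = B $$ (i, k) + c i * B $$ (s, k)" if "i < m" "k < p" for i k
        unfolding C_def using Bc sm that by (intro shear_mult_index) auto
      have Cc: "C \<in> carrier_mat m p" using Bc by (auto simp: C_def shear_def)
      have HC: "hermite_upto q C s f"
      proof (rule hermite_upto_cong[OF HB])
        fix i j assume ij: "i < dim_row B" "j < q"
        then have "B $$ (s, j) = 0" using hermite_uptoD(8)[OF HB, of s j] sm Bc by auto
        with ij show "C $$ (i, j) = B $$ (i, j)" using ent[of i j] Bc Suc.prems by auto
      qed (use Bc Cc in auto)
      have lastcol: "C $$ (i, q) = (if i < s then B $$ (i, q) mod g else B $$ (i, q))" if "i < m" for i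
        using ent[of i q] that Suc.prems
        by (auto simp: c_def g_def minus_div_mult_eq_mod[symmetric])
      have Csq: "C $$ (s, q) = g" using lastcol[OF sm] by (simp add: g_def)
      note K = hermite_uptoD[OF HC]
      define f' where "f' = f(s := q)"
      have "hermite_upto (Suc q) C (Suc s) f'"
      proof (rule hermite_uptoI)
        show "Suc s \<le> dim_row C" using sm Cc by auto
        show "strict_mono_on {..<Suc s} f'"
          using K(2,3) by (auto simp: f'_def strict_mono_on_def less_Suc_eq)
        show "f' i < Suc q" if "i < Suc s" for i
          using K(3)[of i] that by (auto simp: f'_def less_Suc_eq)
        show "1 \<le> C $$ (i, f' i)" if "i < Suc s" for i
          using K(4)[of i] that Csq g by (cases "i = s") (auto simp: f'_def)
        show "C $$ (i, j) = 0" if "i < Suc s" "j < f' i" for i j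
          using K(5)[of i j] K(8)[of i j] that Cc sm by (cases "i = s") (auto simp: f'_def)
        show "0 \<le> C $$ (i, f' k)" if "i < k" "k < Suc s" for i k
          using K(6)[of i k] that lastcol[of i] g sm by (cases "k = s") (auto simp: f'_def)
        show "C $$ (i, f' k) < C $$ (k, f' k)" if "i < k" "k < Suc s" for i k
          using K(7)[of i k] that lastcol[of i] Csq g sm by (cases "k = s") (auto simp: f'_def)
        show "C $$ (i, j) = 0" if "Suc s \<le> i" "i < dim_row C" "j < Suc q" for i j
          using K(8)[of i j] lastcol[of i] B(2) Cc that by (cases "j = q") auto
      qed
      moreover have "C = (shear m s c * (W * U)) * A"
        unfolding C_def BU(1) using BU(2) assms
        by (intro assoc_mult_mat[symmetric]) (auto simp: shear_def GL_Z_def)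
      moreover have "shear m s c * (W * U) \<in> GL_Z m"
        using sm by (intro GL_Z_mult[OF shear_GL_Z BU(2)]) (auto simp: c_def)
      ultimately show ?thesis by metis
    qed
  qed
qed

section \<open>Integer matrices of full rank\<close>

text \<open>Both sides say that the columns span the whole space, since a subspace of full dimension is
everything.\<close>

lemma rank_eq_dim_iff_surj:
  fixes A :: "'a::field mat"
  assumes A: "A \<in> carrier_mat n m"
  shows "vec_space.rank n A = n \<longleftrightarrow> (\<forall>y\<in>carrier_vec n. \<exists>x\<in>carrier_vec m. A *\<^sub>v x = y)"
proof -
  interpret vec_space "TYPE('a)" n .
  have cols: "set (cols A) \<subseteq> carrier_vec n" using A cols_dim by blast
  have span: "span (set (cols A)) = {y\<in>carrier_vec n. \<exists>x\<in>carrier_vec m. A *\<^sub>v x = y}"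
    using col_space_eq[OF A] A by (simp add: col_space_def)
  have "rank A = n \<longleftrightarrow> span (set (cols A)) = carrier_vec n"
  proof
    assume rank: "rank A = n"
    obtain S where S: "maximal S (\<lambda>T. T \<subseteq> set (cols A) \<and> lin_indpt T)" "finite S"
      using maximal_exists_superset[of "set (cols A)" "\<lambda>T. T \<subseteq> set (cols A) \<and> lin_indpt T" "{}"]
      by (auto simp: lin_dep_def)
    then have "S \<subseteq> set (cols A)" "lin_indpt S" by (auto simp: maximal_def)
    moreover have "card S = n" using rank_card_indpt[OF A S(1)] rank by simp
    ultimately have "basis S"
      using S(2) cols by (intro dim_li_is_basis) (auto simp: dim_is_n)
    then have "carrier_vec n = span S" by (simp add: basis_def)
    also have "\<dots> \<subseteq> span (set (cols A))" using \<open>S \<subseteq> set (cols A)\<close> by (rule span_is_monotone)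
    finally show "span (set (cols A)) = carrier_vec n" using span by auto
  next
    assume "span (set (cols A)) = carrier_vec n"
    then have "span_vs (set (cols A)) = V" by simp
    then show "rank A = n" unfolding rank_def by (simp add: dim_is_n)
  qed
  then show ?thesis unfolding span by auto
qed

lemma scalar_prod_self_eq_0D:
  fixes v :: "'a::linordered_idom vec"
  assumes "v \<in> carrier_vec m" "v \<bullet> v = 0"
  shows "v = 0\<^sub>v m"
proof (rule eq_vecI)
  have "(\<Sum>i\<in>{0..<m}. v $ i * v $ i) = 0" using assms by (auto simp: scalar_prod_def)
  then have "\<forall>i\<in>{0..<m}. v $ i * v $ i = 0" by (subst (asm) sum_nonneg_eq_0_iff) auto
  then show "v $ i = 0\<^sub>v m $ i" if "i < dim_vec (0\<^sub>v m)" for i using that by auto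
qed (use assms in auto)

text \<open>A vector \<open>v\<close> in the kernel of the Gram matrix \<open>A A\<^sup>T\<close> satisfies \<open>(A\<^sup>T v) \<bullet> (A\<^sup>T v) = v \<bullet> (A A\<^sup>T v) = 0\<close>, so
\<open>A\<^sup>T v = 0\<close> over an ordered ring.\<close>

lemma det_gram_nonzero:
  fixes A :: "'a::linordered_idom mat"
  assumes A: "A \<in> carrier_mat a m"
    and inj: "\<forall>x\<in>carrier_vec a. transpose_mat A *\<^sub>v x = 0\<^sub>v m \<longrightarrow> x = 0\<^sub>v a"
  shows "det (A * transpose_mat A) \<noteq> 0"
proof -
  define G where "G = A * transpose_mat A"
  have G: "G \<in> carrier_mat a a" using A by (simp add: G_def)
  show "det (A * transpose_mat A) \<noteq> 0"
    unfolding G_def[symmetric]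
  proof
    assume "det G = 0"
    then obtain v where v: "v \<in> carrier_vec a" "v \<noteq> 0\<^sub>v a" "G *\<^sub>v v = 0\<^sub>v a"
      using det_0_iff_vec_prod_zero[OF G] by auto
    let ?w = "transpose_mat A *\<^sub>v v"
    have w: "?w \<in> carrier_vec m" using A v by auto
    have "?w \<bullet> ?w = v \<bullet> (A *\<^sub>v ?w)" using transpose_vec_mult_scalar[OF A w v(1)] .
    also have "A *\<^sub>v ?w = 0\<^sub>v a"
      using v assoc_mult_mat_vec[OF A _ v(1), of "transpose_mat A"] A by (simp add: G_def)
    also have "v \<bullet> 0\<^sub>v a = 0" using v(1) by simp
    finally have "?w = 0\<^sub>v m" using scalar_prod_self_eq_0D w by blast
    then show False using inj v by auto
  qed
qed

text \<open>Full row rank as independence of the rows over the integers, the form in which the rank is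
available for matrices whose rows are part of a basis. Towards the rank, the determinant of the
Gram matrix shows that already the columns of \<open>A A\<^sup>T\<close> span everything.\<close>

lemma rank_int_full_iff:
  assumes A: "A \<in> carrier_mat a m"
  shows "rank_int A = a \<longleftrightarrow> (\<forall>x\<in>carrier_vec a. transpose_mat A *\<^sub>v x = 0\<^sub>v m \<longrightarrow> x = 0\<^sub>v a)"
proof
  let ?q = "map_mat rat_of_int"
  have qA: "?q A \<in> carrier_mat a m" using A by simp
  assume "rank_int A = a"
  then have surj: "\<forall>y\<in>carrier_vec a. \<exists>x\<in>carrier_vec m. ?q A *\<^sub>v x = y"
    using rank_eq_dim_iff_surj[OF qA] A by (simp add: rank_int_def)
  show "\<forall>x\<in>carrier_vec a. transpose_mat A *\<^sub>v x = 0\<^sub>v m \<longrightarrow> x = 0\<^sub>v a"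
  proof (intro ballI impI)
    fix x assume x: "x \<in> carrier_vec a" "transpose_mat A *\<^sub>v x = 0\<^sub>v m"
    let ?x = "map_vec rat_of_int x"
    obtain z where z: "z \<in> carrier_vec m" "?q A *\<^sub>v z = ?x" using bspec[OF surj, of ?x] x(1) by auto
    have "transpose_mat (?q A) *\<^sub>v ?x = map_vec rat_of_int (transpose_mat A *\<^sub>v x)"
      using A x(1) by (simp add: of_int_hom.mult_mat_vec_hom[of _ m a] map_mat_transpose)
    also have "\<dots> = 0\<^sub>v m" using x(2) by auto
    finally have "?x \<bullet> (?q A *\<^sub>v z) = 0\<^sub>v m \<bullet> z"
      using transpose_vec_mult_scalar[OF qA z(1), of ?x] x(1) by simp
    then have "?x \<bullet> ?x = 0" using z by simp
    then have "?x = 0\<^sub>v a" using scalar_prod_self_eq_0D[of ?x a] x(1) by simp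
    then show "x = 0\<^sub>v a" by simp
  qed
next
  let ?q = "map_mat rat_of_int"
  have qA: "?q A \<in> carrier_mat a m" using A by simp
  assume inj: "\<forall>x\<in>carrier_vec a. transpose_mat A *\<^sub>v x = 0\<^sub>v m \<longrightarrow> x = 0\<^sub>v a"
  define G where "G = A * transpose_mat A"
  have G: "G \<in> carrier_mat a a" using A by (simp add: G_def)
  have "det G \<noteq> 0" unfolding G_def using A inj by (rule det_gram_nonzero)
  then have "det (?q G) \<noteq> 0" by (simp add: of_int_hom.hom_det)
  then have "vec_space.rank a (?q G) = a"
    using vec_space.low_rank_det_zero[of "?q G" a] G by simp
  then have surj: "\<forall>y\<in>carrier_vec a. \<exists>x\<in>carrier_vec a. ?q G *\<^sub>v x = y"
    using rank_eq_dim_iff_surj[of "?q G" a a] G by simp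
  have "?q G = ?q A * transpose_mat (?q A)"
    using A by (simp add: G_def of_int_hom.mat_hom_mult[of _ a m _ a] map_mat_transpose)
  then have "?q G *\<^sub>v x = ?q A *\<^sub>v (transpose_mat (?q A) *\<^sub>v x)" if "x \<in> carrier_vec a" for x
    using assoc_mult_mat_vec[OF qA _ that] qA by simp
  then have "\<forall>y\<in>carrier_vec a. \<exists>x\<in>carrier_vec m. ?q A *\<^sub>v x = y"
    using surj qA by (metis mult_mat_vec_carrier transpose_carrier_mat)
  then show "rank_int A = a" using rank_eq_dim_iff_surj[OF qA] A by (simp add: rank_int_def)
qed

lemma strict_mono_on_lessThan_eq_id:
  fixes f :: "nat \<Rightarrow> nat"
  assumes mono: "strict_mono_on {..<a} f" and less: "\<And>i. i < a \<Longrightarrow> f i < a" and i: "i < a"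
  shows "f i = i"
proof -
  have grow: "f k + d \<le> f (k + d)" if "k + d < a" for k d
    using that
  proof (induction d)
    case (Suc d)
    then have "f (k + d) < f (k + Suc d)"
      using mono by (intro strict_mono_onD[OF mono]) auto
    with Suc show ?case by simp
  qed simp
  have "f i + (a - 1 - i) \<le> f (a - 1)" using grow[of i "a - 1 - i"] i by simp
  moreover have "f (a - 1) < a" using less i by simp
  ultimately show ?thesis using grow[of 0 i] i by simp
qed

text \<open>A Hermite normal form with \<open>a\<close> columns and \<open>a\<close> pivots: an upper triangular block with positive
diagonal on top of zero rows.\<close>

definition full_hermite :: "nat \<Rightarrow> int mat \<Rightarrow> bool" where
  "full_hermite a H \<longleftrightarrow> hermite_normal_form H \<and> (\<forall>i<a. H $$ (i, i) \<ge> 1 \<and> (\<forall>j<i. H $$ (i, j) = 0)) \<and>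
     (\<forall>i j. a \<le> i \<and> i < dim_row H \<and> j < a \<longrightarrow> H $$ (i, j) = 0)"

text \<open>If \<open>A\<close> has full row rank then the transpose of \<open>A\<close> is injective, and so is its Hermite normal form.
This forces a pivot in every column.\<close>

lemma full_hermite_exists:
  assumes A: "A \<in> carrier_mat a (a + b)" and rank: "rank_int A = a"
  obtains U where "U \<in> GL_Z (a + b)" "full_hermite a (U * transpose_mat A)"
proof -
  have At: "transpose_mat A \<in> carrier_mat (a + b) a" using A by simp
  obtain U s f where U: "U \<in> GL_Z (a + b)" and H0: "hermite_upto a (U * transpose_mat A) s f"
    using hermite_upto_exists[OF At, of a] by auto
  define H where "H = U * transpose_mat A"
  have H: "H \<in> carrier_mat (a + b) a" using U At by (auto simp: H_def GL_Z_def)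
  note H0 = H0[folded H_def]
  note D = hermite_uptoD[OF H0]
  obtain W where W: "W \<in> carrier_mat (a + b) (a + b)" "W * U = 1\<^sub>m (a + b)" using U GL_Z_iff by blast
  have "inj_on f {..<s}" using D(2) by (rule strict_mono_on_imp_inj_on)
  then have "card {..<s} \<le> card {..<a}"
    using D(3) by (intro card_inj_on_le[of f]) auto
  then have "s \<le> a" by simp
  moreover have "\<not> s < a"
  proof
    \<comment> \<open>The top square block would have a zero row, so a non-zero \<open>v\<close>
      would satisfy \<open>H v = 0\<close> and thus \<open>A\<^sup>T v = 0\<close>.\<close>
    assume sa: "s < a"
    define B where "B = mat a a (\<lambda>(i, j). H $$ (i, j))"
    have B: "B \<in> carrier_mat a a" by (simp add: B_def)
    have "B = mat\<^sub>r a a (\<lambda>i. if i = s then 0\<^sub>v a else row B i)"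
      using D(8)[of s] sa H by (intro eq_matI) (auto simp: B_def)
    then have "det B = 0" using det_row_0[OF sa, of "row B"] B by auto
    then obtain v where v: "v \<in> carrier_vec a" "v \<noteq> 0\<^sub>v a" "B *\<^sub>v v = 0\<^sub>v a"
      using det_0_iff_vec_prod_zero[OF B] by auto
    have "H *\<^sub>v v = 0\<^sub>v (a + b)"
    proof (rule eq_vecI)
      fix i assume i: "i < dim_vec (0\<^sub>v (a + b))"
      show "(H *\<^sub>v v) $ i = 0\<^sub>v (a + b) $ i"
      proof (cases "i < a")
        case True
        have "(H *\<^sub>v v) $ i = (B *\<^sub>v v) $ i"
          using True H v(1) by (auto simp: scalar_prod_def B_def)
        then show ?thesis using True i v(3) by simp
      next
        case False
        then have "row H i = 0\<^sub>v a" using D(8)[of i] sa i H by (intro eq_vecI) auto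
        then show ?thesis using i H v(1) by simp
      qed
    qed (use H in simp)
    then have "W *\<^sub>v (H *\<^sub>v v) = 0\<^sub>v (a + b)" using W by auto
    moreover have "H *\<^sub>v v = U *\<^sub>v (transpose_mat A *\<^sub>v v)"
      unfolding H_def using GL_Z_carrier[OF U] At v(1) by (rule assoc_mult_mat_vec)
    moreover have "W *\<^sub>v (U *\<^sub>v w) = w" if "w \<in> carrier_vec (a + b)" for w
      using assoc_mult_mat_vec[OF W(1) GL_Z_carrier[OF U] that] W(2) that by simp
    ultimately have "transpose_mat A *\<^sub>v v = 0\<^sub>v (a + b)" using At v(1) by simp
    then show False using rank rank_int_full_iff[OF A] v by auto
  qed
  ultimately have s: "s = a" by simp
  \<comment> \<open>With \<open>a\<close> pivots in \<open>a\<close> columns, all pivots are on the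
    diagonal.\<close>
  have f: "f i = i" if "i < a" for i
    using strict_mono_on_lessThan_eq_id[of a f i] D(2,3) that unfolding s by blast
  have "full_hermite a H"
    unfolding full_hermite_def
  proof (intro conjI allI impI)
    show "hermite_normal_form H" using H0 H by (auto simp: hermite_normal_form_iff_upto)
    show "H $$ (i, i) \<ge> 1" if "i < a" for i using D(4)[of i] f s that by simp
    show "H $$ (i, j) = 0" if "i < a" "j < i" for i j using D(5)[of i j] f s that by simp
    show "H $$ (i, j) = 0" if "a \<le> i \<and> i < dim_row H \<and> j < a" for i j using D(8)[of i j] s that by simp
  qed
  with U show thesis using that by (simp add: H_def)
qed

section \<open>Integer combinations and bases in abelian groups\<close>

lemma (in comm_group) Z_combination_closed:
  "b \<in> {..<k} \<rightarrow> carrier G \<Longrightarrow> Z_combination G k b c \<in> carrier G"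
  unfolding Z_combination_def by (intro finprod_closed) (auto simp: Pi_iff)

lemma (in comm_group) Z_combination_0: "Z_combination G 0 b c = \<one>"
  by (simp add: Z_combination_def)

lemma (in comm_group) Z_combination_Suc:
  assumes "b \<in> {..<Suc k} \<rightarrow> carrier G"
  shows "Z_combination G (Suc k) b c = Z_combination G k b c \<otimes> b k [^] c k"
proof -
  have "Z_combination G (Suc k) b c = b k [^] c k \<otimes> Z_combination G k b c"
    unfolding Z_combination_def lessThan_Suc using assms by (intro finprod_insert) auto
  then show ?thesis using assms by (simp add: m_comm Z_combination_closed Pi_iff)
qed

lemma Z_combination_hom:
  assumes "comm_group G" "comm_group H" "h \<in> hom G H" "b \<in> {..<k} \<rightarrow> carrier G"
  shows "h (Z_combination G k b c) = Z_combination H k (\<lambda>i. h (b i)) c"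
proof -
  interpret G: comm_group G by fact
  interpret H: comm_group H by fact
  interpret h: group_hom G H h using assms(3) by unfold_locales
  show ?thesis
    using assms(4)
  proof (induction k)
    case 0
    then show ?case by (simp add: G.Z_combination_0 H.Z_combination_0)
  next
    case (Suc k)
    then have b: "b \<in> {..<k} \<rightarrow> carrier G" "b k \<in> carrier G" by (auto simp: Pi_iff)
    have "(\<lambda>i. h (b i)) \<in> {..<Suc k} \<rightarrow> carrier H" using Suc.prems by (auto simp: Pi_iff)
    then show ?case
      using Suc b by (simp add: G.Z_combination_Suc H.Z_combination_Suc G.Z_combination_closed h.hom_int_pow)
  qed
qed

lemma Z_combination_integer_group: "Z_combination integer_group k b c = (\<Sum>i<k. c i * b i)"
proof -
  interpret comm_group integer_group by (rule abelian_integer_group)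
  show ?thesis by (induction k) (auto simp: Z_combination_0 Z_combination_Suc)
qed

text \<open>Coordinates of an integer combination are computed by evaluating homomorphisms to the integers,
which replaces calculations with finite products.\<close>

lemma Z_combination_hom_int:
  assumes "comm_group G" "h \<in> hom G integer_group" "b \<in> {..<k} \<rightarrow> carrier G"
  shows "h (Z_combination G k b c) = (\<Sum>i<k. c i * h (b i))"
  using Z_combination_hom[OF assms(1) abelian_integer_group assms(2,3)]
  by (simp add: Z_combination_integer_group)

lemma Z_basis_cong:
  assumes "comm_group G" "\<And>i. i < k \<Longrightarrow> b i = b' i"
  shows "Z_basis G k b \<longleftrightarrow> Z_basis G k b'"
proof -
  interpret comm_group G by fact
  have "Z_combination G k b c = Z_combination G k b' c" if "b' \<in> {..<k} \<rightarrow> carrier G" for c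
    unfolding Z_combination_def using assms(2) that by (intro finprod_cong) (auto simp: Pi_iff simp_implies_def)
  moreover have "b \<in> {..<k} \<rightarrow> carrier G \<longleftrightarrow> b' \<in> {..<k} \<rightarrow> carrier G"
    using assms(2) by (auto simp: Pi_iff)
  ultimately show ?thesis unfolding Z_basis_def Z_independent_def by auto
qed

lemma (in comm_group) Z_combination_in_subgroup:
  assumes "subgroup H G" "b \<in> {..<k} \<rightarrow> H"
  shows "Z_combination G k b c \<in> H"
  using assms(2)
proof (induction k)
  case 0
  then show ?case using assms(1) by (simp add: Z_combination_0 subgroup.one_closed)
next
  case (Suc k)
  have b: "b k \<in> H" "b \<in> {..<k} \<rightarrow> H" "b \<in> {..<Suc k} \<rightarrow> carrier G"
    using Suc.prems subgroup.mem_carrier[OF assms(1)] by (auto simp: Pi_iff)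
  have "b k [^] c k \<in> H" using subgroup_int_pow_closed[OF assms(1) b(1)] .
  then show ?case using Suc.IH[OF b(2)] b(3) assms(1) by (simp add: Z_combination_Suc subgroup.m_closed)
qed

lemma Z_basis_iso:
  assumes "comm_group G" "comm_group H" "h \<in> iso G H" "Z_basis G k b"
  shows "Z_basis H k (\<lambda>i. h (b i))"
proof -
  have h: "h \<in> hom G H" "inj_on h (carrier G)" "h ` carrier G = carrier H"
    using assms(3) by (auto simp: iso_def bij_betw_def)
  interpret G: comm_group G by fact
  interpret H: comm_group H by fact
  interpret h: group_hom G H h using h(1) by unfold_locales
  have b: "b \<in> {..<k} \<rightarrow> carrier G" using assms(4) by (simp add: Z_basis_def Z_independent_def)
  note comb = Z_combination_hom[OF assms(1,2) h(1) b, symmetric]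
  have closed: "Z_combination G k b c \<in> carrier G" for c using b by (rule G.Z_combination_closed)
  have "Z_combination G k b c = \<one>\<^bsub>G\<^esub>" if "Z_combination H k (\<lambda>i. h (b i)) c = \<one>\<^bsub>H\<^esub>" for c
    using that inj_onD[OF h(2), of "Z_combination G k b c" "\<one>\<^bsub>G\<^esub>"] closed by (simp add: comb)
  moreover have "\<exists>c. y = Z_combination H k (\<lambda>i. h (b i)) c" if y: "y \<in> carrier H" for y
  proof -
    obtain x where "x \<in> carrier G" "y = h x" using y h(3) by auto
    then show ?thesis using assms(4) by (auto simp: Z_basis_def comb)
  qed
  ultimately show ?thesis using assms(4) b by (auto simp: Z_basis_def Z_independent_def Pi_iff)
qed

section \<open>Kernels of integer matrices and Gale duality\<close>

lemma kernel_group_simps: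
  assumes "A \<in> carrier_mat a m"
  shows "carrier (kernel_group A) = {x \<in> carrier_vec m. A *\<^sub>v x = 0\<^sub>v a}"
    "x \<otimes>\<^bsub>kernel_group A\<^esub> y = x + y" "\<one>\<^bsub>kernel_group A\<^esub> = 0\<^sub>v m"
  using assms by (auto simp: kernel_group_def mat_kernel_def monoid_vec_def)

lemma comm_group_kernel_group:
  assumes A: "A \<in> carrier_mat a m"
  shows "comm_group (kernel_group A)"
proof (rule comm_groupI, unfold kernel_group_simps[OF A])
  fix x assume x: "x \<in> {x \<in> carrier_vec m. A *\<^sub>v x = 0\<^sub>v a}"
  then have "x \<in> carrier_vec m" by simp
  then have "A *\<^sub>v (- x) = - (A *\<^sub>v x)" using A by (intro eq_vecI) auto
  then have "- x \<in> {x \<in> carrier_vec m. A *\<^sub>v x = 0\<^sub>v a}" using x by auto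
  moreover have "- x + x = 0\<^sub>v m" using x by auto
  ultimately show "\<exists>y\<in>{x \<in> carrier_vec m. A *\<^sub>v x = 0\<^sub>v a}. y + x = 0\<^sub>v m" by blast
qed (use A in \<open>auto simp: mult_add_distrib_mat_vec[OF A] assoc_add_vec comm_add_vec\<close>)

lemma vec_index_self: "c \<in> carrier_vec n \<Longrightarrow> vec n (($) c) = c"
  by auto

lemma transpose_mult_vec_index:
  fixes G :: "int mat"
  assumes "G \<in> carrier_mat b m" "c \<in> carrier_vec b" "j < m"
  shows "(transpose_mat G *\<^sub>v c) $ j = (\<Sum>i<b. c $ i * G $$ (i, j))"
  using assms by (auto simp: scalar_prod_def lessThan_atLeast0 mult.commute intro!: sum.cong)

lemma transpose_mult_unit_vec:
  fixes G :: "int mat"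
  assumes "G \<in> carrier_mat b m" "i < b"
  shows "transpose_mat G *\<^sub>v unit_vec b i = Matrix.row G i"
  using assms by (intro eq_vecI) auto

lemma transpose_mult_carrier: "G \<in> carrier_mat b m \<Longrightarrow> transpose_mat G *\<^sub>v c \<in> carrier_vec m"
  by (rule carrier_vecI) simp

lemma Z_combination_kernel_group:
  assumes A: "A \<in> carrier_mat a m" and G: "G \<in> carrier_mat b m"
    and rows: "Matrix.row G \<in> {..<b} \<rightarrow> carrier (kernel_group A)"
  shows "Z_combination (kernel_group A) b (Matrix.row G) c = transpose_mat G *\<^sub>v vec b c"
proof (rule eq_vecI)
  interpret comm_group "kernel_group A" using A by (rule comm_group_kernel_group)
  have carr: "Z_combination (kernel_group A) b (Matrix.row G) c \<in> carrier_vec m"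
    using Z_combination_closed[OF rows] A by (auto simp: kernel_group_simps)
  then show "dim_vec (Z_combination (kernel_group A) b (Matrix.row G) c)
      = dim_vec (transpose_mat G *\<^sub>v vec b c)" using G by simp
  fix j assume "j < dim_vec (transpose_mat G *\<^sub>v vec b c)"
  then have j: "j < m" using G by simp
  have "(\<lambda>x. x $ j) \<in> hom (kernel_group A) integer_group"
    using A j by (auto simp: hom_def kernel_group_simps)
  from Z_combination_hom_int[OF comm_group_axioms this rows]
  show "Z_combination (kernel_group A) b (Matrix.row G) c $ j = (transpose_mat G *\<^sub>v vec b c) $ j"
    using transpose_mult_vec_index[OF G, of "vec b c" j] G j by simp
qed

text \<open>The formula for integer combinations of kernel elements applies to arbitrary integer vectors: they
form the kernel of a matrix without rows.\<close>

lemma row_lattice_eq: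
  assumes A: "A \<in> carrier_mat r m"
  shows "row_lattice A = {transpose_mat A *\<^sub>v c | c. c \<in> carrier_vec r}"
proof -
  let ?G = "monoid_vec TYPE(int) m"
  have kernel_all: "kernel_group (0\<^sub>m 0 m) = ?G"
    by (auto simp: kernel_group_def mat_kernel_def monoid_vec_def)
  interpret comm_group ?G by (rule comm_group_vec)
  have rows: "set (Matrix.rows A) = Matrix.row A ` {..<r}"
    using A by (auto simp: Matrix.rows_def)
  have rows_carrier: "Matrix.row A \<in> {..<r} \<rightarrow> carrier ?G"
    using A by (auto simp: monoid_vec_simps)
  have comb: "Z_combination ?G r (Matrix.row A) c = transpose_mat A *\<^sub>v vec r c" for c
    using Z_combination_kernel_group[of "0\<^sub>m 0 m" 0 m A r c] A rows_carrier unfolding kernel_all by simp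
  have dim: "dim_col A = m" using A by simp
  have "transpose_mat A *\<^sub>v c \<in> generate ?G (set (Matrix.rows A))" if c: "c \<in> carrier_vec r" for c
  proof -
    have "subgroup (generate ?G (set (Matrix.rows A))) ?G"
      using rows_carrier unfolding rows by (intro generate_is_subgroup) auto
    moreover have "Matrix.row A \<in> {..<r} \<rightarrow> generate ?G (set (Matrix.rows A))"
      unfolding rows by (auto intro: generate.incl)
    ultimately have "Z_combination ?G r (Matrix.row A) (($) c) \<in> generate ?G (set (Matrix.rows A))"
      by (rule Z_combination_in_subgroup)
    moreover have "vec r (($) c) = c" using c by auto
    ultimately show ?thesis by (simp add: comb)
  qed
  moreover have "x \<in> {transpose_mat A *\<^sub>v c | c. c \<in> carrier_vec r}"
    if "x \<in> generate ?G (set (Matrix.rows A))" for x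
    using that
  proof (induction rule: generate.induct)
    case one
    have "transpose_mat A *\<^sub>v 0\<^sub>v r = 0\<^sub>v m" using A by auto
    then show ?case by (intro CollectI exI[of _ "0\<^sub>v r"]) (simp add: monoid_vec_simps)
  next
    case (incl h)
    then obtain i where "i < r" "h = Matrix.row A i" unfolding rows by auto
    then show ?case using transpose_mult_unit_vec[OF A] by (intro CollectI exI[of _ "unit_vec r i"]) simp
  next
    case (inv h)
    then obtain i where i: "i < r" "h = Matrix.row A i" unfolding rows by auto
    have h: "h \<in> carrier_vec m" using i A by auto
    have "inv\<^bsub>?G\<^esub> h = - h" using h by (intro inv_equality) (auto simp: monoid_vec_simps)
    also have "\<dots> = transpose_mat A *\<^sub>v (- unit_vec r i)"
      using i A by (intro eq_vecI) (auto simp: transpose_mult_vec_index)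
    finally show ?case by (intro CollectI exI[of _ "- unit_vec r i"]) simp
  next
    case (eng h1 h2)
    then obtain c d where "c \<in> carrier_vec r" "d \<in> carrier_vec r"
        "h1 = transpose_mat A *\<^sub>v c" "h2 = transpose_mat A *\<^sub>v d" by auto
    then show ?case using A mult_add_distrib_mat_vec[of "transpose_mat A" m r c d]
      by (intro CollectI exI[of _ "c + d"]) (simp add: monoid_vec_simps)
  qed
  ultimately show ?thesis unfolding row_lattice_def dim by blast
qed

lemma row_lattice_subgroup:
  assumes A: "A \<in> carrier_mat r m"
  shows "subgroup (row_lattice A) (monoid_vec TYPE(int) m)"
proof -
  interpret comm_group "monoid_vec TYPE(int) m" by (rule comm_group_vec)
  have "set (Matrix.rows A) \<subseteq> carrier_vec m" using A by (auto simp: Matrix.rows_def)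
  then show ?thesis using A unfolding row_lattice_def by (auto intro!: generate_is_subgroup simp: monoid_vec_simps)
qed

text \<open>The rows of \<open>G\<close> form a basis of the kernel of \<open>A\<close>, in the language of matrices: \<open>G\<^sup>T\<close> maps into the
kernel, injectively, and onto it.\<close>

definition kernel_basis :: "nat \<Rightarrow> nat \<Rightarrow> int mat \<Rightarrow> int mat \<Rightarrow> bool" where
  "kernel_basis a b A G \<longleftrightarrow> (\<forall>c\<in>carrier_vec b. A *\<^sub>v (transpose_mat G *\<^sub>v c) = 0\<^sub>v a) \<and>
     (\<forall>c\<in>carrier_vec b. transpose_mat G *\<^sub>v c = 0\<^sub>v (a + b) \<longrightarrow> c = 0\<^sub>v b) \<and>
     (\<forall>x\<in>carrier_vec (a + b). A *\<^sub>v x = 0\<^sub>v a \<longrightarrow> (\<exists>c\<in>carrier_vec b. x = transpose_mat G *\<^sub>v c))"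

lemma Z_basis_kernel_group_iff:
  assumes A: "A \<in> carrier_mat a (a + b)" and G: "G \<in> carrier_mat b (a + b)"
  shows "Z_basis (kernel_group A) b (Matrix.row G) \<longleftrightarrow> kernel_basis a b A G"
proof
  assume basis: "Z_basis (kernel_group A) b (Matrix.row G)"
  then have rows: "Matrix.row G \<in> {..<b} \<rightarrow> carrier (kernel_group A)"
    by (simp add: Z_basis_def Z_independent_def)
  interpret comm_group "kernel_group A" using A by (rule comm_group_kernel_group)
  note comb = Z_combination_kernel_group[OF A G rows]
  have vec: "vec b (($) c) = c" if "c \<in> carrier_vec b" for c :: "int vec" using that by auto
  show "kernel_basis a b A G"
    unfolding kernel_basis_def
  proof (intro conjI ballI impI)
    fix c :: "int vec" assume c: "c \<in> carrier_vec b"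
    show "A *\<^sub>v (transpose_mat G *\<^sub>v c) = 0\<^sub>v a"
      using Z_combination_closed[OF rows, of "($) c"] vec[OF c] A by (auto simp: comb kernel_group_simps)
    assume "transpose_mat G *\<^sub>v c = 0\<^sub>v (a + b)"
    then have "Z_combination (kernel_group A) b (Matrix.row G) (($) c) = \<one>\<^bsub>kernel_group A\<^esub>"
      using vec[OF c] A by (simp add: comb kernel_group_simps)
    then have "\<forall>i<b. c $ i = 0" using basis unfolding Z_basis_def Z_independent_def by blast
    then show "c = 0\<^sub>v b" using c by auto
  next
    fix x assume "x \<in> carrier_vec (a + b)" "A *\<^sub>v x = 0\<^sub>v a"
    then have "x \<in> carrier (kernel_group A)" using A by (simp add: kernel_group_simps)
    then obtain c where "x = Z_combination (kernel_group A) b (Matrix.row G) c"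
      using basis unfolding Z_basis_def by blast
    then show "\<exists>c\<in>carrier_vec b. x = transpose_mat G *\<^sub>v c" by (auto simp: comb)
  qed
next
  assume kb: "kernel_basis a b A G"
  have rows: "Matrix.row G \<in> {..<b} \<rightarrow> carrier (kernel_group A)"
  proof
    fix i assume i: "i \<in> {..<b}"
    then have "A *\<^sub>v (transpose_mat G *\<^sub>v unit_vec b i) = 0\<^sub>v a"
      using kb by (simp add: kernel_basis_def)
    then show "Matrix.row G i \<in> carrier (kernel_group A)"
      using transpose_mult_unit_vec[OF G] i A G by (simp add: kernel_group_simps)
  qed
  note comb = Z_combination_kernel_group[OF A G rows]
  show "Z_basis (kernel_group A) b (Matrix.row G)"
    unfolding Z_basis_def Z_independent_def
  proof (intro conjI allI impI ballI rows)
    fix c and i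
    assume "Z_combination (kernel_group A) b (Matrix.row G) c = \<one>\<^bsub>kernel_group A\<^esub>" and i: "i < b"
    then have "transpose_mat G *\<^sub>v vec b c = 0\<^sub>v (a + b)" using A by (simp add: comb kernel_group_simps)
    then have "vec b c = 0\<^sub>v b" using kb by (simp add: kernel_basis_def)
    from arg_cong[OF this, of "\<lambda>v. v $ i"] i show "c i = 0" by simp
  next
    fix x assume "x \<in> carrier (kernel_group A)"
    then obtain c where c: "c \<in> carrier_vec b" "x = transpose_mat G *\<^sub>v c"
      using kb A by (auto simp: kernel_basis_def kernel_group_simps)
    then have "vec b (($) c) = c" by auto
    with c have "x = Z_combination (kernel_group A) b (Matrix.row G) (($) c)" by (simp add: comb)
    then show "\<exists>c. x = Z_combination (kernel_group A) b (Matrix.row G) c" by blast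
  qed
qed

lemma gale_dual_iff:
  "gale_dual a b A G \<longleftrightarrow> A \<in> carrier_mat a (a + b) \<and> rank_int A = a \<and>
     G \<in> carrier_mat b (a + b) \<and> kernel_basis a b A G"
  unfolding gale_dual_def using Z_basis_kernel_group_iff by blast

text \<open>Preimages of the unit vectors are the rows of a left inverse. It is two-sided because it is so
over the rationals.\<close>

lemma GL_Z_surjI:
  assumes U: "U \<in> carrier_mat m m"
    and surj: "\<And>x. x \<in> carrier_vec m \<Longrightarrow> \<exists>z\<in>carrier_vec m. transpose_mat U *\<^sub>v z = x"
  shows "U \<in> GL_Z m"
proof -
  obtain z where z: "\<And>i. i < m \<Longrightarrow> z i \<in> carrier_vec m"
      "\<And>i. i < m \<Longrightarrow> transpose_mat U *\<^sub>v z i = unit_vec m i"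
    using surj[OF unit_vec_carrier] by metis
  define Z where "Z = mat m m (\<lambda>(i, j). z i $ j)"
  have Z: "Z \<in> carrier_mat m m" by (simp add: Z_def)
  have ZU: "Z * U = 1\<^sub>m m"
  proof (rule eq_matI)
    fix i j assume ij: "i < dim_row (1\<^sub>m m)" "j < dim_col (1\<^sub>m m)"
    have "Matrix.row Z i = z i" using z(1)[of i] ij by (auto simp: Z_def)
    then have "(Z * U) $$ (i, j) = (transpose_mat U *\<^sub>v z i) $ j"
      using ij Z U z(1)[of i] by (simp add: comm_scalar_prod[of _ m])
    then show "(Z * U) $$ (i, j) = 1\<^sub>m m $$ (i, j)" using z(2)[of i] ij by simp
  qed (use Z U in auto)
  have "map_mat rat_of_int Z * map_mat rat_of_int U = map_mat rat_of_int (Z * U)"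
    using Z U by (rule of_int_hom.mat_hom_mult[symmetric])
  also have "\<dots> = 1\<^sub>m m" unfolding ZU by (rule of_int_hom.mat_hom_one)
  finally have "map_mat rat_of_int Z * map_mat rat_of_int U = 1\<^sub>m m" .
  from this have "map_mat rat_of_int U * map_mat rat_of_int Z = 1\<^sub>m m"
    using mat_mult_left_right_inverse[of "map_mat rat_of_int Z" m "map_mat rat_of_int U"] Z U by simp
  also have "map_mat rat_of_int U * map_mat rat_of_int Z = map_mat rat_of_int (U * Z)"
    using U Z by (rule of_int_hom.mat_hom_mult[symmetric])
  also have "1\<^sub>m m = map_mat rat_of_int (1\<^sub>m m)" by (rule of_int_hom.mat_hom_one[symmetric])
  finally have "U * Z = 1\<^sub>m m" by (rule of_int_hom.mat_hom_inj)
  with ZU U Z show ?thesis by (auto simp: GL_Z_iff)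
qed

lemma GL_Z_transpose_surj:
  assumes "U \<in> GL_Z m" "x \<in> carrier_vec m"
  obtains z where "z \<in> carrier_vec m" "transpose_mat U *\<^sub>v z = x"
proof -
  obtain W where W: "W \<in> carrier_mat m m" "W * U = 1\<^sub>m m" and U: "U \<in> carrier_mat m m"
    using assms(1) GL_Z_iff by blast
  have "transpose_mat U * transpose_mat W = 1\<^sub>m m" using transpose_mult[OF W(1) U] W(2) by simp
  then have "transpose_mat U *\<^sub>v (transpose_mat W *\<^sub>v x) = x"
    using assoc_mult_mat_vec[of "transpose_mat U" m m "transpose_mat W" m x] U W assms(2) by simp
  then show thesis using that[of "transpose_mat W *\<^sub>v x"] W assms(2) by auto
qed

lemma GL_Z_transpose_inj:
  assumes "U \<in> GL_Z m" "z \<in> carrier_vec m" "transpose_mat U *\<^sub>v z = 0\<^sub>v m"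
  shows "z = 0\<^sub>v m"
proof -
  obtain W where W: "W \<in> carrier_mat m m" "U * W = 1\<^sub>m m" and U: "U \<in> carrier_mat m m"
    using assms(1) GL_Z_iff by blast
  have "transpose_mat W * transpose_mat U = 1\<^sub>m m" using transpose_mult[OF U W(1)] W(2) by simp
  then have "transpose_mat W *\<^sub>v (transpose_mat U *\<^sub>v z) = z"
    using assoc_mult_mat_vec[of "transpose_mat W" m m "transpose_mat U" m z] U W assms(2) by simp
  moreover have "transpose_mat W *\<^sub>v 0\<^sub>v m = 0\<^sub>v m" using W by auto
  ultimately show ?thesis using assms(3) by simp
qed

text \<open>Combinations of the last \<open>b\<close> rows of a matrix with \<open>a + b\<close> rows are the combinations of all its rows
with coefficients of the form \<open>extend_zero a b c\<close>.\<close>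

definition extend_zero :: "nat \<Rightarrow> nat \<Rightarrow> int vec \<Rightarrow> int vec" where
  "extend_zero a b c = vec (a + b) (\<lambda>i. if i < a then 0 else c $ (i - a))"

lemma extend_zero_carrier [simp]: "extend_zero a b c \<in> carrier_vec (a + b)"
  by (simp add: extend_zero_def)

lemma sum_lessThan_add:
  fixes f :: "nat \<Rightarrow> 'a::comm_monoid_add"
  shows "(\<Sum>i<a + b. f i) = (\<Sum>i<a. f i) + (\<Sum>i<b. f (a + i))"
  by (induction b) (auto simp: add.assoc)

lemma last_rows_carrier: "U \<in> carrier_mat p m \<Longrightarrow> last_rows b U \<in> carrier_mat b m"
  by (simp add: last_rows_def)

lemma last_rows_transpose_mult:
  assumes U: "U \<in> carrier_mat (a + b) m" and c: "c \<in> carrier_vec b"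
  shows "transpose_mat (last_rows b U) *\<^sub>v c = transpose_mat U *\<^sub>v extend_zero a b c"
proof (rule eq_vecI)
  fix j assume "j < dim_vec (transpose_mat U *\<^sub>v extend_zero a b c)"
  then have j: "j < m" using U by simp
  show "(transpose_mat (last_rows b U) *\<^sub>v c) $ j = (transpose_mat U *\<^sub>v extend_zero a b c) $ j"
    using transpose_mult_vec_index[OF last_rows_carrier[OF U] c j]
      transpose_mult_vec_index[OF U extend_zero_carrier j] U j c
    by (simp add: sum_lessThan_add extend_zero_def last_rows_def)
qed (use U in \<open>auto simp: last_rows_def\<close>)

lemma mult_transpose_vec_of_row_ops:
  fixes A :: "int mat"
  assumes A: "A \<in> carrier_mat a m" and U: "U \<in> carrier_mat m m" and z: "z \<in> carrier_vec m"
  shows "A *\<^sub>v (transpose_mat U *\<^sub>v z) = transpose_mat (U * transpose_mat A) *\<^sub>v z"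
proof -
  have "transpose_mat (U * transpose_mat A) = A * transpose_mat U"
    using A U by (simp add: transpose_mult[of U m m "transpose_mat A" a])
  then show ?thesis using A U z by (simp add: assoc_mult_mat_vec[of A a m "transpose_mat U" m z])
qed

text \<open>Forward substitution in the triangular system: column \<open>j\<close> of \<open>H\<close> determines \<open>z $ j\<close> once the earlier
entries are known to vanish.\<close>

lemma full_hermite_kernel:
  assumes H: "H \<in> carrier_mat (a + b) a" "full_hermite a H" and z: "z \<in> carrier_vec (a + b)"
  shows "transpose_mat H *\<^sub>v z = 0\<^sub>v a \<longleftrightarrow> (\<forall>i<a. z $ i = 0)"
proof
  have ent: "(transpose_mat H *\<^sub>v z) $ j = (\<Sum>i<a. z $ i * H $$ (i, j))" if j: "j < a" for j
    using transpose_mult_vec_index[OF H(1) z j] H j by (simp add: sum_lessThan_add full_hermite_def)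
  {
    assume "\<forall>i<a. z $ i = 0"
    then have "(transpose_mat H *\<^sub>v z) $ j = 0" if "j < a" for j using ent[OF that] by simp
    then show "transpose_mat H *\<^sub>v z = 0\<^sub>v a" using H by (intro eq_vecI) auto
  next
    assume zero: "transpose_mat H *\<^sub>v z = 0\<^sub>v a"
    have "i < a \<Longrightarrow> z $ i = 0" for i
    proof (induction i rule: less_induct)
      case (less j)
      have "0 = (\<Sum>i<a. z $ i * H $$ (i, j))" using ent[OF less.prems] zero less.prems by simp
      also have "\<dots> = (\<Sum>i<a. if i = j then z $ j * H $$ (j, j) else 0)"
      proof (rule sum.cong)
        fix i assume "i \<in> {..<a}"
        then show "z $ i * H $$ (i, j) = (if i = j then z $ j * H $$ (j, j) else 0)"
          using less H(2) by (cases i j rule: linorder_cases) (auto simp: full_hermite_def)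
      qed simp
      also have "\<dots> = z $ j * H $$ (j, j)" using less.prems by simp
      finally show "z $ j = 0" using H(2) less.prems by (auto simp: full_hermite_def)
    qed
    then show "\<forall>i<a. z $ i = 0" by blast
  }
qed

text \<open>Substituting \<open>x = U\<^sup>T z\<close> turns \<open>A x\<close> into \<open>H\<^sup>T z\<close> with the Hermite normal form \<open>H = U A\<^sup>T\<close>. So \<open>x\<close> is in the
kernel iff the first \<open>a\<close> entries of \<open>z\<close> vanish, that is, iff \<open>x\<close> is a combination of the last
\<open>b\<close> rows of \<open>U\<close>.\<close>

lemma kernel_basis_last_rows:
  assumes A: "A \<in> carrier_mat a (a + b)" and U: "U \<in> GL_Z (a + b)"
    and H: "full_hermite a (U * transpose_mat A)"
  shows "kernel_basis a b A (last_rows b U)"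
  unfolding kernel_basis_def
proof (intro conjI ballI impI)
  note Uc = GL_Z_carrier[OF U]
  have Hc: "U * transpose_mat A \<in> carrier_mat (a + b) a" using Uc A by simp
  note ker = full_hermite_kernel[OF Hc H]
  {
    fix c :: "int vec" assume c: "c \<in> carrier_vec b"
    have "\<forall>i<a. extend_zero a b c $ i = 0" by (simp add: extend_zero_def)
    then show "A *\<^sub>v (transpose_mat (last_rows b U) *\<^sub>v c) = 0\<^sub>v a"
      using ker[OF extend_zero_carrier] mult_transpose_vec_of_row_ops[OF A Uc extend_zero_carrier]
      by (simp add: last_rows_transpose_mult[OF Uc c])
    assume "transpose_mat (last_rows b U) *\<^sub>v c = 0\<^sub>v (a + b)"
    then have zero: "extend_zero a b c = 0\<^sub>v (a + b)"
      using GL_Z_transpose_inj[OF U extend_zero_carrier] by (simp add: last_rows_transpose_mult[OF Uc c])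
    show "c = 0\<^sub>v b"
    proof (rule eq_vecI)
      fix i assume "i < dim_vec (0\<^sub>v b)"
      then show "c $ i = 0\<^sub>v b $ i"
        using arg_cong[OF zero, of "\<lambda>v. v $ (a + i)"] by (simp add: extend_zero_def)
    qed (use c in simp)
  next
    fix x assume x: "x \<in> carrier_vec (a + b)" "A *\<^sub>v x = 0\<^sub>v a"
    obtain z where z: "z \<in> carrier_vec (a + b)" "transpose_mat U *\<^sub>v z = x"
      using GL_Z_transpose_surj[OF U x(1)] .
    have "\<forall>i<a. z $ i = 0" using ker[OF z(1)] mult_transpose_vec_of_row_ops[OF A Uc z(1)] z(2) x(2) by simp
    then have "z = extend_zero a b (vec b (\<lambda>i. z $ (a + i)))"
      using z(1) by (intro eq_vecI) (auto simp: extend_zero_def)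
    then show "\<exists>c\<in>carrier_vec b. x = transpose_mat (last_rows b U) *\<^sub>v c"
      using z(2) last_rows_transpose_mult[OF Uc, of "vec b (\<lambda>i. z $ (a + i))"]
      by (intro bexI[of _ "vec b (\<lambda>i. z $ (a + i))"]) auto
  }
qed

text \<open>Solve \<open>U x = extend_zero a b y\<close>. For the theorem this means that the columns of a Gale dual generate
the lattice.\<close>

lemma last_rows_surj:
  assumes U: "U \<in> GL_Z (a + b)" and y: "y \<in> carrier_vec b"
  shows "\<exists>x\<in>carrier_vec (a + b). last_rows b U *\<^sub>v x = y"
proof -
  obtain W where W: "W \<in> carrier_mat (a + b) (a + b)" "U * W = 1\<^sub>m (a + b)" and Uc: "U \<in> carrier_mat (a + b) (a + b)"
    using U GL_Z_iff by blast
  let ?e = "extend_zero a b y"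
  let ?x = "W *\<^sub>v ?e"
  have x: "?x \<in> carrier_vec (a + b)" by (rule mult_mat_vec_carrier[OF W(1) extend_zero_carrier])
  have Ux: "U *\<^sub>v ?x = ?e" using assoc_mult_mat_vec[OF Uc W(1) extend_zero_carrier, of y] W(2) by simp
  have "last_rows b U *\<^sub>v ?x = y"
  proof (rule eq_vecI)
    fix i assume "i < dim_vec y"
    then have i: "i < b" using y by simp
    have "Matrix.row (last_rows b U) i = Matrix.row U (a + i)"
      using i Uc by (intro eq_vecI) (auto simp: last_rows_def)
    then have "(last_rows b U *\<^sub>v ?x) $ i = (U *\<^sub>v ?x) $ (a + i)" using i Uc by (simp add: last_rows_def)
    then show "(last_rows b U *\<^sub>v ?x) $ i = y $ i" unfolding Ux using i by (simp add: extend_zero_def)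
  qed (use y in \<open>simp add: last_rows_def\<close>)
  with x show ?thesis by blast
qed

lemma gale_dual_exists:
  assumes "A \<in> carrier_mat a (a + b)" "rank_int A = a"
  shows "\<exists>G. gale_dual a b A G"
proof -
  obtain U where U: "U \<in> GL_Z (a + b)" "full_hermite a (U * transpose_mat A)"
    using full_hermite_exists[OF assms] .
  then have "gale_dual a b A (last_rows b U)"
    using assms kernel_basis_last_rows[OF assms(1) U] last_rows_carrier[OF GL_Z_carrier[OF U(1)]]
    by (simp add: gale_dual_iff)
  then show ?thesis by blast
qed

text \<open>The last \<open>b\<close> rows of a unimodular matrix that produces the Hermite normal form span the kernel of
\<open>A\<close>. Exchanging them for another basis of the kernel changes neither unimodularity nor the product
with \<open>A\<^sup>T\<close>, whose last \<open>b\<close> rows are zero in any case. So every choice of the Gale dual occurs.\<close>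

lemma gale_dual_hermite:
  assumes "gale_dual a b A G"
  shows "\<exists>U\<in>GL_Z (a + b). hermite_normal_form (U * transpose_mat A) \<and> G = last_rows b U"
proof -
  have A: "A \<in> carrier_mat a (a + b)" and rank: "rank_int A = a" and G: "G \<in> carrier_mat b (a + b)"
    and basis: "kernel_basis a b A G"
    using assms by (auto simp: gale_dual_iff)
  obtain U where U: "U \<in> GL_Z (a + b)" and H: "full_hermite a (U * transpose_mat A)"
    using full_hermite_exists[OF A rank] .
  note Uc = GL_Z_carrier[OF U]
  define U' where "U' = mat (a + b) (a + b) (\<lambda>(i, j). if i < a then U $$ (i, j) else G $$ (i - a, j))"
  have U'c: "U' \<in> carrier_mat (a + b) (a + b)" by (simp add: U'_def)
  have last: "G = last_rows b U'" using G by (intro eq_matI) (auto simp: U'_def last_rows_def)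
  have row: "Matrix.row U' i = (if i < a then Matrix.row U i else Matrix.row G (i - a))" if "i < a + b" for i
    using that Uc G by (intro eq_vecI) (auto simp: U'_def)
  have "U' * transpose_mat A = U * transpose_mat A"
  proof (rule eq_matI)
    fix i j assume "i < dim_row (U * transpose_mat A)" "j < dim_col (U * transpose_mat A)"
    then have ij: "i < a + b" "j < a" using Uc A by auto
    show "(U' * transpose_mat A) $$ (i, j) = (U * transpose_mat A) $$ (i, j)"
    proof (cases "i < a")
      case True
      then show ?thesis using ij row[of i] A Uc U'c by simp
    next
      case False
      then have i: "i - a < b" using ij by simp
      have "A *\<^sub>v Matrix.row G (i - a) = 0\<^sub>v a"
        using basis transpose_mult_unit_vec[OF G i] unfolding kernel_basis_def
        by (metis unit_vec_carrier)
      from arg_cong[OF this, of "\<lambda>v. v $ j"] have "Matrix.row A j \<bullet> Matrix.row G (i - a) = 0"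
        using ij A by simp
      then have "Matrix.row G (i - a) \<bullet> Matrix.row A j = 0"
        using A G ij i by (subst comm_scalar_prod[of _ "a + b"]) auto
      then show ?thesis using False ij row[of i] A Uc U'c H by (simp add: full_hermite_def)
    qed
  qed (use U'c Uc in auto)
  moreover have "U' \<in> GL_Z (a + b)"
  proof (rule GL_Z_surjI[OF U'c])
    fix x :: "int vec" assume x: "x \<in> carrier_vec (a + b)"
    obtain z where z: "z \<in> carrier_vec (a + b)" "transpose_mat U *\<^sub>v z = x"
      using GL_Z_transpose_surj[OF U x] .
    define d where "d = vec b (\<lambda>i. z $ (a + i))"
    have d: "d \<in> carrier_vec b" by (simp add: d_def)
    \<comment> \<open>The part of \<open>x\<close> that comes from the last rows of \<open>U\<close>
      is in the kernel and can be rewritten with the rows of \<open>G\<close>.\<close>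
    define k where "k = transpose_mat (last_rows b U) *\<^sub>v d"
    have "A *\<^sub>v k = 0\<^sub>v a"
      using kernel_basis_last_rows[OF A U H] d by (simp add: k_def kernel_basis_def)
    moreover have "k \<in> carrier_vec (a + b)"
      unfolding k_def by (rule transpose_mult_carrier[OF last_rows_carrier[OF Uc]])
    ultimately obtain c where c: "c \<in> carrier_vec b" "k = transpose_mat G *\<^sub>v c"
      using basis by (auto simp: kernel_basis_def)
    define y where "y = vec (a + b) (\<lambda>i. if i < a then z $ i else c $ (i - a))"
    have y: "y \<in> carrier_vec (a + b)" by (simp add: y_def)
    have "transpose_mat U' *\<^sub>v y = x"
    proof (rule eq_vecI)
      fix j assume "j < dim_vec x"
      then have j: "j < a + b" using x by simp
      have "(transpose_mat U' *\<^sub>v y) $ j = (\<Sum>i<a. z $ i * U $$ (i, j)) + (\<Sum>i<b. c $ i * G $$ (i, j))"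
        using transpose_mult_vec_index[OF U'c y j] j by (simp add: sum_lessThan_add U'_def y_def)
      also have "(\<Sum>i<b. c $ i * G $$ (i, j)) = k $ j"
        using transpose_mult_vec_index[OF G c(1) j] c(2) by simp
      also have "k $ j = (\<Sum>i<b. z $ (a + i) * U $$ (a + i, j))"
        using transpose_mult_vec_index[OF last_rows_carrier[OF Uc] d j] Uc j
        by (simp add: k_def d_def last_rows_def)
      also have "(\<Sum>i<a. z $ i * U $$ (i, j)) + \<dots> = x $ j"
        using transpose_mult_vec_index[OF Uc z(1) j] z(2) by (simp add: sum_lessThan_add)
      finally show "(transpose_mat U' *\<^sub>v y) $ j = x $ j" .
    qed (use U'c x in auto)
    with y show "\<exists>z\<in>carrier_vec (a + b). transpose_mat U' *\<^sub>v z = x" by blast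
  qed
  ultimately show ?thesis using H last by (intro bexI[of _ U']) (simp_all add: full_hermite_def)
qed

text \<open>The rows of \<open>P\<close> are the coordinates of the rows of \<open>G'\<close> with respect to those of \<open>G\<close>. The same
argument with the roles of \<open>G\<close> and \<open>G'\<close> exchanged makes \<open>P\<^sup>T\<close> surjective.\<close>

lemma kernel_basis_change:
  assumes G: "G \<in> carrier_mat b (a + b)" "kernel_basis a b A G"
    and G': "G' \<in> carrier_mat b (a + b)" "kernel_basis a b A G'"
  obtains P where "P \<in> GL_Z b" "G' = P * G"
proof -
  have row: "\<exists>c\<in>carrier_vec b. Matrix.row G' i = transpose_mat G *\<^sub>v c" if i: "i < b" for i
  proof -
    have "A *\<^sub>v (transpose_mat G' *\<^sub>v unit_vec b i) = 0\<^sub>v a"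
      using G'(2) by (simp add: kernel_basis_def)
    then have "A *\<^sub>v Matrix.row G' i = 0\<^sub>v a" using transpose_mult_unit_vec[OF G'(1) i] by simp
    moreover have "Matrix.row G' i \<in> carrier_vec (a + b)" using G'(1) i by auto
    ultimately show ?thesis using G(2) by (simp add: kernel_basis_def)
  qed
  then obtain p where p: "\<And>i. i < b \<Longrightarrow> p i \<in> carrier_vec b"
      "\<And>i. i < b \<Longrightarrow> Matrix.row G' i = transpose_mat G *\<^sub>v p i" by metis
  define P where "P = mat b b (\<lambda>(i, j). p i $ j)"
  have P: "P \<in> carrier_mat b b" by (simp add: P_def)
  have eq: "G' = P * G"
  proof (rule eq_matI)
    fix i j assume "i < dim_row (P * G)" "j < dim_col (P * G)"
    then have ij: "i < b" "j < a + b" using G(1) P by auto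
    have "Matrix.row P i = p i" using p(1)[OF ij(1)] ij by (auto simp: P_def)
    then have "(P * G) $$ (i, j) = (transpose_mat G *\<^sub>v p i) $ j"
      using ij P G(1) p(1)[OF ij(1)] by (simp add: comm_scalar_prod[of _ b])
    then show "G' $$ (i, j) = (P * G) $$ (i, j)"
      using p(2)[OF ij(1)] ij G'(1) by (metis index_row(1) carrier_matD)
  qed (use G G' P in auto)
  have "P \<in> GL_Z b"
  proof (rule GL_Z_surjI[OF P])
    fix y :: "int vec" assume y: "y \<in> carrier_vec b"
    let ?x = "transpose_mat G *\<^sub>v y"
    have "A *\<^sub>v ?x = 0\<^sub>v a" "?x \<in> carrier_vec (a + b)"
      using G y by (auto simp: kernel_basis_def)
    then obtain c where c: "c \<in> carrier_vec b" "?x = transpose_mat G' *\<^sub>v c"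
      using G'(2) by (auto simp: kernel_basis_def)
    let ?z = "transpose_mat P *\<^sub>v c"
    have z: "?z \<in> carrier_vec b" using P c by auto
    have "transpose_mat G' *\<^sub>v c = transpose_mat G *\<^sub>v ?z"
      using P G(1) c(1) by (simp add: eq transpose_mult[of P b b G "a + b"] assoc_mult_mat_vec[of _ "a + b" b _ b])
    then have "transpose_mat G *\<^sub>v (?z - y) = 0\<^sub>v (a + b)"
      using c z y G(1) mult_minus_distrib_mat_vec[of "transpose_mat G" "a + b" b ?z y] by simp
    then have "?z - y = 0\<^sub>v b" using G(2) z y by (simp add: kernel_basis_def)
    then have "?z = y" using z y by (metis eq_vecI minus_carrier_vec carrier_vecD eq_iff_diff_eq_0 index_minus_vec(1) index_zero_vec(1))
    then show "\<exists>z\<in>carrier_vec b. transpose_mat P *\<^sub>v z = y" using c by blast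
  qed
  with eq show thesis using that by blast
qed

text \<open>This is the transpose of the relation \<open>V Q\<^sup>T = 0\<close>.\<close>

lemma kernel_basis_swap:
  assumes V: "V \<in> carrier_mat n (n + r)" and Q: "Q \<in> carrier_mat r (n + r)"
    and basis: "kernel_basis n r V Q" and x: "x \<in> carrier_vec n"
  shows "Q *\<^sub>v (transpose_mat V *\<^sub>v x) = 0\<^sub>v r"
proof (rule eq_vecI)
  fix i assume "i < dim_vec (0\<^sub>v r)"
  then have i: "i < r" by simp
  have Vx: "transpose_mat V *\<^sub>v x \<in> carrier_vec (n + r)" by (rule transpose_mult_carrier[OF V])
  have Qi: "Matrix.row Q i \<in> carrier_vec (n + r)" using Q i by auto
  have "V *\<^sub>v Matrix.row Q i = 0\<^sub>v n"
    using basis transpose_mult_unit_vec[OF Q i] unfolding kernel_basis_def by (metis unit_vec_carrier)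
  then have "(transpose_mat V *\<^sub>v x) \<bullet> Matrix.row Q i = 0"
    using transpose_vec_mult_scalar[OF V Qi x] x by simp
  then show "(Q *\<^sub>v (transpose_mat V *\<^sub>v x)) $ i = 0\<^sub>v r $ i"
    using i Q comm_scalar_prod[OF Vx Qi] by simp
qed (use Q in simp)

lemma smult_one_mat_mult_vec:
  fixes v :: "int vec"
  assumes v: "v \<in> carrier_vec n"
  shows "(k \<cdot>\<^sub>m 1\<^sub>m n) *\<^sub>v v = k \<cdot>\<^sub>v v"
proof (rule eq_vecI)
  fix i assume "i < dim_vec (k \<cdot>\<^sub>v v)"
  then have i: "i < n" using v by simp
  have "((k \<cdot>\<^sub>m 1\<^sub>m n) *\<^sub>v v) $ i = (\<Sum>j\<in>{0..<n}. k * (if j = i then 1 else 0) * v $ j)"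
    using i v by (auto simp: scalar_prod_def intro!: sum.cong)
  also have "\<dots> = (\<Sum>j\<in>{0..<n}. if j = i then k * v $ i else 0)" by (intro sum.cong) auto
  finally have "((k \<cdot>\<^sub>m 1\<^sub>m n) *\<^sub>v v) $ i = (\<Sum>j\<in>{0..<n}. if j = i then k * v $ i else 0)" .
  then show "((k \<cdot>\<^sub>m 1\<^sub>m n) *\<^sub>v v) $ i = (k \<cdot>\<^sub>v v) $ i" using i v by simp
qed (use v in simp)

text \<open>Over the rationals the row space of \<open>V\<close> is the orthogonal complement of the kernel of \<open>V\<close>. The
integral version: with \<open>k\<close> the determinant of the Gram matrix of \<open>V\<close>, Cramer's rule gives an integer
vector \<open>y\<close> for which \<open>k w - V\<^sup>T y\<close> lies in the kernel of \<open>V\<close> and is orthogonal to it, hence is zero.\<close>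

lemma multiple_in_row_lattice:
  assumes V: "V \<in> carrier_mat n (n + r)" and Q: "Q \<in> carrier_mat r (n + r)"
    and rank: "rank_int V = n" and basis: "kernel_basis n r V Q"
    and w: "w \<in> carrier_vec (n + r)" "Q *\<^sub>v w = 0\<^sub>v r"
  obtains k y where "k \<noteq> 0" "y \<in> carrier_vec n" "k \<cdot>\<^sub>v w = transpose_mat V *\<^sub>v y"
proof -
  let ?Vt = "transpose_mat V"
  define G where "G = V * ?Vt"
  have G: "G \<in> carrier_mat n n" using V by (simp add: G_def)
  have det: "det G \<noteq> 0" unfolding G_def using rank rank_int_full_iff[OF V] by (intro det_gram_nonzero[OF V]) simp
  note adj = adj_mat[OF G]
  \<comment> \<open>By Cramer's rule \<open>y\<close> is \<open>det G\<close> times the solution \<open>x\<close> of \<open>G x = V w\<close>.\<close>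
  define y where "y = adj_mat G *\<^sub>v (V *\<^sub>v w)"
  have Vw: "V *\<^sub>v w \<in> carrier_vec n" by (rule mult_mat_vec_carrier[OF V w(1)])
  have y: "y \<in> carrier_vec n" unfolding y_def by (rule mult_mat_vec_carrier[OF adj(1) Vw])
  have Vty: "?Vt *\<^sub>v y \<in> carrier_vec (n + r)" by (rule transpose_mult_carrier[OF V])
  have "V *\<^sub>v (?Vt *\<^sub>v y) = G *\<^sub>v y"
    unfolding G_def using assoc_mult_mat_vec[OF V _ y, of ?Vt] V by simp
  also have "\<dots> = (G * adj_mat G) *\<^sub>v (V *\<^sub>v w)"
    unfolding y_def using assoc_mult_mat_vec[OF G adj(1) Vw] by simp
  also have "\<dots> = det G \<cdot>\<^sub>v (V *\<^sub>v w)"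
    unfolding adj(2) by (rule smult_one_mat_mult_vec[OF Vw])
  finally have Vy: "V *\<^sub>v (?Vt *\<^sub>v y) = det G \<cdot>\<^sub>v (V *\<^sub>v w)" .
  define u where "u = det G \<cdot>\<^sub>v w - ?Vt *\<^sub>v y"
  have u: "u \<in> carrier_vec (n + r)" using w(1) Vty by (simp add: u_def)
  \<comment> \<open>\<open>u\<close> is killed by both \<open>V\<close> and \<open>Q\<close>; being
    in the kernel of \<open>V\<close>, it is a combination of the rows of \<open>Q\<close>, and
    therefore orthogonal to itself.\<close>
  have smult: "A *\<^sub>v (det G \<cdot>\<^sub>v w) = det G \<cdot>\<^sub>v (A *\<^sub>v w)" if "A \<in> carrier_mat p (n + r)" for A :: "int mat" and p
    using that w(1) by (intro eq_vecI) auto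
  have "V *\<^sub>v u = 0\<^sub>v n"
    using mult_minus_distrib_mat_vec[OF V, of "det G \<cdot>\<^sub>v w" "?Vt *\<^sub>v y"] w(1) Vty V
    by (simp add: u_def Vy smult[OF V])
  then obtain c where c: "c \<in> carrier_vec r" "u = transpose_mat Q *\<^sub>v c"
    using basis u by (auto simp: kernel_basis_def)
  have "det G \<cdot>\<^sub>v 0\<^sub>v r = 0\<^sub>v r" by auto
  then have "Q *\<^sub>v u = 0\<^sub>v r"
    using mult_minus_distrib_mat_vec[OF Q, of "det G \<cdot>\<^sub>v w" "?Vt *\<^sub>v y"] w Vty
      kernel_basis_swap[OF V Q basis y] by (simp add: u_def smult[OF Q])
  then have "c \<bullet> (Q *\<^sub>v u) = 0" using c(1) by simp
  then have "u \<bullet> u = 0" using transpose_vec_mult_scalar[OF Q u c(1)] c(2) by simp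
  then have zero: "u = 0\<^sub>v (n + r)" using scalar_prod_self_eq_0D u by blast
  have "det G \<cdot>\<^sub>v w = ?Vt *\<^sub>v y"
  proof (rule eq_vecI)
    fix i assume "i < dim_vec (?Vt *\<^sub>v y)"
    then show "(det G \<cdot>\<^sub>v w) $ i = (?Vt *\<^sub>v y) $ i"
      using arg_cong[OF zero, of "\<lambda>v. v $ i"] Vty w(1) V by (simp add: u_def)
  qed (use w(1) V in auto)
  then show thesis using that det y by blast
qed

section \<open>Lattices in a Euclidean space\<close>

lemma lattice_group_simps [simp]:
  "carrier (lattice_group N) = N" "x \<otimes>\<^bsub>lattice_group N\<^esub> y = x + y" "\<one>\<^bsub>lattice_group N\<^esub> = 0"
  by (simp_all add: lattice_group_def)

lemma lattice_in_closed:
  assumes "lattice_in N"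
  shows "0 \<in> N" "x \<in> N \<Longrightarrow> y \<in> N \<Longrightarrow> x + y \<in> N" "x \<in> N \<Longrightarrow> - x \<in> N"
proof -
  obtain B where N: "N = {\<Sum>x\<in>B. real_of_int (c x) *\<^sub>R x | c. True}"
    using assms by (auto simp: lattice_in_def)
  show "0 \<in> N" unfolding N by (auto intro!: exI[of _ "\<lambda>_. 0"])
  show "x \<in> N \<Longrightarrow> y \<in> N \<Longrightarrow> x + y \<in> N"
    unfolding N by (auto simp: sum.distrib[symmetric] scaleR_add_left[symmetric] of_int_add[symmetric] simp del: of_int_add)
  show "x \<in> N \<Longrightarrow> - x \<in> N"
  proof -
    assume "x \<in> N"
    then obtain c where "x = (\<Sum>x\<in>B. real_of_int (c x) *\<^sub>R x)" unfolding N by auto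
    then have "- x = (\<Sum>x\<in>B. real_of_int (- c x) *\<^sub>R x)" by (simp add: sum_negf)
    then show "- x \<in> N"
      unfolding N by (intro CollectI exI[of _ "\<lambda>x. - c x"] conjI TrueI)
  qed
qed

lemma comm_group_lattice_group:
  assumes "lattice_in N"
  shows "comm_group (lattice_group N)"
proof (rule comm_groupI)
  fix x assume "x \<in> carrier (lattice_group N)"
  then show "\<exists>y\<in>carrier (lattice_group N). y \<otimes>\<^bsub>lattice_group N\<^esub> x = \<one>\<^bsub>lattice_group N\<^esub>"
    using lattice_in_closed[OF assms] by (intro bexI[of _ "- x"]) auto
qed (use lattice_in_closed[OF assms] in \<open>auto simp: add.commute add.assoc\<close>)

lemma lattice_group_int_pow:
  assumes "lattice_in N" "x \<in> N"
  shows "x [^]\<^bsub>lattice_group N\<^esub> (c::int) = real_of_int c *\<^sub>R x"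
proof -
  interpret comm_group "lattice_group N" using assms(1) by (rule comm_group_lattice_group)
  have pow: "x [^]\<^bsub>lattice_group N\<^esub> (k::nat) = real k *\<^sub>R x" for k
    by (induction k) (simp_all add: scaleR_add_left add.commute)
  have "inv\<^bsub>lattice_group N\<^esub> (x [^]\<^bsub>lattice_group N\<^esub> k) = - (real k *\<^sub>R x)" for k :: nat
    using nat_pow_closed[of x k] assms lattice_in_closed(3)[OF assms(1), of "real k *\<^sub>R x"]
    by (intro inv_equality) (auto simp: pow)
  from this[of "nat (- c)"] show ?thesis by (auto simp: int_pow_def2 pow)
qed

lemma Z_combination_lattice_group:
  assumes "lattice_in N" "b \<in> {..<k} \<rightarrow> N"
  shows "Z_combination (lattice_group N) k b c = (\<Sum>i<k. real_of_int (c i) *\<^sub>R b i)"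
proof -
  interpret comm_group "lattice_group N" using assms(1) by (rule comm_group_lattice_group)
  show ?thesis
    using assms(2)
    by (induction k) (auto simp: Z_combination_0 Z_combination_Suc lattice_group_int_pow[OF assms(1)] Pi_iff)
qed

lemma subset_int_combinations:
  assumes "finite (B :: 'a::real_vector set)"
  shows "B \<subseteq> {\<Sum>x\<in>B. real_of_int (c x) *\<^sub>R x | c. True}"
proof
  fix x assume x: "x \<in> B"
  have "(\<Sum>y\<in>B. real_of_int (if y = x then 1 else 0) *\<^sub>R y) = (\<Sum>y\<in>B. if y = x then y else 0)"
    by (intro sum.cong) auto
  also have "\<dots> = x" using assms x by simp
  finally show "x \<in> {\<Sum>x\<in>B. real_of_int (c x) *\<^sub>R x | c. True}"
    by (intro CollectI exI[of _ "\<lambda>y. if y = x then 1 else 0"] conjI TrueI) (rule sym)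
qed

lemma lattice_basis_exists:
  assumes "lattice_in (N :: 'a::euclidean_space set)"
  obtains b where "Z_basis (lattice_group N) DIM('a) b"
proof -
  obtain B where B: "independent B" "span B = UNIV" and N: "N = {\<Sum>x\<in>B. real_of_int (c x) *\<^sub>R x | c. True}"
    using assms by (auto simp: lattice_in_def)
  have fin: "finite B" using B(1) by (rule independent_imp_finite)
  have card: "card B = DIM('a)" using dim_eq_card[of B UNIV] B by simp
  obtain b where b: "bij_betw b {..<DIM('a)} B"
    using ex_bij_betw_nat_finite[OF fin] card by (auto simp: lessThan_atLeast0)
  have sum: "(\<Sum>x\<in>B. f x) = (\<Sum>i<DIM('a). f (b i))" for f :: "'a \<Rightarrow> 'a"
    using sum.reindex_bij_betw[OF b, of f] by simp
  have BN: "x \<in> N" if "x \<in> B" for x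
    using subset_int_combinations[OF fin] that unfolding N by blast
  have bN: "b \<in> {..<DIM('a)} \<rightarrow> N" using BN b by (auto simp: bij_betw_def)
  have "Z_basis (lattice_group N) DIM('a) b"
    unfolding Z_basis_def Z_independent_def
  proof (intro conjI allI impI ballI)
    show "b \<in> {..<DIM('a)} \<rightarrow> carrier (lattice_group N)" using bN by simp
    fix c and i
    assume zero: "Z_combination (lattice_group N) DIM('a) b c = \<one>\<^bsub>lattice_group N\<^esub>" and i: "i < DIM('a)"
    define d where "d = (\<lambda>x. c (inv_into {..<DIM('a)} b x))"
    have d: "d (b j) = c j" if "j < DIM('a)" for j
      using that b by (auto simp: d_def bij_betw_def)
    have "(\<Sum>x\<in>B. real_of_int (d x) *\<^sub>R x) = 0"
      using zero by (simp add: sum d Z_combination_lattice_group[OF assms bN])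
    then have "real_of_int (d (b i)) = 0"
      using independentD[OF B(1) fin subset_refl, of "\<lambda>x. real_of_int (d x)" "b i"] i b
      by (auto simp: bij_betw_def)
    then show "c i = 0" using d[OF i] by simp
  next
    fix x assume "x \<in> carrier (lattice_group N)"
    then obtain c where "x = (\<Sum>x\<in>B. real_of_int (c x) *\<^sub>R x)" unfolding N by auto
    then have "x = Z_combination (lattice_group N) DIM('a) b (\<lambda>i. c (b i))"
      by (simp add: sum Z_combination_lattice_group[OF assms bN])
    then show "\<exists>c. x = Z_combination (lattice_group N) DIM('a) b c" by blast
  qed
  then show thesis using that by blast
qed

text \<open>A lattice with a basis \<open>b\<close>. Every point of the ambient space is \<open>comb t\<close> for unique real coordinates
\<open>t\<close>, and it is a lattice point iff its coordinates are integers.\<close>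

locale based_lattice =
  fixes N :: "'a::euclidean_space set" and b :: "nat \<Rightarrow> 'a"
  assumes lattice: "lattice_in N" and basis: "Z_basis (lattice_group N) DIM('a) b"
begin

definition comb :: "(nat \<Rightarrow> real) \<Rightarrow> 'a" where "comb t = (\<Sum>i<DIM('a). t i *\<^sub>R b i)"

lemma basis_in: "i < DIM('a) \<Longrightarrow> b i \<in> N"
  using basis by (auto simp: Z_basis_def Z_independent_def)

lemma comb_of_int: "Z_combination (lattice_group N) DIM('a) b c = comb (\<lambda>i. real_of_int (c i))"
  using Z_combination_lattice_group[OF lattice, of b "DIM('a)"] basis_in by (auto simp: comb_def)

lemma lattice_eq: "x \<in> N \<longleftrightarrow> (\<exists>c. x = comb (\<lambda>i. real_of_int (c i)))"
proof -
  interpret comm_group "lattice_group N" using lattice by (rule comm_group_lattice_group)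
  have "comb (\<lambda>i. real_of_int (c i)) \<in> N" for c
    using Z_combination_closed[of b "DIM('a)" c] basis_in by (auto simp: comb_of_int)
  then show ?thesis using basis by (auto simp: Z_basis_def comb_of_int)
qed

lemma comb_add: "comb s + comb t = comb (\<lambda>i. s i + t i)"
  by (simp add: comb_def sum.distrib scaleR_add_left)

lemma comb_scaleR: "a *\<^sub>R comb t = comb (\<lambda>i. a * t i)"
  by (simp add: comb_def scaleR_sum_right)

text \<open>A basis of the lattice as an abelian group spans the lattice, which contains a basis of the vector
space.\<close>

lemma span_basis: "span (b ` {..<DIM('a)}) = UNIV"
proof -
  obtain B where B: "span B = UNIV" "independent B"
      and N: "N = {\<Sum>x\<in>B. real_of_int (c x) *\<^sub>R x | c. True}"
    using lattice by (auto simp: lattice_in_def)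
  have "B \<subseteq> N"
    unfolding N by (rule subset_int_combinations[OF independent_imp_finite[OF B(2)]])
  moreover have "N \<subseteq> span (b ` {..<DIM('a)})"
  proof
    fix x assume "x \<in> N"
    then obtain c where "x = comb (\<lambda>i. real_of_int (c i))" using lattice_eq by blast
    then show "x \<in> span (b ` {..<DIM('a)})"
      unfolding comb_def by simp (rule span_sum, rule span_scale, rule span_base, simp)
  qed
  ultimately have "span B \<subseteq> span (b ` {..<DIM('a)})" by (meson order_trans span_minimal subspace_span)
  then show ?thesis using B by auto
qed

lemma independent_basis: "independent (b ` {..<DIM('a)})" and inj_basis: "inj_on b {..<DIM('a)}"
proof -
  have le: "card (b ` {..<DIM('a)}) \<le> DIM('a)" using card_image_le[of "{..<DIM('a)}" b] by simp
  show ind: "independent (b ` {..<DIM('a)})"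
    using le by (intro card_le_dim_spanning[of _ UNIV]) (auto simp: span_basis)
  have "card (b ` {..<DIM('a)}) = DIM('a)"
    using dim_eq_card[of "b ` {..<DIM('a)}" UNIV] ind span_basis by simp
  then show "inj_on b {..<DIM('a)}" by (intro eq_card_imp_inj_on) auto
qed

lemma comb_eq_0:
  assumes zero: "comb t = 0" and i: "i < DIM('a)"
  shows "t i = 0"
proof -
  note inj = inj_basis
  have "(\<Sum>x\<in>b ` {..<DIM('a)}. t (inv_into {..<DIM('a)} b x) *\<^sub>R x) = 0"
    using zero inj by (simp add: sum.reindex comb_def)
  from independentD[OF independent_basis _ _ this, of "b i"] show "t i = 0" using i inj by simp
qed

lemma comb_eq_iff: "comb s = comb t \<longleftrightarrow> (\<forall>i<DIM('a). s i = t i)"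
proof
  assume "comb s = comb t"
  then have "comb (\<lambda>i. s i - t i) = 0" by (simp add: comb_def sum_subtractf scaleR_diff_left)
  then show "\<forall>i<DIM('a). s i = t i" using comb_eq_0 by fastforce
qed (simp add: comb_def)

lemma dual_comb:
  assumes "u \<in> carrier (int_dual (lattice_group N))"
  shows "u (comb (\<lambda>i. real_of_int (c i))) = (\<Sum>i<DIM('a). c i * u (b i))"
  using Z_combination_hom_int[OF comm_group_lattice_group[OF lattice], of u b "DIM('a)" c] assms basis_in
  by (auto simp: int_dual_def comb_of_int)

text \<open>Linear functionals on the lattice take arbitrary values on the basis: they are integer combinations
of the coordinate functions.\<close>

lemma dual_exists:
  obtains u where "u \<in> carrier (int_dual (lattice_group N))" "\<And>i. i < DIM('a) \<Longrightarrow> u (b i) = x i"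
proof -
  have "\<forall>v\<in>N. \<exists>c. v = comb (\<lambda>i. real_of_int (c i))" using lattice_eq by blast
  then obtain \<kappa> where \<kappa>: "\<And>v. v \<in> N \<Longrightarrow> v = comb (\<lambda>i. real_of_int (\<kappa> v i))" by metis
  \<comment> \<open>\<open>\<kappa> v\<close> are the coordinates of \<open>v\<close>; by uniqueness
    they are additive in \<open>v\<close>.\<close>
  have \<kappa>_comb: "\<kappa> v i = c i" if "v = comb (\<lambda>i. real_of_int (c i))" "i < DIM('a)" for v c i
  proof -
    have "v \<in> N" using that(1) lattice_eq by blast
    then have "comb (\<lambda>i. real_of_int (\<kappa> v i)) = comb (\<lambda>i. real_of_int (c i))" using \<kappa> that(1) by metis
    then show ?thesis using comb_eq_iff that(2) by simp
  qed
  define u where "u = restrict (\<lambda>v. \<Sum>i<DIM('a). \<kappa> v i * x i) N"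
  have "u (v + w) = u v + u w" if v: "v \<in> N" "w \<in> N" for v w
  proof -
    have "v + w = comb (\<lambda>i. real_of_int (\<kappa> v i + \<kappa> w i))"
      unfolding of_int_add comb_add[symmetric] by (intro arg_cong2[of _ _ _ _ "(+)"] \<kappa> v)
    then have add: "\<kappa> (v + w) i = \<kappa> v i + \<kappa> w i" if "i < DIM('a)" for i by (rule \<kappa>_comb[OF _ that])
    have "(\<Sum>i<DIM('a). \<kappa> (v + w) i * x i) = (\<Sum>i<DIM('a). \<kappa> v i * x i + \<kappa> w i * x i)"
      by (intro sum.cong) (simp_all add: add distrib_right)
    then show ?thesis
      using v lattice_in_closed(2)[OF lattice v] by (simp add: u_def sum.distrib)
  qed
  then have "u \<in> carrier (int_dual (lattice_group N))"
    by (auto simp: int_dual_def hom_def u_def)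
  moreover have "u (b k) = x k" if k: "k < DIM('a)" for k
  proof -
    have "comb (\<lambda>j. real_of_int (if j = k then 1 else 0)) = (\<Sum>j<DIM('a). if j = k then b j else 0)"
      unfolding comb_def by (intro sum.cong) auto
    then have "b k = comb (\<lambda>j. real_of_int (if j = k then 1 else 0))" using k by simp
    then have \<kappa>_k: "\<kappa> (b k) j = (if j = k then 1 else 0)" if "j < DIM('a)" for j by (rule \<kappa>_comb[OF _ that])
    have "u (b k) = (\<Sum>j<DIM('a). \<kappa> (b k) j * x j)" using basis_in[OF k] by (simp add: u_def)
    also have "\<dots> = (\<Sum>j<DIM('a). if j = k then x j else 0)" by (intro sum.cong) (simp_all add: \<kappa>_k)
    also have "\<dots> = x k" using k by simp
    finally have "u (b k) = x k" .
    then show ?thesis .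
  qed
  ultimately show thesis using that by blast
qed

end

section \<open>Dual groups and torsion\<close>

lemma int_dual_simps:
  "\<phi> \<in> carrier (int_dual G) \<longleftrightarrow> \<phi> \<in> hom G integer_group \<and> \<phi> \<in> extensional (carrier G)"
  "\<phi> \<otimes>\<^bsub>int_dual G\<^esub> \<psi> = restrict (\<lambda>x. \<phi> x + \<psi> x) (carrier G)"
  "\<one>\<^bsub>int_dual G\<^esub> = restrict (\<lambda>x. 0) (carrier G)"
  by (simp_all add: int_dual_def)

lemma comm_group_int_dual:
  assumes "group G"
  shows "comm_group (int_dual G)"
proof -
  interpret group G by fact
  show ?thesis
  proof (rule comm_groupI)
    fix \<phi> assume \<phi>: "\<phi> \<in> carrier (int_dual G)"
    then have "restrict (\<lambda>x. - \<phi> x) (carrier G) \<in> carrier (int_dual G)"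
      by (auto simp: int_dual_simps hom_def)
    moreover have "restrict (\<lambda>x. - \<phi> x) (carrier G) \<otimes>\<^bsub>int_dual G\<^esub> \<phi> = \<one>\<^bsub>int_dual G\<^esub>"
      by (auto simp: int_dual_simps restrict_def)
    ultimately show "\<exists>\<psi>\<in>carrier (int_dual G). \<psi> \<otimes>\<^bsub>int_dual G\<^esub> \<phi> = \<one>\<^bsub>int_dual G\<^esub>" by blast
    show "\<one>\<^bsub>int_dual G\<^esub> \<otimes>\<^bsub>int_dual G\<^esub> \<phi> = \<phi>"
      using \<phi> by (auto simp: int_dual_simps extensional_def restrict_def)
  qed (auto simp: int_dual_simps hom_def restrict_def extensional_def)
qed

lemma torsion_free_FactGroup_iff:
  assumes "comm_group G" "subgroup H G"
  shows "torsion_free (G Mod H) \<longleftrightarrow> (\<forall>x\<in>carrier G. \<forall>k::nat. k > 0 \<longrightarrow> x [^]\<^bsub>G\<^esub> k \<in> H \<longrightarrow> x \<in> H)"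
proof -
  interpret comm_group G by fact
  have normal: "H \<lhd> G" using assms(2) by (rule subgroup_imp_normal)
  interpret normal H G by fact
  interpret Q: group "G Mod H" by (rule factorgroup_is_group)
  interpret h: group_hom G "G Mod H" "\<lambda>x. H #>\<^bsub>G\<^esub> x" using r_coset_hom_Mod by unfold_locales
  have mem: "H #>\<^bsub>G\<^esub> x = \<one>\<^bsub>G Mod H\<^esub> \<longleftrightarrow> x \<in> H" if "x \<in> carrier G" for x
    using coset_join1[OF _ that assms(2)] coset_join2[OF that assms(2)] by auto
  have pow: "(H #>\<^bsub>G\<^esub> x) [^]\<^bsub>G Mod H\<^esub> k = H #>\<^bsub>G\<^esub> (x [^]\<^bsub>G\<^esub> k)" if "x \<in> carrier G" for x and k :: nat
    using h.hom_nat_pow[OF that] by simp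
  show ?thesis
    unfolding torsion_free_def carrier_FactGroup by (simp add: pow mem del: one_FactGroup)
qed

lemma free_abelian_imp_torsion_free:
  assumes "group G" "free_abelian G"
  shows "torsion_free G"
proof -
  obtain S h where h: "h \<in> iso G (free_Abelian_group (S :: 'a set))"
    using assms(2) by (auto simp: free_abelian_def is_iso_def)
  interpret group G by fact
  interpret F: group "free_Abelian_group S" by simp
  interpret h: group_hom G "free_Abelian_group S" h using h by unfold_locales (auto simp: iso_def)
  have inj: "inj_on h (carrier G)" using h by (auto simp: iso_def bij_betw_def)
  show ?thesis
    unfolding torsion_free_def
  proof (intro ballI allI impI)
    fix x and k :: nat assume x: "x \<in> carrier G" "k > 0" "x [^]\<^bsub>G\<^esub> k = \<one>\<^bsub>G\<^esub>"
    then have "frag_cmul (int k) (h x) = 0" using h.hom_nat_pow[OF x(1), of k] h.hom_one by simp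
    then have "Poly_Mapping.lookup (h x) s = 0" for s
      using x(2) lookup_frag_cmul[of "int k" "h x" s] by simp
    then have "h x = h \<one>\<^bsub>G\<^esub>" by (simp add: poly_mapping_eqI)
    then show "x = \<one>\<^bsub>G\<^esub>" using inj x(1) by (simp add: inj_on_def)
  qed
qed

section \<open>Divisors and the class group\<close>

text \<open>The identification of integer vectors with divisors that is given by an enumeration of the prime
divisors.\<close>

definition divisor :: "(nat \<Rightarrow> 'b) \<Rightarrow> int vec \<Rightarrow> ('b \<Rightarrow>\<^sub>0 int)" where
  "divisor \<rho> w = (\<Sum>j<dim_vec w. frag_cmul (w $ j) (frag_of (\<rho> j)))"

lemma lookup_divisor:
  assumes "inj_on \<rho> {..<m}" "w \<in> carrier_vec m" "j < m"
  shows "Poly_Mapping.lookup (divisor \<rho> w) (\<rho> j) = w $ j"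
proof -
  have "Poly_Mapping.lookup (divisor \<rho> w) (\<rho> j) = (\<Sum>i<m. if i = j then w $ j else 0)"
    unfolding divisor_def lookup_sum using assms
    by (intro sum.cong) (auto simp: inj_on_def)
  then show ?thesis using assms by simp
qed

lemma divisor_carrier:
  assumes "\<rho> ` {..<m} \<subseteq> R" "w \<in> carrier_vec m"
  shows "divisor \<rho> w \<in> carrier (free_Abelian_group R)"
proof -
  have "Poly_Mapping.keys (frag_cmul (w $ j) (frag_of (\<rho> j))) \<subseteq> R" if "j < m" for j
    using order_trans[OF keys_cmul] that assms(1) by fastforce
  then show ?thesis
    using assms(2) order_trans[OF keys_sum] unfolding divisor_def
    by (simp add: UN_subset_iff order_trans[OF keys_sum])
qed

lemma divisor_lookup:
  assumes "bij_betw \<rho> {..<m} R" "D \<in> carrier (free_Abelian_group R)"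
  shows "D = divisor \<rho> (vec m (\<lambda>j. Poly_Mapping.lookup D (\<rho> j)))" (is "D = ?D")
proof (rule poly_mapping_eqI)
  fix x
  have inj: "inj_on \<rho> {..<m}" and img: "\<rho> ` {..<m} = R" using assms(1) by (auto simp: bij_betw_def)
  show "Poly_Mapping.lookup D x = Poly_Mapping.lookup ?D x"
  proof (cases "x \<in> R")
    case True
    then obtain j where "j < m" "x = \<rho> j" using img by auto
    then show ?thesis using lookup_divisor[OF inj, of "vec m (\<lambda>j. Poly_Mapping.lookup D (\<rho> j))" j] by simp
  next
    case False
    then have "x \<notin> Poly_Mapping.keys D" "x \<notin> Poly_Mapping.keys ?D"
      using assms(2) divisor_carrier[of \<rho> m R "vec m (\<lambda>j. Poly_Mapping.lookup D (\<rho> j))"] img by auto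
    then show ?thesis by (simp add: in_keys_iff)
  qed
qed

lemma divisor_eq_Z_combination:
  assumes "\<rho> ` {..<m} \<subseteq> R" "w \<in> carrier_vec m"
  shows "divisor \<rho> w = Z_combination (free_Abelian_group R) m (\<lambda>j. frag_of (\<rho> j)) (($) w)"
proof -
  interpret comm_group "free_Abelian_group R" by (rule abelian_free_Abelian_group)
  have "Z_combination (free_Abelian_group R) k (\<lambda>j. frag_of (\<rho> j)) (($) w)
      = (\<Sum>j<k. frag_cmul (w $ j) (frag_of (\<rho> j)))" if "k \<le> m" for k
    using that
  proof (induction k)
    case (Suc k)
    have "(\<lambda>j. frag_of (\<rho> j)) \<in> {..<Suc k} \<rightarrow> carrier (free_Abelian_group R)"
      using Suc.prems assms(1) by (auto simp: image_subset_iff)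
    moreover have "Poly_Mapping.keys (frag_of (\<rho> k)) \<subseteq> R"
      using Suc.prems assms(1) by (auto simp: keys_frag_of image_subset_iff)
    ultimately show ?case using Suc by (simp add: Z_combination_Suc)
  qed (simp add: Z_combination_0)
  then show ?thesis using assms(2) by (simp add: divisor_def)
qed

lemma hom_divisor:
  assumes "\<rho> ` {..<m} \<subseteq> R" "w \<in> carrier_vec m" "\<psi> \<in> hom (free_Abelian_group R) integer_group"
  shows "\<psi> (divisor \<rho> w) = (\<Sum>j<m. w $ j * \<psi> (frag_of (\<rho> j)))"
  unfolding divisor_eq_Z_combination[OF assms(1,2)] using assms
  by (intro Z_combination_hom_int[OF abelian_free_Abelian_group assms(3)]) auto

lemma divisor_add:
  "v \<in> carrier_vec m \<Longrightarrow> w \<in> carrier_vec m \<Longrightarrow> divisor \<rho> (v + w) = divisor \<rho> v + divisor \<rho> w"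
  by (simp add: divisor_def sum.distrib[symmetric] frag_cmul_distrib)

lemma frag_cmul_divisor: "frag_cmul k (divisor \<rho> w) = divisor \<rho> (k \<cdot>\<^sub>v w)"
  by (simp add: divisor_def frag_cmul_sum)

lemma divisor_inj:
  assumes "inj_on \<rho> {..<m}" "v \<in> carrier_vec m" "w \<in> carrier_vec m" "divisor \<rho> v = divisor \<rho> w"
  shows "v = w"
  using assms lookup_divisor[OF assms(1)] by (metis eq_vecI carrier_vecD)

text \<open>A fan matrix together with the lattice basis to which it refers: column \<open>j\<close> contains the coordinates
of the generator of the \<open>j\<close>-th ray.\<close>

locale fan_coordinates = based_lattice N b
  for N :: "'a::euclidean_space set" and b :: "nat \<Rightarrow> 'a" +
  fixes \<Sigma> :: "'a set set" and \<rho> :: "nat \<Rightarrow> 'a set" and m :: nat and V :: "int mat"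
  assumes enum: "bij_betw \<rho> {..<m} (rays \<Sigma>)" and V: "V \<in> carrier_mat DIM('a) m"
    and gens: "j < m \<Longrightarrow> ray_generator N (\<rho> j) = comb (\<lambda>i. real_of_int (V $$ (i, j)))"
begin

lemma enum_inj_image: "inj_on \<rho> {..<m}" "\<rho> ` {..<m} = rays \<Sigma>"
  using enum by (auto simp: bij_betw_def)

lemma div_map_eq:
  assumes u: "u \<in> carrier (int_dual (lattice_group N))"
  shows "div_map N \<Sigma> u = divisor \<rho> (transpose_mat V *\<^sub>v vec DIM('a) (\<lambda>i. u (b i)))"
proof -
  have "div_map N \<Sigma> u = (\<Sum>j<m. frag_cmul (u (ray_generator N (\<rho> j))) (frag_of (\<rho> j)))"
    unfolding div_map_def enum_inj_image(2)[symmetric] by (simp add: sum.reindex[OF enum_inj_image(1)])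
  also have "\<dots> = divisor \<rho> (transpose_mat V *\<^sub>v vec DIM('a) (\<lambda>i. u (b i)))"
    unfolding divisor_def
  proof (rule sum.cong)
    fix j assume "j \<in> {..<dim_vec (transpose_mat V *\<^sub>v vec DIM('a) (\<lambda>i. u (b i)))}"
    then have j: "j < m" using V by simp
    have "u (ray_generator N (\<rho> j)) = (transpose_mat V *\<^sub>v vec DIM('a) (\<lambda>i. u (b i))) $ j"
      unfolding gens[OF j] dual_comb[OF u]
      using transpose_mult_vec_index[OF V _ j, of "vec DIM('a) (\<lambda>i. u (b i))"] by (simp add: mult.commute)
    then show "frag_cmul (u (ray_generator N (\<rho> j))) (frag_of (\<rho> j)) =
        frag_cmul ((transpose_mat V *\<^sub>v vec DIM('a) (\<lambda>i. u (b i))) $ j) (frag_of (\<rho> j))" by simp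
  qed (use V in simp)
  finally show ?thesis .
qed

lemma principal_divisors_eq:
  "principal_divisors N \<Sigma> = {divisor \<rho> (transpose_mat V *\<^sub>v x) | x. x \<in> carrier_vec DIM('a)}"
proof (intro equalityI subsetI)
  fix D assume "D \<in> principal_divisors N \<Sigma>"
  then show "D \<in> {divisor \<rho> (transpose_mat V *\<^sub>v x) | x. x \<in> carrier_vec DIM('a)}"
    unfolding principal_divisors_def using div_map_eq vec_carrier by blast
next
  fix D assume "D \<in> {divisor \<rho> (transpose_mat V *\<^sub>v x) | x. x \<in> carrier_vec DIM('a)}"
  then obtain x where x: "x \<in> carrier_vec DIM('a)" "D = divisor \<rho> (transpose_mat V *\<^sub>v x)" by auto
  obtain u where u: "u \<in> carrier (int_dual (lattice_group N))" "\<And>i. i < DIM('a) \<Longrightarrow> u (b i) = x $ i"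
    using dual_exists[of "($) x"] by blast
  have "vec DIM('a) (\<lambda>i. u (b i)) = x" using u(2) x(1) by auto
  then have "D = div_map N \<Sigma> u" using div_map_eq[OF u(1)] x(2) by simp
  then show "D \<in> principal_divisors N \<Sigma>" using u(1) by (auto simp: principal_divisors_def)
qed

lemma principal_subgroup: "subgroup (principal_divisors N \<Sigma>) (torus_divisors \<Sigma>)"
proof (rule group.subgroupI)
  show "group (torus_divisors \<Sigma>)" by simp
  show sub: "principal_divisors N \<Sigma> \<subseteq> carrier (torus_divisors \<Sigma>)"
    unfolding principal_divisors_eq
    using divisor_carrier[of \<rho> m "rays \<Sigma>"] enum_inj_image(2) transpose_mult_carrier[OF V] by auto
  show "principal_divisors N \<Sigma> \<noteq> {}" unfolding principal_divisors_eq by (auto intro: zero_carrier_vec)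
  fix D E assume D: "D \<in> principal_divisors N \<Sigma>"
  then obtain x where x: "x \<in> carrier_vec DIM('a)" "D = divisor \<rho> (transpose_mat V *\<^sub>v x)"
    unfolding principal_divisors_eq by auto
  have "inv\<^bsub>torus_divisors \<Sigma>\<^esub> D = frag_cmul (- 1) D" using sub D by auto
  also have "\<dots> = divisor \<rho> (transpose_mat V *\<^sub>v ((- 1) \<cdot>\<^sub>v x))"
    unfolding x(2) frag_cmul_divisor using V x(1) by (intro arg_cong[of _ _ "divisor \<rho>"] eq_vecI) auto
  finally show "inv\<^bsub>torus_divisors \<Sigma>\<^esub> D \<in> principal_divisors N \<Sigma>"
    using x(1) unfolding principal_divisors_eq by auto
  assume "E \<in> principal_divisors N \<Sigma>"
  then obtain y where y: "y \<in> carrier_vec DIM('a)" "E = divisor \<rho> (transpose_mat V *\<^sub>v y)"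
    unfolding principal_divisors_eq by auto
  have "D \<otimes>\<^bsub>torus_divisors \<Sigma>\<^esub> E = divisor \<rho> (transpose_mat V *\<^sub>v (x + y))"
    using V x y transpose_mult_carrier[OF V]
    by (simp add: mult_add_distrib_mat_vec[of _ m "DIM('a)"] divisor_add[of _ m])
  then show "D \<otimes>\<^bsub>torus_divisors \<Sigma>\<^esub> E \<in> principal_divisors N \<Sigma>"
    using x(1) y(1) unfolding principal_divisors_eq by auto
qed

lemma comm_group_class_group: "comm_group (class_group N \<Sigma>)"
  unfolding class_group_def
  by (rule comm_group.abelian_FactGroup[OF abelian_free_Abelian_group principal_subgroup])

lemma divisor_class_hom: "divisor_class N \<Sigma> \<in> hom (torus_divisors \<Sigma>) (class_group N \<Sigma>)"
  unfolding divisor_class_def[abs_def] class_group_def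
  by (rule normal.r_coset_hom_Mod, rule comm_group.subgroup_imp_normal[OF abelian_free_Abelian_group principal_subgroup])

lemma carrier_class_group: "carrier (class_group N \<Sigma>) = divisor_class N \<Sigma> ` carrier (torus_divisors \<Sigma>)"
  by (simp add: class_group_def divisor_class_def carrier_FactGroup)

text \<open>The image of \<open>\<phi>\<close> under the dual of the class map, in the dual basis of the prime divisors; the rows
of a weight matrix are vectors of this form.\<close>

definition weights :: "(('a set \<Rightarrow>\<^sub>0 int) set \<Rightarrow> int) \<Rightarrow> int vec" where
  "weights \<phi> = vec m (\<lambda>j. \<phi> (divisor_class N \<Sigma> (frag_of (\<rho> j))))"

text \<open>The dual of the exact sequence of the class group. A homomorphism from the class group to the
integers is a homomorphism on divisors that vanishes on principal divisors. On the divisor with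
coefficients \<open>w\<close> it has the value \<open>w \<bullet> q\<close>, where \<open>q\<close> is its vector of weights, and the principal divisors
are the combinations of the rows of \<open>V\<close>; so the condition is \<open>V q = 0\<close>.\<close>

lemma weights_iso: "weights \<in> iso (int_dual (class_group N \<Sigma>)) (kernel_group V)"
proof -
  let ?T = "torus_divisors \<Sigma>" and ?Cl = "class_group N \<Sigma>"
  note kernel = kernel_group_simps[OF V]
  have sub: "\<rho> ` {..<m} \<subseteq> rays \<Sigma>" using enum_inj_image by simp
  have frag_in: "divisor_class N \<Sigma> (frag_of (\<rho> j)) \<in> carrier ?Cl" if "j < m" for j
    unfolding carrier_class_group using sub that by auto
  have eval: "\<phi> (divisor_class N \<Sigma> (divisor \<rho> w)) = (\<Sum>j<m. w $ j * weights \<phi> $ j)"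
    if "\<phi> \<in> hom ?Cl integer_group" "w \<in> carrier_vec m" for \<phi> w
  proof -
    have "\<phi> \<circ> divisor_class N \<Sigma> \<in> hom ?T integer_group"
      using divisor_class_hom that(1) by (rule hom_compose)
    from hom_divisor[OF sub that(2) this] show ?thesis by (simp add: weights_def)
  qed
  have V_index: "(V *\<^sub>v q) $ i = (\<Sum>j<m. (transpose_mat V *\<^sub>v unit_vec DIM('a) i) $ j * q $ j)"
    if "i < DIM('a)" "q \<in> carrier_vec m" for i q
    using that V unfolding transpose_mult_unit_vec[OF V that(1)]
    by (auto simp: scalar_prod_def lessThan_atLeast0 intro!: sum.cong)
  have one_Cl: "divisor_class N \<Sigma> D = \<one>\<^bsub>?Cl\<^esub>" if "D \<in> principal_divisors N \<Sigma>" for D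
    unfolding class_group_def divisor_class_def
    using group.coset_join2[OF group_free_Abelian_group _ principal_subgroup that]
      subgroup.mem_carrier[OF principal_subgroup that] by simp
  have hom: "weights \<in> hom (int_dual ?Cl) (kernel_group V)"
  proof (rule homI)
    fix \<phi> assume "\<phi> \<in> carrier (int_dual ?Cl)"
    then have \<phi>: "\<phi> \<in> hom ?Cl integer_group" by (simp add: int_dual_simps)
    have "V *\<^sub>v weights \<phi> = 0\<^sub>v DIM('a)"
    proof (rule eq_vecI)
      fix i assume "i < dim_vec (0\<^sub>v DIM('a))"
      then have i: "i < DIM('a)" by simp
      have "(V *\<^sub>v weights \<phi>) $ i = \<phi> (divisor_class N \<Sigma> (divisor \<rho> (transpose_mat V *\<^sub>v unit_vec DIM('a) i)))"
        using V_index[OF i, of "weights \<phi>"] eval[OF \<phi> transpose_mult_carrier[OF V]] by (simp add: weights_def)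
      also have "divisor_class N \<Sigma> (divisor \<rho> (transpose_mat V *\<^sub>v unit_vec DIM('a) i)) = \<one>\<^bsub>?Cl\<^esub>"
        by (rule one_Cl) (auto simp: principal_divisors_eq)
      also have "\<phi> \<one>\<^bsub>?Cl\<^esub> = 0"
        using hom_one[OF \<phi> comm_group.axioms(2)[OF comm_group_class_group]] by simp
      finally show "(V *\<^sub>v weights \<phi>) $ i = 0\<^sub>v DIM('a) $ i" using i by simp
    qed (use V in simp)
    then show "weights \<phi> \<in> carrier (kernel_group V)" by (simp add: kernel weights_def)
  next
    fix \<phi> \<psi> assume "\<phi> \<in> carrier (int_dual ?Cl)" "\<psi> \<in> carrier (int_dual ?Cl)"
    then show "weights (\<phi> \<otimes>\<^bsub>int_dual ?Cl\<^esub> \<psi>) = weights \<phi> \<otimes>\<^bsub>kernel_group V\<^esub> weights \<psi>"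
      by (intro eq_vecI) (auto simp: kernel weights_def int_dual_simps frag_in)
  qed
  moreover have "inj_on weights (carrier (int_dual ?Cl))"
  proof (rule inj_onI)
    fix \<phi> \<psi> assume \<phi>: "\<phi> \<in> carrier (int_dual ?Cl)" and \<psi>: "\<psi> \<in> carrier (int_dual ?Cl)"
      and eq: "weights \<phi> = weights \<psi>"
    show "\<phi> = \<psi>"
    proof (rule extensionalityI)
      show "\<phi> \<in> extensional (carrier ?Cl)" "\<psi> \<in> extensional (carrier ?Cl)"
        using \<phi> \<psi> by (auto simp: int_dual_simps)
      fix c assume "c \<in> carrier ?Cl"
      then obtain D where D: "D \<in> carrier ?T" "c = divisor_class N \<Sigma> D" unfolding carrier_class_group by auto
      obtain w where w: "w \<in> carrier_vec m" "D = divisor \<rho> w"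
        using divisor_lookup[OF enum D(1)] vec_carrier by blast
      show "\<phi> c = \<psi> c" using eval[of \<phi> w] eval[of \<psi> w] w(1) \<phi> \<psi> eq D(2) w(2)
        by (simp add: int_dual_simps)
    qed
  qed
  moreover have "q \<in> weights ` carrier (int_dual ?Cl)" if "q \<in> carrier (kernel_group V)" for q
  proof -
    have q: "q \<in> carrier_vec m" "V *\<^sub>v q = 0\<^sub>v DIM('a)" using that by (simp_all add: kernel)
    \<comment> \<open>The homomorphism on divisors with prescribed values \<open>q\<close> on the
      prime divisors descends to the class group.\<close>
    define \<psi> where "\<psi> = (\<lambda>D. \<Sum>j<m. Poly_Mapping.lookup D (\<rho> j) * q $ j)"
    have \<psi>: "\<psi> \<in> hom ?T integer_group"
      by (auto simp: hom_def \<psi>_def lookup_add distrib_right sum.distrib)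
    have \<psi>_divisor: "\<psi> (divisor \<rho> w) = (\<Sum>j<m. w $ j * q $ j)" if "w \<in> carrier_vec m" for w
      unfolding \<psi>_def using lookup_divisor[OF enum_inj_image(1) that] by simp
    have "\<psi> D = 0" if D: "D \<in> principal_divisors N \<Sigma>" for D
    proof -
      obtain x where x: "x \<in> carrier_vec DIM('a)" "D = divisor \<rho> (transpose_mat V *\<^sub>v x)"
        using D unfolding principal_divisors_eq by auto
      then have "\<psi> D = (transpose_mat V *\<^sub>v x) \<bullet> q"
        using \<psi>_divisor[OF transpose_mult_carrier[OF V]] q(1) by (simp add: scalar_prod_def lessThan_atLeast0)
      also have "\<dots> = 0" using transpose_vec_mult_scalar[OF V q(1) x(1)] q(2) x(1) by simp
      finally show ?thesis .
    qed
    then have "principal_divisors N \<Sigma> \<subseteq> Coset.kernel ?T integer_group \<psi>"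
      using subgroup.mem_carrier[OF principal_subgroup] by (auto simp: Coset.kernel_def)
    moreover have normal: "principal_divisors N \<Sigma> \<lhd> ?T"
      by (rule comm_group.subgroup_imp_normal[OF abelian_free_Abelian_group principal_subgroup])
    moreover have "group_hom ?T integer_group \<psi>"
      using \<psi> by (simp add: group_hom_def group_hom_axioms_def)
    ultimately obtain g where g: "g \<in> hom (?T Mod principal_divisors N \<Sigma>) integer_group"
        "\<And>D. D \<in> carrier ?T \<Longrightarrow> g (principal_divisors N \<Sigma> #>\<^bsub>?T\<^esub> D) = \<psi> D"
      using group_hom.FactGroup_universal_kernel[of ?T integer_group \<psi> "principal_divisors N \<Sigma>"]
      by metis
    define \<phi> where "\<phi> = restrict g (carrier ?Cl)"
    interpret Cl: comm_group ?Cl by (rule comm_group_class_group)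
    have "\<phi> \<in> carrier (int_dual ?Cl)"
      using g(1) Cl.m_closed unfolding class_group_def[symmetric]
      by (auto simp: int_dual_simps \<phi>_def hom_def)
    moreover have "weights \<phi> = q"
    proof (rule eq_vecI)
      fix j assume "j < dim_vec q"
      then have j: "j < m" using q(1) by simp
      have "frag_of (\<rho> j) = divisor \<rho> (unit_vec m j)"
      proof -
        have "divisor \<rho> (unit_vec m j) = (\<Sum>i<m. if i = j then frag_of (\<rho> j) else 0)"
          unfolding divisor_def using j by (intro sum.cong) auto
        then show ?thesis using j by simp
      qed
      moreover have "weights \<phi> $ j = g (principal_divisors N \<Sigma> #>\<^bsub>?T\<^esub> frag_of (\<rho> j))"
        using j frag_in[OF j] by (simp add: weights_def \<phi>_def divisor_class_def)
      moreover have "frag_of (\<rho> j) \<in> carrier ?T" using sub j by auto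
      ultimately have "weights \<phi> $ j = (\<Sum>i<m. unit_vec m j $ i * q $ i)"
        using g(2) \<psi>_divisor[OF unit_vec_carrier[of m j]] by metis
      also have "\<dots> = (\<Sum>i<m. if i = j then q $ j else 0)" using j by (intro sum.cong) auto
      finally show "weights \<phi> $ j = q $ j" using j by simp
    qed (use q in \<open>simp add: weights_def\<close>)
    ultimately show ?thesis by blast
  qed
  ultimately show ?thesis by (auto simp: iso_def bij_betw_def hom_def)
qed

end

section \<open>Simplicial cones, rays and primitive generators\<close>

text \<open>The non-negative combinations of \<open>S\<close> form a convex cone, and every convex cone that contains \<open>S\<close>
contains them.\<close>

lemma convex_cone_hull_finite:
  fixes S :: "'a::real_vector set"
  assumes fin: "finite S"
  shows "convex_cone hull S = {\<Sum>s\<in>S. c s *\<^sub>R s | c. \<forall>s\<in>S. c s \<ge> 0}" (is "_ = ?C")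
proof
  show "convex_cone hull S \<subseteq> ?C"
  proof (rule hull_minimal)
    show "S \<subseteq> ?C"
    proof
      fix s assume s: "s \<in> S"
      have "(\<Sum>x\<in>S. (if x = s then 1 else 0) *\<^sub>R x) = (\<Sum>x\<in>S. if x = s then x else 0)"
        by (intro sum.cong) auto
      then have "s = (\<Sum>x\<in>S. (if x = s then 1 else 0) *\<^sub>R x)" using fin s by simp
      then show "s \<in> ?C" by (intro CollectI exI[of _ "\<lambda>x. if x = s then 1 else 0"]) auto
    qed
    show "convex_cone ?C"
      unfolding convex_cone_iff
    proof (intro conjI ballI allI impI)
      show "0 \<in> ?C" by (intro CollectI exI[of _ "\<lambda>_. 0"]) simp
      fix x y assume "x \<in> ?C" "y \<in> ?C"
      then obtain c d where "x = (\<Sum>s\<in>S. c s *\<^sub>R s)" "\<forall>s\<in>S. c s \<ge> 0"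
          "y = (\<Sum>s\<in>S. d s *\<^sub>R s)" "\<forall>s\<in>S. d s \<ge> 0" by blast
      then show "x + y \<in> ?C"
        by (intro CollectI exI[of _ "\<lambda>s. c s + d s"]) (auto simp: sum.distrib scaleR_add_left)
    next
      fix x and t :: real assume "x \<in> ?C" "t \<ge> 0"
      moreover from this obtain c where "x = (\<Sum>s\<in>S. c s *\<^sub>R s)" "\<forall>s\<in>S. c s \<ge> 0" by blast
      ultimately show "t *\<^sub>R x \<in> ?C"
        by (intro CollectI exI[of _ "\<lambda>s. t * c s"]) (auto simp: scaleR_sum_right)
    qed
  qed
  show "?C \<subseteq> convex_cone hull S"
  proof
    fix x assume "x \<in> ?C"
    then obtain c where c: "x = (\<Sum>s\<in>S. c s *\<^sub>R s)" "\<forall>s\<in>S. c s \<ge> 0" by blast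
    have "T \<subseteq> S \<Longrightarrow> (\<Sum>s\<in>T. c s *\<^sub>R s) \<in> convex_cone hull S" for T
    proof (induction T rule: infinite_finite_induct)
      case (insert s T)
      then have "s \<in> S" "T \<subseteq> S" by auto
      then have "c s *\<^sub>R s \<in> convex_cone hull S" using c(2) by (intro convex_cone_hull_mul hull_inc) auto
      then show ?case using insert \<open>T \<subseteq> S\<close> by (simp add: convex_cone_hull_add)
    qed (simp_all add: convex_cone_hull_contains_0)
    then show "x \<in> convex_cone hull S" using c(1) by simp
  qed
qed

lemma convex_cone_hull_singleton: "convex_cone hull {s} = {t *\<^sub>R s | t. t \<ge> 0}"
  for s :: "'a::real_vector"
  by (subst convex_cone_hull_finite) (auto intro: exI[of _ "\<lambda>_. t" for t])

text \<open>If a point of the ray through \<open>s\<close> is in the interior of a segment of the cone, the coefficients of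
the two end points at any other generator are non-negative and have a vanishing convex
combination with positive weights, so they vanish.\<close>

lemma ray_face_of_simplicial_cone:
  fixes S :: "'a::euclidean_space set"
  assumes fin: "finite S" and ind: "independent S" and s: "s \<in> S"
  shows "(convex_cone hull {s}) face_of (convex_cone hull S)"
  unfolding face_of_def
proof (intro conjI ballI impI)
  show "convex_cone hull {s} \<subseteq> convex_cone hull S" using s by (intro hull_mono) auto
  show "convex (convex_cone hull {s})" by (rule convex_convex_cone_hull)
  have sum_s: "(\<Sum>r\<in>S. (if r = s then d else 0) *\<^sub>R r) = d *\<^sub>R s" for d
  proof -
    have "(\<Sum>r\<in>S. (if r = s then d else 0) *\<^sub>R r) = (\<Sum>r\<in>S. if r = s then d *\<^sub>R r else 0)"
      by (intro sum.cong) auto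
    then show ?thesis using fin s by simp
  qed
  have coeffs: "f r = g r" if "(\<Sum>r\<in>S. f r *\<^sub>R r) = (\<Sum>r\<in>S. g r *\<^sub>R r)" "r \<in> S" for f g :: "'a \<Rightarrow> real" and r
    using independentD[OF ind fin subset_refl, of "\<lambda>r. f r - g r" r] that
    by (simp add: scaleR_diff_left sum_subtractf)
  fix a c x
  assume a: "a \<in> convex_cone hull S" and c: "c \<in> convex_cone hull S"
    and "x \<in> convex_cone hull {s}" and seg: "x \<in> open_segment a c"
  obtain \<alpha> where \<alpha>: "a = (\<Sum>r\<in>S. \<alpha> r *\<^sub>R r)" "\<forall>r\<in>S. \<alpha> r \<ge> 0"
    using a unfolding convex_cone_hull_finite[OF fin] by blast
  obtain \<gamma> where \<gamma>: "c = (\<Sum>r\<in>S. \<gamma> r *\<^sub>R r)" "\<forall>r\<in>S. \<gamma> r \<ge> 0"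
    using c unfolding convex_cone_hull_finite[OF fin] by blast
  obtain t where t: "x = t *\<^sub>R s"
    using \<open>x \<in> convex_cone hull {s}\<close> unfolding convex_cone_hull_singleton by blast
  obtain u where u: "0 < u" "u < 1" and x: "x = (1 - u) *\<^sub>R a + u *\<^sub>R c"
    using seg unfolding in_segment by blast
  have "(\<Sum>r\<in>S. ((1 - u) * \<alpha> r + u * \<gamma> r) *\<^sub>R r) = x"
    unfolding x \<alpha>(1) \<gamma>(1) by (simp add: scaleR_sum_right scaleR_add_left sum.distrib)
  also have "x = (\<Sum>r\<in>S. (if r = s then t else 0) *\<^sub>R r)" using sum_s t by simp
  finally have eq: "(\<Sum>r\<in>S. ((1 - u) * \<alpha> r + u * \<gamma> r) *\<^sub>R r) = (\<Sum>r\<in>S. (if r = s then t else 0) *\<^sub>R r)" .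
  have off_ray: "(1 - u) * \<alpha> r + u * \<gamma> r = 0" if "r \<in> S" "r \<noteq> s" for r using coeffs[OF eq that(1)] that(2) by simp
  have zero: "\<alpha> r = 0 \<and> \<gamma> r = 0" if "r \<in> S" "r \<noteq> s" for r
  proof -
    have "(1 - u) * \<alpha> r \<ge> 0" "u * \<gamma> r \<ge> 0" using \<alpha>(2) \<gamma>(2) u that(1) by simp_all
    then have "(1 - u) * \<alpha> r = 0 \<and> u * \<gamma> r = 0"
      using off_ray[OF that] by (simp only: add_nonneg_eq_0_iff)
    then show ?thesis using u by simp
  qed
  have "a = (\<Sum>r\<in>S. (if r = s then \<alpha> s else 0) *\<^sub>R r)" "c = (\<Sum>r\<in>S. (if r = s then \<gamma> s else 0) *\<^sub>R r)"
    unfolding \<alpha>(1) \<gamma>(1) by (intro sum.cong; simp add: zero)+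
  then have "a = \<alpha> s *\<^sub>R s" "c = \<gamma> s *\<^sub>R s" by (simp_all only: sum_s)
  then show "a \<in> convex_cone hull {s}" "c \<in> convex_cone hull {s}"
    using \<alpha>(2) \<gamma>(2) s by (auto simp: convex_cone_hull_singleton)
qed

lemma dim_simplicial_cone:
  fixes S :: "'a::euclidean_space set"
  assumes "independent S"
  shows "dim (convex_cone hull S) = card S"
proof (rule dim_unique)
  show "S \<subseteq> convex_cone hull S" by (rule hull_subset)
  show "convex_cone hull S \<subseteq> span S" by (intro hull_minimal span_superset convex_cone_span)
qed (use assms in auto)

lemma simplicial_ray:
  assumes "simplicial_cone N \<rho>" "dim \<rho> = 1"
  obtains s where "s \<in> N" "s \<noteq> 0" "\<rho> = {t *\<^sub>R s | t. t \<ge> 0}"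
proof -
  obtain S where S: "finite S" "S \<subseteq> N" "independent S" "\<rho> = convex_cone hull S"
    using assms(1) by (auto simp: simplicial_cone_def)
  then have "card S = 1" using assms(2) dim_simplicial_cone[of S] by simp
  then obtain s where s: "S = {s}" by (auto simp: card_1_singleton_iff)
  have "s \<noteq> 0" using S(3) dependent_zero[of "{s}"] unfolding s by auto
  moreover have "s \<in> N" using S(2) s by simp
  ultimately show thesis using that[of s] S(4) unfolding s convex_cone_hull_singleton by blast
qed

context based_lattice
begin

lemma lattice_scaleR_int: "x \<in> N \<Longrightarrow> real_of_int k *\<^sub>R x \<in> N"
proof -
  assume "x \<in> N"
  then obtain c where "x = comb (\<lambda>i. real_of_int (c i))" using lattice_eq by blast
  then have "real_of_int k *\<^sub>R x = comb (\<lambda>i. real_of_int (k * c i))" by (simp add: comb_scaleR)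
  then show "real_of_int k *\<^sub>R x \<in> N" unfolding lattice_eq by (intro exI[of _ "\<lambda>i. k * c i"])
qed

text \<open>Multiplying by the absolute value \<open>a\<close> of a non-zero coordinate of \<open>s\<close> turns the lattice points on the
ray into points \<open>(d / a) s\<close> with a natural number \<open>d\<close>. The least positive such \<open>d\<close> divides all others, by
division with remainder.\<close>

lemma primitive_on_ray:
  assumes s: "s \<in> N" "s \<noteq> 0"
  obtains v where "v \<in> N" "v \<noteq> 0" "{t *\<^sub>R s | t. t \<ge> 0} = {t *\<^sub>R v | t. t \<ge> 0}"
    "{t *\<^sub>R s | t. t \<ge> 0} \<inter> N = {real k *\<^sub>R v | k. True}"
proof -
  obtain c where c: "s = comb (\<lambda>i. real_of_int (c i))" using s(1) lattice_eq by blast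
  have "\<exists>i<DIM('a). c i \<noteq> 0"
  proof (rule ccontr)
    assume "\<not> ?thesis"
    then have "s = 0" unfolding c comb_def by (intro sum.neutral) auto
    then show False using s by simp
  qed
  then obtain i where i: "i < DIM('a)" "c i \<noteq> 0" by auto
  define a where "a = real_of_int \<bar>c i\<bar>"
  have a: "a > 0" using i by (simp add: a_def)
  define P where "P = (\<lambda>d::nat. d > 0 \<and> (real d / a) *\<^sub>R s \<in> N)"
  have "P (nat \<bar>c i\<bar>)" using i s by (auto simp: P_def a_def)
  define d0 where "d0 = (LEAST d. P d)"
  have d0: "P d0" unfolding d0_def using \<open>P (nat \<bar>c i\<bar>)\<close> by (rule LeastI)
  have least: "\<not> P d" if "d < d0" for d using that not_less_Least unfolding d0_def by blast
  define v where "v = (real d0 / a) *\<^sub>R s"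
  have pos: "real d0 / a > 0" using d0 a by (simp add: P_def)
  have vN: "v \<in> N" and v0: "v \<noteq> 0" using d0 pos s by (auto simp: v_def P_def)
  have ray: "{t *\<^sub>R s | t. t \<ge> 0} = {t *\<^sub>R v | t. t \<ge> 0}"
  proof (intro equalityI subsetI)
    fix x assume "x \<in> {t *\<^sub>R s | t. t \<ge> 0}"
    then obtain t where "x = t *\<^sub>R s" "t \<ge> 0" by auto
    then have "x = (t / (real d0 / a)) *\<^sub>R v" using a d0 by (simp add: v_def P_def)
    moreover have "t / (real d0 / a) \<ge> 0" using pos \<open>t \<ge> 0\<close> by (simp only: divide_nonneg_pos)
    ultimately show "x \<in> {t *\<^sub>R v | t. t \<ge> 0}" by blast
  next
    fix x assume "x \<in> {t *\<^sub>R v | t. t \<ge> 0}"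
    then obtain t where "x = t *\<^sub>R v" "t \<ge> 0" by auto
    then have "x = (t * (real d0 / a)) *\<^sub>R s" by (simp add: v_def)
    moreover have "t * (real d0 / a) \<ge> 0" using pos \<open>t \<ge> 0\<close> by (intro mult_nonneg_nonneg) auto
    ultimately show "x \<in> {t *\<^sub>R s | t. t \<ge> 0}" by blast
  qed
  have "x \<in> {real k *\<^sub>R v | k. True}" if x: "x \<in> {t *\<^sub>R s | t. t \<ge> 0} \<inter> N" for x
  proof -
    obtain t where t: "x = t *\<^sub>R s" "t \<ge> 0" using x by auto
    obtain e where e: "x = comb (\<lambda>i. real_of_int (e i))" using x lattice_eq by blast
    have "comb (\<lambda>i. t * real_of_int (c i)) = comb (\<lambda>i. real_of_int (e i))"
      using e t(1) c by (simp add: comb_scaleR)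
    then have "t * real_of_int (c i) = real_of_int (e i)" using comb_eq_iff i(1) by simp
    then have "\<bar>t * real_of_int (c i)\<bar> = real_of_int \<bar>e i\<bar>" by simp
    then have ta: "t * a = real (nat \<bar>e i\<bar>)" using t(2) by (simp add: abs_mult a_def)
    define d where "d = nat \<bar>e i\<bar>"
    have td: "t = real d / a" using ta a by (simp add: d_def field_simps)
    have "real d = real (d div d0) * real d0 + real (d mod d0)"
      by (metis div_mult_mod_eq of_nat_add of_nat_mult)
    then have "t = real (d div d0) * (real d0 / a) + real (d mod d0) / a"
      by (simp add: td add_divide_distrib)
    then have x_eq: "x = real (d div d0) *\<^sub>R v + (real (d mod d0) / a) *\<^sub>R s"
      by (simp add: t(1) v_def scaleR_add_left)
    then have "(real (d mod d0) / a) *\<^sub>R s = x + - (real_of_int (int (d div d0)) *\<^sub>R v)" by simp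
    also have "\<dots> \<in> N"
      using x lattice_scaleR_int[OF vN] lattice_in_closed[OF lattice] by blast
    finally have "d mod d0 = 0" using least[of "d mod d0"] d0 by (auto simp: P_def)
    then show ?thesis using x_eq by auto
  qed
  moreover have "real k *\<^sub>R v \<in> {t *\<^sub>R s | t. t \<ge> 0} \<inter> N" for k
    using lattice_scaleR_int[OF vN, of "int k"] unfolding ray by auto
  ultimately show thesis using that[OF vN v0 ray] by blast
qed

lemma ray_generator_props:
  assumes "simplicial_cone N \<rho>" "dim \<rho> = 1"
  shows "ray_generator N \<rho> \<in> N" "ray_generator N \<rho> \<noteq> 0"
    "\<rho> = {t *\<^sub>R ray_generator N \<rho> | t. t \<ge> 0}"
    "\<rho> \<inter> N = {real k *\<^sub>R ray_generator N \<rho> | k. True}"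
proof -
  obtain s where s: "s \<in> N" "s \<noteq> 0" "\<rho> = {t *\<^sub>R s | t. t \<ge> 0}" using simplicial_ray[OF assms] .
  obtain v where v: "v \<in> N" "v \<noteq> 0" "\<rho> = {t *\<^sub>R v | t. t \<ge> 0}" "\<rho> \<inter> N = {real k *\<^sub>R v | k. True}"
    by (rule primitive_on_ray[OF s(1,2), folded s(3)])
  have "ray_generator N \<rho> = v"
    unfolding ray_generator_def
  proof (rule the_equality)
    fix w assume w: "\<rho> \<inter> N = {real k *\<^sub>R w | k. True}"
    have multiples: "{real k *\<^sub>R w | k. True} = {real k *\<^sub>R v | k. True}" by (rule trans[OF w[symmetric] v(4)])
    have self: "x \<in> {real k *\<^sub>R x | k. True}" for x :: 'a by (intro CollectI exI[of _ 1]) simp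
    obtain k :: nat where k: "w = real k *\<^sub>R v" using self[of w] unfolding multiples by blast
    obtain l :: nat where l: "v = real l *\<^sub>R w" using self[of v] unfolding multiples[symmetric] by blast
    have "v = real l *\<^sub>R (real k *\<^sub>R v)" using l unfolding k .
    then have "(real (l * k) - 1) *\<^sub>R v = 0" by (simp add: scaleR_diff_left)
    then have "real (l * k) = 1" using v(2) by simp
    then have "l * k = 1" by (simp only: of_nat_eq_1_iff)
    then show "w = v" using k by simp
  qed (fact v(4))
  with v show "ray_generator N \<rho> \<in> N" "ray_generator N \<rho> \<noteq> 0"
    "\<rho> = {t *\<^sub>R ray_generator N \<rho> | t. t \<ge> 0}"
    "\<rho> \<inter> N = {real k *\<^sub>R ray_generator N \<rho> | k. True}" by simp_all
qed

text \<open>One of \<open>w\<close> and \<open>- w\<close> is a lattice point on the ray, hence a natural multiple of the generator.\<close>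

lemma ray_generator_primitive:
  assumes ray: "simplicial_cone N \<rho>" "dim \<rho> = 1" and w: "w \<in> N" and k: "k > 0"
    and eq: "real_of_int e *\<^sub>R ray_generator N \<rho> = real_of_int k *\<^sub>R w"
  shows "k dvd e"
proof -
  let ?v = "ray_generator N \<rho>"
  note props = ray_generator_props[OF ray]
  have main: "k dvd e'" if "w' \<in> N" "e' \<ge> 0" "real_of_int e' *\<^sub>R ?v = real_of_int k *\<^sub>R w'" for e' w'
  proof -
    have "w' = (1 / real_of_int k) *\<^sub>R (real_of_int k *\<^sub>R w')" using k by simp
    also have "\<dots> = (real_of_int e' / real_of_int k) *\<^sub>R ?v" by (simp add: that(3)[symmetric])
    finally have "w' \<in> \<rho>" using that(2) k by (subst props(3)) auto
    with that(1) have "w' \<in> \<rho> \<inter> N" by blast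
    then obtain l :: nat where "w' = real l *\<^sub>R ?v" unfolding props(4) by blast
    then have "(real_of_int e' - real_of_int k * real l) *\<^sub>R ?v = 0" using that(3) by (simp add: scaleR_diff_left)
    then have "real_of_int e' = real_of_int (k * int l)" using props(2) by simp
    then have "e' = k * int l" by (simp only: of_int_eq_iff)
    then show ?thesis by simp
  qed
  show ?thesis
  proof (cases "e \<ge> 0")
    case True
    then show ?thesis using main[OF w _ eq] by simp
  next
    case False
    then have "k dvd - e" using main[of "- w" "- e"] eq lattice_in_closed(3)[OF lattice w] by simp
    then show ?thesis by simp
  qed
qed

end

text \<open>Every point lies in a cone of the fan and is a non-negative combination of its generators. Each
of these spans a face of the cone, which is therefore a ray of the fan.\<close>

lemma fan_rays_positively_span:
  fixes \<Sigma> :: "'a::euclidean_space set set" and m :: nat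
  assumes fan: "fan N \<Sigma>" and simp: "\<forall>\<sigma>\<in>\<Sigma>. simplicial_cone N \<sigma>" and complete: "\<Union>\<Sigma> = UNIV"
    and enum: "bij_betw \<rho> {..<m} (rays \<Sigma>)"
    and g: "\<And>j. j < m \<Longrightarrow> \<rho> j = {t *\<^sub>R g j | t. t \<ge> 0}"
  shows "\<exists>c. (\<forall>j<m. c j \<ge> 0) \<and> x = (\<Sum>j<m. c j *\<^sub>R g j)"
proof -
  define C where "C = {\<Sum>j<m. c j *\<^sub>R g j | c. \<forall>j<m. c j \<ge> (0::real)}"
  have cone: "convex_cone C"
    unfolding convex_cone_iff
  proof (intro conjI ballI allI impI)
    show "0 \<in> C" unfolding C_def by (intro CollectI exI[of _ "\<lambda>_. 0"]) simp
    fix x y assume "x \<in> C" "y \<in> C"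
    then obtain c d where "x = (\<Sum>j<m. c j *\<^sub>R g j)" "\<forall>j<m. c j \<ge> 0"
        "y = (\<Sum>j<m. d j *\<^sub>R g j)" "\<forall>j<m. d j \<ge> 0" unfolding C_def by blast
    then show "x + y \<in> C" unfolding C_def
      by (intro CollectI exI[of _ "\<lambda>j. c j + d j"]) (auto simp: sum.distrib scaleR_add_left)
  next
    fix x and t :: real assume "x \<in> C" "t \<ge> 0"
    moreover from this obtain c where "x = (\<Sum>j<m. c j *\<^sub>R g j)" "\<forall>j<m. c j \<ge> 0" unfolding C_def by blast
    ultimately show "t *\<^sub>R x \<in> C" unfolding C_def
      by (intro CollectI exI[of _ "\<lambda>j. t * c j"]) (auto simp: scaleR_sum_right)
  qed
  obtain \<sigma> where \<sigma>: "\<sigma> \<in> \<Sigma>" "x \<in> \<sigma>" using complete by blast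
  obtain S where S: "finite S" "independent S" "\<sigma> = convex_cone hull S"
    using simp \<sigma>(1) by (auto simp: simplicial_cone_def)
  have "S \<subseteq> C"
  proof
    fix s assume s: "s \<in> S"
    let ?\<tau> = "convex_cone hull {s}"
    have ind: "independent {s}" by (rule independent_mono[OF S(2)]) (use s in simp)
    have "?\<tau> face_of \<sigma>" unfolding S(3) by (rule ray_face_of_simplicial_cone[OF S(1,2) s])
    then have "?\<tau> \<in> \<Sigma>" using fan \<sigma>(1) convex_cone_hull_nonempty[of "{s}"] unfolding fan_def by blast
    then have "?\<tau> \<in> rays \<Sigma>" using dim_simplicial_cone[OF ind] by (simp add: rays_def)
    then obtain j where j: "j < m" "?\<tau> = \<rho> j" using enum by (auto simp: bij_betw_def)
    have "s \<in> \<rho> j" using hull_inc[of s "{s}" convex_cone] j(2) by simp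
    then obtain t where t: "s = t *\<^sub>R g j" "t \<ge> 0" unfolding g[OF j(1)] by auto
    have "(\<Sum>i<m. (if i = j then t else 0) *\<^sub>R g i) = (\<Sum>i<m. if i = j then s else 0)"
      using t by (intro sum.cong) auto
    also have "\<dots> = s" using j(1) by simp
    finally have "s = (\<Sum>i<m. (if i = j then t else 0) *\<^sub>R g i)" by (rule sym)
    then show "s \<in> C" unfolding C_def using t
      by (intro CollectI exI[of _ "\<lambda>i. if i = j then t else 0"]) auto
  qed
  then have "\<sigma> \<subseteq> C" unfolding S(3) using cone by (rule hull_minimal)
  then show ?thesis using \<sigma>(2) unfolding C_def by blast
qed

section \<open>Fan matrices and weight matrices\<close>

context fan_coordinates
begin

text \<open>Being a weight matrix does not refer to a fan matrix, but in terms of any fan matrix \<open>V\<close> of the same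
variety it means to be a Gale dual of \<open>V\<close>.\<close>

lemma weight_matrix_iff:
  "weight_matrix N \<Sigma> r m \<rho> Q \<longleftrightarrow> Q \<in> carrier_mat r m \<and> Z_basis (kernel_group V) r (Matrix.row Q)"
proof -
  let ?D = "int_dual (class_group N \<Sigma>)"
  have D: "comm_group ?D"
    using comm_group_class_group by (intro comm_group_int_dual) (simp add: comm_group.axioms(2))
  have K: "comm_group (kernel_group V)" using V by (rule comm_group_kernel_group)
  show ?thesis
  proof
    assume W: "weight_matrix N \<Sigma> r m \<rho> Q"
    then obtain \<phi> where Q: "Q \<in> carrier_mat r m" and \<phi>: "Z_basis ?D r \<phi>"
      "\<forall>i<r. \<forall>j<m. Q $$ (i, j) = \<phi> i (divisor_class N \<Sigma> (frag_of (\<rho> j)))"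
      by (auto simp: weight_matrix_def)
    have "weights (\<phi> i) = Matrix.row Q i" if "i < r" for i
      using that \<phi>(2) Q by (intro eq_vecI) (auto simp: weights_def)
    then have "Z_basis (kernel_group V) r (Matrix.row Q)"
      using Z_basis_iso[OF D K weights_iso \<phi>(1)] Z_basis_cong[OF K, of r "\<lambda>i. weights (\<phi> i)" "Matrix.row Q"]
      by simp
    with Q show "Q \<in> carrier_mat r m \<and> Z_basis (kernel_group V) r (Matrix.row Q)" by simp
  next
    assume *: "Q \<in> carrier_mat r m \<and> Z_basis (kernel_group V) r (Matrix.row Q)"
    define inv_w where "inv_w = inv_into (carrier ?D) weights"
    have inv_iso: "inv_w \<in> iso (kernel_group V) ?D"
      unfolding inv_w_def using D weights_iso by (intro group.iso_set_sym) (simp add: comm_group.axioms(2))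
    have rows: "Matrix.row Q i \<in> carrier (kernel_group V)" if "i < r" for i
      using * that by (auto simp: Z_basis_def Z_independent_def)
    have surj: "weights ` carrier ?D = carrier (kernel_group V)"
      using weights_iso by (simp add: iso_def bij_betw_def)
    have "weights (inv_w (Matrix.row Q i)) = Matrix.row Q i" if "i < r" for i
      unfolding inv_w_def using f_inv_into_f[of "Matrix.row Q i" weights "carrier ?D"] rows[OF that] surj by simp
    then have "Q $$ (i, j) = weights (inv_w (Matrix.row Q i)) $ j" if "i < r" "j < m" for i j
      using that conjunct1[OF *] by auto
    then have "Q $$ (i, j) = inv_w (Matrix.row Q i) (divisor_class N \<Sigma> (frag_of (\<rho> j)))"
      if "i < r" "j < m" for i j
      using that by (simp add: weights_def)
    moreover have "Z_basis ?D r (\<lambda>i. inv_w (Matrix.row Q i))"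
      using Z_basis_iso[OF K D inv_iso] * by blast
    ultimately show "weight_matrix N \<Sigma> r m \<rho> Q" using * unfolding weight_matrix_def by blast
  qed
qed

lemma weight_matrix_iff_kernel_basis:
  assumes "m = DIM('a) + r"
  shows "weight_matrix N \<Sigma> r m \<rho> Q \<longleftrightarrow> Q \<in> carrier_mat r m \<and> kernel_basis DIM('a) r V Q"
  using weight_matrix_iff[of r Q] Z_basis_kernel_group_iff[of V "DIM('a)" r Q] V unfolding assms by blast

end

text \<open>The geometry enters through two facts: the ray generators are primitive lattice vectors, and by
completeness they span the space positively.\<close>

locale complete_simplicial_fan = fan_coordinates +
  assumes is_fan: "fan N \<Sigma>" and simplicial: "\<forall>\<sigma>\<in>\<Sigma>. simplicial_cone N \<sigma>"
    and complete: "\<Union>\<Sigma> = UNIV"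
begin

abbreviation gen :: "nat \<Rightarrow> 'a" where "gen j \<equiv> ray_generator N (\<rho> j)"

lemma ray: "j < m \<Longrightarrow> simplicial_cone N (\<rho> j)" "j < m \<Longrightarrow> dim (\<rho> j) = 1"
  using enum_inj_image(2) simplicial by (auto simp: rays_def)

lemma positively_span: "\<exists>c. (\<forall>j<m. c j \<ge> 0) \<and> x = (\<Sum>j<m. c j *\<^sub>R gen j)"
  using ray_generator_props(3)[OF ray] by (intro fan_rays_positively_span[OF is_fan simplicial complete enum])

lemma sum_gens: "(\<Sum>j<m. c j *\<^sub>R gen j) = comb (\<lambda>i. \<Sum>j<m. c j * real_of_int (V $$ (i, j)))"
proof -
  have "(\<Sum>j<m. c j *\<^sub>R gen j) = (\<Sum>j<m. \<Sum>i<DIM('a). (c j * real_of_int (V $$ (i, j))) *\<^sub>R b i)"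
    by (intro sum.cong) (simp_all add: gens comb_def scaleR_sum_right)
  also have "\<dots> = comb (\<lambda>i. \<Sum>j<m. c j * real_of_int (V $$ (i, j)))"
    unfolding comb_def scaleR_sum_left by (rule sum.swap)
  finally show ?thesis .
qed

text \<open>A linear functional \<open>x\<close> that vanishes on all ray generators vanishes on the whole space, because the
ray generators span it; evaluating it at the point with coordinates \<open>x\<close> gives \<open>x \<bullet> x = 0\<close>.\<close>

lemma rank_V: "rank_int V = DIM('a)"
  unfolding rank_int_full_iff[OF V]
proof (intro ballI impI)
  fix x assume x: "x \<in> carrier_vec DIM('a)" "transpose_mat V *\<^sub>v x = 0\<^sub>v m"
  obtain c where "comb (\<lambda>i. real_of_int (x $ i)) = (\<Sum>j<m. c j *\<^sub>R gen j)" using positively_span by blast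
  then have c: "real_of_int (x $ i) = (\<Sum>j<m. c j * real_of_int (V $$ (i, j)))" if "i < DIM('a)" for i
    using that unfolding sum_gens comb_eq_iff by blast
  have "(\<Sum>i<DIM('a). real_of_int (x $ i) * real_of_int (x $ i))
      = (\<Sum>i<DIM('a). \<Sum>j<m. c j * real_of_int (x $ i * V $$ (i, j)))"
  proof (rule sum.cong)
    fix i assume "i \<in> {..<DIM('a)}"
    then have i: "i < DIM('a)" by simp
    have "real_of_int (x $ i) * real_of_int (x $ i) = real_of_int (x $ i) * (\<Sum>j<m. c j * real_of_int (V $$ (i, j)))"
      using c[OF i] by simp
    then show "real_of_int (x $ i) * real_of_int (x $ i) = (\<Sum>j<m. c j * real_of_int (x $ i * V $$ (i, j)))"
      by (simp add: sum_distrib_left mult.left_commute)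
  qed simp
  also have "\<dots> = (\<Sum>j<m. c j * real_of_int (\<Sum>i<DIM('a). x $ i * V $$ (i, j)))"
    by (subst sum.swap) (simp add: sum_distrib_left)
  also have "\<dots> = (\<Sum>j<m. c j * real_of_int ((transpose_mat V *\<^sub>v x) $ j))"
    by (intro sum.cong) (simp_all only: lessThan_iff transpose_mult_vec_index[OF V x(1)])
  also have "\<dots> = 0" unfolding x(2) by simp
  finally have "\<forall>i\<in>{..<DIM('a)}. real_of_int (x $ i) * real_of_int (x $ i) = 0"
    by (subst (asm) sum_nonneg_eq_0_iff) auto
  then show "x = 0\<^sub>v DIM('a)" using x(1) by (intro eq_vecI) auto
qed

lemma column_primitive:
  assumes j: "j < m" and k: "k > 0" and eq: "\<And>i. i < DIM('a) \<Longrightarrow> e * V $$ (i, j) = k * w i"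
  shows "k dvd e"
proof (rule ray_generator_primitive[OF ray[OF j] _ k])
  show "comb (\<lambda>i. real_of_int (w i)) \<in> N" using lattice_eq by blast
  show "real_of_int e *\<^sub>R gen j = real_of_int k *\<^sub>R comb (\<lambda>i. real_of_int (w i))"
    unfolding gens[OF j] comb_scaleR comb_eq_iff using eq by (metis of_int_mult)
qed

end

context complete_simplicial_fan
begin

text \<open>Suppose that \<open>k x\<close> is a combination of the rows of \<open>Q\<close> without column \<open>i\<close>. The same combination of the
full rows is a vector \<open>z\<close> with \<open>V z = 0\<close>, all of whose entries except possibly the \<open>i\<close>-th are divisible
by \<open>k\<close>. So \<open>z $ i\<close> times the \<open>i\<close>-th ray generator is divisible by \<open>k\<close> in the lattice, and since the
generator is primitive, \<open>k\<close> divides \<open>z $ i\<close> as well. Then \<open>z / k\<close> is in the kernel of \<open>V\<close>, hence a combination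
of the rows of \<open>Q\<close>, and deleting its \<open>i\<close>-th entry gives \<open>x\<close>.\<close>

lemma torsion_free_delete_col:
  assumes m: "m = DIM('a) + r" and Q: "Q \<in> carrier_mat r m" and basis: "kernel_basis DIM('a) r V Q"
    and i: "i < m"
  shows "torsion_free (monoid_vec TYPE(int) (m - 1) Mod row_lattice (delete_col i Q))"
proof -
  let ?Qi = "delete_col i Q"
  have Qi: "?Qi \<in> carrier_mat r (m - 1)" using Q by (simp add: delete_col_def)
  have delete: "(transpose_mat ?Qi *\<^sub>v c) $ j = (transpose_mat Q *\<^sub>v c) $ (if j < i then j else Suc j)"
    if c: "c \<in> carrier_vec r" and j: "j < m - 1" for c j
  proof -
    let ?j = "if j < i then j else Suc j"
    have "?j < m" using i j by auto
    have "(transpose_mat ?Qi *\<^sub>v c) $ j = (\<Sum>l<r. c $ l * ?Qi $$ (l, j))"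
      by (rule transpose_mult_vec_index[OF Qi c j])
    also have "\<dots> = (\<Sum>l<r. c $ l * Q $$ (l, ?j))"
      using Q j by (intro sum.cong) (auto simp: delete_col_def)
    also have "\<dots> = (transpose_mat Q *\<^sub>v c) $ ?j"
      by (rule transpose_mult_vec_index[OF Q c \<open>?j < m\<close>, symmetric])
    finally show ?thesis .
  qed
  have pow: "x [^]\<^bsub>monoid_vec TYPE(int) (m - 1)\<^esub> k = int k \<cdot>\<^sub>v x"
    if "x \<in> carrier_vec (m - 1)" for x and k :: nat
    using that by (induction k) (auto simp: nat_pow_def monoid_vec_simps distrib_right intro!: eq_vecI)
  show ?thesis
    unfolding torsion_free_FactGroup_iff[OF comm_group_vec row_lattice_subgroup[OF Qi]]
  proof (intro ballI allI impI)
    fix x and k :: nat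
    assume "x \<in> carrier (monoid_vec TYPE(int) (m - 1))" and k: "k > 0"
      and "x [^]\<^bsub>monoid_vec TYPE(int) (m - 1)\<^esub> k \<in> row_lattice ?Qi"
    then have x: "x \<in> carrier_vec (m - 1)" and "int k \<cdot>\<^sub>v x \<in> row_lattice ?Qi"
      using pow[of x k] by (simp_all only: monoid_vec_simps)
    then obtain c where c: "c \<in> carrier_vec r" "int k \<cdot>\<^sub>v x = transpose_mat ?Qi *\<^sub>v c"
      unfolding row_lattice_eq[OF Qi] by blast
    define z where "z = transpose_mat Q *\<^sub>v c"
    have z: "z \<in> carrier_vec m" unfolding z_def by (rule transpose_mult_carrier[OF Q])
    have Vz: "V *\<^sub>v z = 0\<^sub>v DIM('a)" using basis c(1) by (simp add: z_def kernel_basis_def)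
    have zx: "z $ (if j < i then j else Suc j) = int k * x $ j" if "j < m - 1" for j
      using arg_cong[OF c(2), of "\<lambda>v. v $ j"] delete[OF c(1) that] that x by (simp add: z_def)
    have other: "int k dvd z $ j" if "j < m" "j \<noteq> i" for j
    proof (cases "j < i")
      case True
      then show ?thesis using zx[of j] i by simp
    next
      case False
      then have "j - 1 < m - 1" "\<not> j - 1 < i" "Suc (j - 1) = j" using that by auto
      then have "z $ j = int k * x $ (j - 1)" using zx[of "j - 1"] by (simp only: if_False)
      then show ?thesis by simp
    qed
    have "int k dvd z $ i"
    proof (rule column_primitive[OF i])
      show "int k > 0" using k by simp
      fix l assume l: "l < DIM('a)"
      \<comment> \<open>Row \<open>l\<close> of \<open>V z = 0\<close>, solved for the summand of
        column \<open>i\<close>.\<close>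
      have "0 = (\<Sum>j<m. V $$ (l, j) * z $ j)"
        using arg_cong[OF Vz, of "\<lambda>v. v $ l"] l V z by (simp add: scalar_prod_def lessThan_atLeast0)
      also have "\<dots> = V $$ (l, i) * z $ i + (\<Sum>j\<in>{..<m} - {i}. V $$ (l, j) * z $ j)"
        using i by (simp add: sum.remove)
      also have "(\<Sum>j\<in>{..<m} - {i}. V $$ (l, j) * z $ j)
          = int k * (\<Sum>j\<in>{..<m} - {i}. V $$ (l, j) * (z $ j div int k))"
        unfolding sum_distrib_left using other by (intro sum.cong) auto
      finally show "z $ i * V $$ (l, i) = int k * - (\<Sum>j\<in>{..<m} - {i}. V $$ (l, j) * (z $ j div int k))"
        by (simp add: mult.commute)
    qed
    then have dvd: "int k dvd z $ j" if "j < m" for j using other that by (cases "j = i") auto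
    define y where "y = vec m (\<lambda>j. z $ j div int k)"
    have y: "y \<in> carrier_vec m" by (simp add: y_def)
    have zy: "z = int k \<cdot>\<^sub>v y" using z dvd by (intro eq_vecI) (auto simp: y_def)
    have "V *\<^sub>v z = int k \<cdot>\<^sub>v (V *\<^sub>v y)" unfolding zy using V y by (intro eq_vecI) auto
    then have "int k * (V *\<^sub>v y) $ l = 0" if "l < DIM('a)" for l
      using arg_cong[OF Vz, of "\<lambda>v. v $ l"] that V by simp
    then have "V *\<^sub>v y = 0\<^sub>v DIM('a)" using k V by (intro eq_vecI) auto
    then obtain d where d: "d \<in> carrier_vec r" "y = transpose_mat Q *\<^sub>v d"
      using basis y by (auto simp: kernel_basis_def m)
    have "x = transpose_mat ?Qi *\<^sub>v d"
    proof (rule eq_vecI)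
      fix j assume "j < dim_vec (transpose_mat ?Qi *\<^sub>v d)"
      then have j: "j < m - 1" using Qi by simp
      let ?j = "if j < i then j else Suc j"
      have "?j < m" using i j by auto
      then have "z $ ?j = int k * y $ ?j"
        unfolding zy by (intro index_smult_vec(1)) (simp only: carrier_vecD[OF y])
      then have "int k * x $ j = int k * y $ ?j" using zx[OF j] by (simp only:)
      then show "x $ j = (transpose_mat ?Qi *\<^sub>v d) $ j" using k delete[OF d(1) j] d(2) by simp
    qed (use x Qi in auto)
    then show "x \<in> row_lattice ?Qi" using d(1) unfolding row_lattice_eq[OF Qi] by blast
  qed
qed

lemma reduced_weight_matrix_of_gale_dual:
  assumes "gale_dual DIM('a) r V Q" and m: "m = DIM('a) + r"
  shows "reduced_weight_matrix N \<Sigma> r m \<rho> Q"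
proof -
  have "Q \<in> carrier_mat r m" "kernel_basis DIM('a) r V Q" using assms by (auto simp: gale_dual_iff)
  then show ?thesis
    using weight_matrix_iff_kernel_basis[OF m] torsion_free_delete_col[OF m]
    by (simp add: reduced_weight_matrix_def)
qed

text \<open>The rows of \<open>V\<close> are independent and orthogonal to the rows of \<open>Q\<close>. An integer vector \<open>w\<close> that is
orthogonal to the rows of \<open>Q\<close> has a non-zero multiple in the row lattice of \<open>V\<close>: a multiple of the divisor
with coefficients \<open>w\<close> is principal. If the class group has no torsion, this divisor is principal
itself, and \<open>w\<close> is a combination of the rows of \<open>V\<close>.\<close>

lemma gale_dual_of_weight_matrix:
  assumes W: "weight_matrix N \<Sigma> r m \<rho> Q" and m: "m = DIM('a) + r"
    and free: "torsion_free (class_group N \<Sigma>)"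
  shows "gale_dual r DIM('a) Q V"
proof -
  have Q: "Q \<in> carrier_mat r (DIM('a) + r)" and basis: "kernel_basis DIM('a) r V Q"
    using W weight_matrix_iff_kernel_basis[OF m] m by auto
  have V': "V \<in> carrier_mat DIM('a) (DIM('a) + r)" using V m by simp
  have rank: "rank_int Q = r"
    using basis unfolding rank_int_full_iff[OF Q] by (simp add: kernel_basis_def)
  have inj: "\<forall>x\<in>carrier_vec DIM('a). transpose_mat V *\<^sub>v x = 0\<^sub>v (DIM('a) + r) \<longrightarrow> x = 0\<^sub>v DIM('a)"
    using rank_V rank_int_full_iff[OF V'] by simp
  have "\<exists>x\<in>carrier_vec DIM('a). w = transpose_mat V *\<^sub>v x"
    if w: "w \<in> carrier_vec (DIM('a) + r)" "Q *\<^sub>v w = 0\<^sub>v r" for w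
  proof -
    let ?T = "torus_divisors \<Sigma>" and ?P = "principal_divisors N \<Sigma>"
    obtain k y where k: "k \<noteq> 0" and y: "y \<in> carrier_vec DIM('a)" "k \<cdot>\<^sub>v w = transpose_mat V *\<^sub>v y"
      using multiple_in_row_lattice[OF V' Q rank_V basis w] .
    have wm: "w \<in> carrier_vec m" using w(1) m by simp
    have D: "divisor \<rho> w \<in> carrier ?T" using divisor_carrier[of \<rho> m "rays \<Sigma>" w] enum_inj_image(2) wm by simp
    \<comment> \<open>The square of \<open>k\<close> is a positive multiplier, as the definition of
      torsion requires.\<close>
    have "(k * k) \<cdot>\<^sub>v w = k \<cdot>\<^sub>v (k \<cdot>\<^sub>v w)" by (simp add: smult_smult_assoc)
    also have "\<dots> = transpose_mat V *\<^sub>v (k \<cdot>\<^sub>v y)" unfolding y(2) using V y(1) by (intro eq_vecI) auto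
    finally have "divisor \<rho> ((k * k) \<cdot>\<^sub>v w) \<in> ?P" unfolding principal_divisors_eq using y(1) by auto
    moreover have "k * k > 0" using k by (auto simp: zero_less_mult_iff)
    ultimately have "divisor \<rho> w [^]\<^bsub>?T\<^esub> nat (k * k) \<in> ?P" "nat (k * k) > 0"
      by (simp_all add: frag_cmul_divisor)
    then have "divisor \<rho> w \<in> ?P"
      using free D torsion_free_FactGroup_iff[OF abelian_free_Abelian_group principal_subgroup]
      unfolding class_group_def by blast
    then obtain x where x: "x \<in> carrier_vec DIM('a)" "divisor \<rho> w = divisor \<rho> (transpose_mat V *\<^sub>v x)"
      unfolding principal_divisors_eq by blast
    then have "w = transpose_mat V *\<^sub>v x"
      using divisor_inj[OF enum_inj_image(1) wm transpose_mult_carrier[OF V]] by blast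
    with x(1) show ?thesis by blast
  qed
  then have "kernel_basis r DIM('a) Q V"
    using inj kernel_basis_swap[OF V' Q basis] by (simp add: kernel_basis_def add.commute)
  then show "gale_dual r DIM('a) Q V" using Q V' rank by (simp add: gale_dual_iff add.commute)
qed

text \<open>Multiplying the coordinates by \<open>P\<close> amounts to passing to the basis that is given by the columns of
the inverse \<open>W\<close> of \<open>P\<close>.\<close>

lemma fan_matrix_change_basis:
  assumes P: "P \<in> GL_Z DIM('a)"
  shows "fan_matrix N m \<rho> (P * V)"
proof -
  let ?n = "DIM('a)"
  obtain W where W: "W \<in> carrier_mat ?n ?n" "P * W = 1\<^sub>m ?n" "W * P = 1\<^sub>m ?n" and Pc: "P \<in> carrier_mat ?n ?n"
    using P GL_Z_iff by blast
  define b' where "b' k = comb (\<lambda>i. real_of_int (W $$ (i, k)))" for k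
  have b'N: "b' \<in> {..<?n} \<rightarrow> N" using lattice_eq by (auto simp: b'_def)
  have b'_comb: "(\<Sum>k<?n. t k *\<^sub>R b' k) = comb (\<lambda>i. \<Sum>k<?n. t k * real_of_int (W $$ (i, k)))" for t
  proof -
    have "(\<Sum>k<?n. t k *\<^sub>R b' k) = (\<Sum>k<?n. \<Sum>i<?n. (t k * real_of_int (W $$ (i, k))) *\<^sub>R b i)"
      by (intro sum.cong) (simp_all add: b'_def comb_def scaleR_sum_right)
    also have "\<dots> = comb (\<lambda>i. \<Sum>k<?n. t k * real_of_int (W $$ (i, k)))"
      unfolding comb_def scaleR_sum_left by (rule sum.swap)
    finally show ?thesis .
  qed
  have W_index: "(W *\<^sub>v c) $ i = (\<Sum>k<?n. c $ k * W $$ (i, k))" if "c \<in> carrier_vec ?n" "i < ?n" for c i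
    using that W(1) by (auto simp: scalar_prod_def lessThan_atLeast0 mult.commute)
  have b'_int: "(\<Sum>k<?n. real_of_int (c $ k) *\<^sub>R b' k) = comb (\<lambda>i. real_of_int ((W *\<^sub>v c) $ i))"
    if "c \<in> carrier_vec ?n" for c
    unfolding b'_comb comb_eq_iff using W_index[OF that] by simp
  have Z_comb: "Z_combination (lattice_group N) ?n b' c = comb (\<lambda>i. real_of_int ((W *\<^sub>v vec ?n c) $ i))" for c
    using b'_int[of "vec ?n c"] by (simp add: Z_combination_lattice_group[OF lattice b'N])
  have "Z_basis (lattice_group N) ?n b'"
    unfolding Z_basis_def Z_independent_def
  proof (intro conjI allI impI ballI)
    show "b' \<in> {..<?n} \<rightarrow> carrier (lattice_group N)" using b'N by simp
    fix c and i assume zero: "Z_combination (lattice_group N) ?n b' c = \<one>\<^bsub>lattice_group N\<^esub>" and i: "i < ?n"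
    then have "comb (\<lambda>i. real_of_int ((W *\<^sub>v vec ?n c) $ i)) = 0" by (simp add: Z_comb)
    then have "(W *\<^sub>v vec ?n c) $ i = 0" if "i < ?n" for i
      using comb_eq_0[of "\<lambda>i. real_of_int ((W *\<^sub>v vec ?n c) $ i)" i] that by simp
    then have "W *\<^sub>v vec ?n c = 0\<^sub>v ?n" using W(1) by (intro eq_vecI) auto
    then have "P *\<^sub>v (W *\<^sub>v vec ?n c) = 0\<^sub>v ?n" using Pc by auto
    then have "vec ?n c = 0\<^sub>v ?n" using assoc_mult_mat_vec[OF Pc W(1), of "vec ?n c"] W(2) by simp
    from arg_cong[OF this, of "\<lambda>v. v $ i"] show "c i = 0" using i by simp
  next
    fix x assume "x \<in> carrier (lattice_group N)"
    then obtain d where d: "x = comb (\<lambda>i. real_of_int (d i))" using lattice_eq by auto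
    let ?c = "P *\<^sub>v vec ?n d"
    have c: "?c \<in> carrier_vec ?n" using Pc by simp
    have "W *\<^sub>v ?c = vec ?n d" using assoc_mult_mat_vec[OF W(1) Pc, of "vec ?n d"] W(3) by simp
    moreover have "vec ?n (($) ?c) = ?c" using c by (rule vec_index_self)
    ultimately have "Z_combination (lattice_group N) ?n b' (($) ?c) = comb (\<lambda>i. real_of_int (vec ?n d $ i))"
      by (simp add: Z_comb)
    also have "\<dots> = x" unfolding d comb_eq_iff by simp
    finally show "\<exists>c. x = Z_combination (lattice_group N) ?n b' c" by blast
  qed
  moreover have "gen j = (\<Sum>i<?n. real_of_int ((P * V) $$ (i, j)) *\<^sub>R b' i)" if j: "j < m" for j
  proof -
    have colV: "col V j \<in> carrier_vec ?n" using V j by auto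
    have col: "col (P * V) j = P *\<^sub>v col V j" using Pc V j by (intro eq_vecI) auto
    have colc: "P *\<^sub>v col V j \<in> carrier_vec ?n" by (rule mult_mat_vec_carrier[OF Pc colV])
    have "(\<Sum>i<?n. real_of_int ((P * V) $$ (i, j)) *\<^sub>R b' i) = (\<Sum>i<?n. real_of_int ((P *\<^sub>v col V j) $ i) *\<^sub>R b' i)"
      using Pc V j by (intro sum.cong) auto
    also have "\<dots> = comb (\<lambda>i. real_of_int ((W *\<^sub>v (P *\<^sub>v col V j)) $ i))" by (rule b'_int[OF colc])
    also have "W *\<^sub>v (P *\<^sub>v col V j) = col V j"
      using assoc_mult_mat_vec[OF W(1) Pc colV] W(3) colV by simp
    also have "comb (\<lambda>i. real_of_int (col V j $ i)) = gen j"
      unfolding gens[OF j] comb_eq_iff using V j by simp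
    finally show ?thesis by (rule sym)
  qed
  moreover have "P * V \<in> carrier_mat ?n m" using Pc V by simp
  ultimately show ?thesis unfolding fan_matrix_def by blast
qed

text \<open>The assumption says that the columns generate the lattice. The other conditions on a \<open>CF\<close>-matrix hold
because the ray generators span the space positively, are non-zero, and lie on distinct rays.\<close>

lemma CF_matrix_V:
  assumes m: "m = DIM('a) + r"
    and generate: "\<And>y. y \<in> carrier_vec DIM('a) \<Longrightarrow> \<exists>x\<in>carrier_vec m. V *\<^sub>v x = y"
  shows "CF_matrix DIM('a) r V"
proof -
  let ?n = "DIM('a)"
  note props = ray_generator_props[OF ray]
  have cone: "y \<in> {map_mat real_of_int V *\<^sub>v c | c. c \<in> carrier_vec m \<and> (\<forall>j<m. c $ j \<ge> 0)}"
    if y: "y \<in> carrier_vec ?n" for y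
  proof -
    obtain c where c: "\<forall>j<m. c j \<ge> 0" "comb (($) y) = (\<Sum>j<m. c j *\<^sub>R gen j)" using positively_span by blast
    have "y = map_mat real_of_int V *\<^sub>v vec m c"
    proof (rule eq_vecI)
      fix i assume "i < dim_vec (map_mat real_of_int V *\<^sub>v vec m c)"
      then have i: "i < ?n" using V by simp
      then have "y $ i = (\<Sum>j<m. c j * real_of_int (V $$ (i, j)))"
        using c(2) unfolding sum_gens comb_eq_iff by blast
      also have "\<dots> = (map_mat real_of_int V *\<^sub>v vec m c) $ i"
        using i V by (auto simp: scalar_prod_def lessThan_atLeast0 mult.commute intro!: sum.cong)
      finally show "y $ i = (map_mat real_of_int V *\<^sub>v vec m c) $ i" .
    qed (use V y in auto)
    then show ?thesis using c(1) by (intro CollectI exI[of _ "vec m c"]) auto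
  qed
  have "{map_mat real_of_int V *\<^sub>v c | c. c \<in> carrier_vec m \<and> (\<forall>j<m. c $ j \<ge> 0)} = carrier_vec ?n"
    using V by (intro equalityI subsetI cone) auto
  moreover have "col V j \<noteq> 0\<^sub>v ?n" if j: "j < m" for j
  proof
    assume zero: "col V j = 0\<^sub>v ?n"
    have "V $$ (i, j) = 0" if "i < ?n" for i
      using arg_cong[OF zero, of "\<lambda>v. v $ i"] V j that by simp
    then have "gen j = 0" unfolding gens[OF j] comb_def by simp
    then show False using props(2)[OF j j] by simp
  qed
  moreover have "\<not> (\<exists>t>0. map_vec real_of_int (col V i) = t \<cdot>\<^sub>v map_vec real_of_int (col V j))"
    if ij: "i < m" "j < m" "i \<noteq> j" for i j
  proof
    assume "\<exists>t>0. map_vec real_of_int (col V i) = t \<cdot>\<^sub>v map_vec real_of_int (col V j)"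
    then obtain t :: real where t: "t > 0" "map_vec real_of_int (col V i) = t \<cdot>\<^sub>v map_vec real_of_int (col V j)" by blast
    have "real_of_int (V $$ (l, i)) = t * real_of_int (V $$ (l, j))" if "l < ?n" for l
      using arg_cong[OF t(2), of "\<lambda>v. v $ l"] V ij that by simp
    then have g: "gen i = t *\<^sub>R gen j" unfolding gens[OF ij(1)] gens[OF ij(2)] comb_scaleR comb_eq_iff by simp
    have "gen i \<in> \<rho> i" by (subst props(3)[OF ij(1) ij(1)]) (auto intro: exI[of _ 1])
    moreover have "\<rho> i \<subseteq> \<rho> j"
    proof
      fix x assume "x \<in> \<rho> i"
      then obtain s where s: "x = s *\<^sub>R gen i" "s \<ge> 0" using props(3)[OF ij(1) ij(1)] by blast
      then have "x = (s * t) *\<^sub>R gen j" "s * t \<ge> 0" using g t(1) by auto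
      then show "x \<in> \<rho> j" by (subst props(3)[OF ij(2) ij(2)]) blast
    qed
    moreover have "\<rho> j \<subseteq> \<rho> i"
    proof
      fix x assume "x \<in> \<rho> j"
      then obtain s where s: "x = s *\<^sub>R gen j" "s \<ge> 0" using props(3)[OF ij(2) ij(2)] by blast
      then have "x = (s / t) *\<^sub>R gen i" "s / t \<ge> 0" using g t(1) by auto
      then show "x \<in> \<rho> i" by (subst props(3)[OF ij(1) ij(1)]) blast
    qed
    ultimately show False using inj_onD[OF enum_inj_image(1), of i j] ij by auto
  qed
  moreover have "generate (monoid_vec TYPE(int) ?n) (set (cols V)) = carrier_vec ?n"
  proof -
    have "row_lattice (transpose_mat V) = {V *\<^sub>v x | x. x \<in> carrier_vec m}"
      using row_lattice_eq[of "transpose_mat V" m ?n] V by simp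
    also have "\<dots> = carrier_vec ?n"
    proof (intro equalityI subsetI)
      fix y assume "y \<in> {V *\<^sub>v x | x. x \<in> carrier_vec m}"
      then show "y \<in> carrier_vec ?n" using V by auto
    qed (use generate in blast)
    finally show ?thesis using V by (simp add: row_lattice_def)
  qed
  ultimately show ?thesis using V rank_V unfolding CF_matrix_def m by blast
qed

end

text \<open>In this form the results on a fixed fan matrix apply to any fan matrix, with the lattice basis that
comes with it.\<close>

lemma complete_simplicial_fan_of_fan_matrix:
  fixes N :: "'a::euclidean_space set"
  assumes "lattice_in N" "fan N \<Sigma>" "\<forall>\<sigma>\<in>\<Sigma>. simplicial_cone N \<sigma>" "\<Union>\<Sigma> = UNIV"
    "bij_betw \<rho> {..<m} (rays \<Sigma>)" "fan_matrix N m \<rho> V"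
  obtains b where "complete_simplicial_fan N b \<Sigma> \<rho> m V"
proof -
  obtain b where b: "V \<in> carrier_mat DIM('a) m" "Z_basis (lattice_group N) DIM('a) b"
      "\<forall>j<m. ray_generator N (\<rho> j) = (\<Sum>i<DIM('a). real_of_int (V $$ (i, j)) *\<^sub>R b i)"
    using assms(6) by (auto simp: fan_matrix_def)
  interpret based_lattice N b using assms(1) b(2) by unfold_locales
  have "complete_simplicial_fan N b \<Sigma> \<rho> m V"
    using assms b(1,3) by unfold_locales (auto simp: comb_def)
  then show thesis by (rule that)
qed

lemma fan_matrix_exists:
  fixes N :: "'a::euclidean_space set"
  assumes "lattice_in N" "\<forall>\<sigma>\<in>\<Sigma>. simplicial_cone N \<sigma>" "bij_betw \<rho> {..<m} (rays \<Sigma>)"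
  obtains V where "fan_matrix N m \<rho> V"
proof -
  obtain b where b: "Z_basis (lattice_group N) DIM('a) b" using lattice_basis_exists[OF assms(1)] .
  interpret based_lattice N b using assms(1) b by unfold_locales
  have "\<exists>c. ray_generator N (\<rho> j) = comb (\<lambda>i. real_of_int (c i))" if "j < m" for j
  proof -
    have "\<rho> j \<in> rays \<Sigma>" using assms(3) that by (auto simp: bij_betw_def)
    then have "ray_generator N (\<rho> j) \<in> N"
      using assms(2) by (intro ray_generator_props(1)) (auto simp: rays_def)
    then show ?thesis using lattice_eq by blast
  qed
  then obtain c where c: "\<And>j. j < m \<Longrightarrow> ray_generator N (\<rho> j) = comb (\<lambda>i. real_of_int (c j i))" by metis
  have "fan_matrix N m \<rho> (mat DIM('a) m (\<lambda>(i, j). c j i))"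
    unfolding fan_matrix_def using b c by (auto simp: comb_def intro!: exI[of _ b])
  then show thesis by (rule that)
qed

theorem proposition4p3:
  fixes N :: "'a::euclidean_space set" and \<Sigma> :: "'a set set" and \<rho> :: "nat \<Rightarrow> 'a set"
    and n r :: nat
  assumes "lattice_in N" and "n = DIM('a)"
    and "fan N \<Sigma>" and "\<forall>\<sigma>\<in>\<Sigma>. simplicial_cone N \<sigma>" and "\<Union>\<Sigma> = UNIV"
    and "r = abelian_rank (picard_group N \<Sigma>)" and "r \<ge> 1"
    and "bij_betw \<rho> {..<n + r} (rays \<Sigma>)"
  shows "(\<forall>V. fan_matrix N (n + r) \<rho> V \<longrightarrow>
            (\<exists>Q. gale_dual n r V Q) \<and>
            (\<forall>Q. gale_dual n r V Q \<longrightarrow>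
               reduced_weight_matrix N \<Sigma> r (n + r) \<rho> Q \<and>
               (\<exists>U\<in>GL_Z (n + r). hermite_normal_form (U * transpose_mat V) \<and> Q = last_rows r U)))
       \<and> (\<forall>Q. reduced_weight_matrix N \<Sigma> r (n + r) \<rho> Q \<and> free_abelian (class_group N \<Sigma>) \<longrightarrow>
            (\<exists>V. gale_dual r n Q V) \<and>
            (\<forall>V. gale_dual r n Q V \<longrightarrow>
               CF_matrix n r V \<and> fan_matrix N (n + r) \<rho> V \<and>
               (\<exists>U\<in>GL_Z (n + r). hermite_normal_form (U * transpose_mat Q) \<and> V = last_rows n U)))"
proof (intro conjI allI impI)
  note n = assms(2)
  note to_locale = complete_simplicial_fan_of_fan_matrix[OF assms(1,3,4,5,8)]
  {
    fix V assume V: "fan_matrix N (n + r) \<rho> V"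
    obtain b where "complete_simplicial_fan N b \<Sigma> \<rho> (n + r) V" using to_locale[OF V] .
    then interpret complete_simplicial_fan N b \<Sigma> \<rho> "n + r" V .
    show "\<exists>Q. gale_dual n r V Q" using gale_dual_exists V rank_V unfolding n fan_matrix_def by blast
    fix Q assume Q: "gale_dual n r V Q"
    then show "reduced_weight_matrix N \<Sigma> r (n + r) \<rho> Q"
      unfolding n by (intro reduced_weight_matrix_of_gale_dual[unfolded n]) simp_all
    show "\<exists>U\<in>GL_Z (n + r). hermite_normal_form (U * transpose_mat V) \<and> Q = last_rows r U"
      using gale_dual_hermite[OF Q] .
  next
    fix Q assume "reduced_weight_matrix N \<Sigma> r (n + r) \<rho> Q \<and> free_abelian (class_group N \<Sigma>)"
    then have W: "weight_matrix N \<Sigma> r (n + r) \<rho> Q" and free: "free_abelian (class_group N \<Sigma>)"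
      by (auto simp: reduced_weight_matrix_def)
    obtain V0 where V0: "fan_matrix N (n + r) \<rho> V0" using fan_matrix_exists[OF assms(1,4,8)] .
    obtain b where "complete_simplicial_fan N b \<Sigma> \<rho> (n + r) V0" using to_locale[OF V0] .
    then interpret V0: complete_simplicial_fan N b \<Sigma> \<rho> "n + r" V0 .
    have "torsion_free (class_group N \<Sigma>)"
      using V0.comm_group_class_group free by (intro free_abelian_imp_torsion_free) (simp add: comm_group.axioms(2))
    then have gale0: "gale_dual r n Q V0"
      using V0.gale_dual_of_weight_matrix[OF W] n by simp
    then show "\<exists>V. gale_dual r n Q V" by blast
    fix V assume V: "gale_dual r n Q V"
    obtain P where P: "P \<in> GL_Z n" "V = P * V0"
      using kernel_basis_change[of V0 n r Q V] gale0 V by (auto simp: gale_dual_iff)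
    then show fan: "fan_matrix N (n + r) \<rho> V" using V0.fan_matrix_change_basis n by simp
    show hermite: "\<exists>U\<in>GL_Z (n + r). hermite_normal_form (U * transpose_mat Q) \<and> V = last_rows n U"
      using gale_dual_hermite[OF V] by (simp add: add.commute)
    obtain b' where "complete_simplicial_fan N b' \<Sigma> \<rho> (n + r) V" using to_locale[OF fan] .
    then interpret V: complete_simplicial_fan N b' \<Sigma> \<rho> "n + r" V .
    show "CF_matrix n r V"
      unfolding n
    proof (rule V.CF_matrix_V)
      show "n + r = DIM('a) + r" using n by simp
      fix y :: "int vec" assume "y \<in> carrier_vec DIM('a)"
      then show "\<exists>x\<in>carrier_vec (n + r). V *\<^sub>v x = y"
        using hermite last_rows_surj[of _ r n y] n by (auto simp: add.commute)
    qed
  }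
qed

end
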